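(* Let $s>0$ with $s$ not an odd positive integer, and let $(a_n)_{n=0}^\infty$ be a greedy $s$-energy sequence on $S^1$. Then for all $N\ge1$ \[ U_{N,s}(a_N)=v_sN+\frac{2}{(2\pi)^s}\sum_{j=0}^{\lfloor s/2\rfloor}\alpha_j(s)\,\zeta(s-2j)\,(2^{s-2j}-1)\,G(\eta(N);s-2j)\,N^{s-2j}+H_{N,s}, \] where the sequence $(H_{N,s})_{N=1}^\infty$ is uniformly bounded in $N$. In the special case when $s$ is a positive even integer, $v_s=0$ and $H_{N,s}=0$ for all $N\ge1$.
   Context: $S^1$ is the unit circle in $\mathbb{C}$. For $s>0$ let $K_s(x,y):=|x-y|^{-s}$ (with value $+\infty$ if $x=y$). A greedy $s$-energy sequence is a sequence $(a_n)_{n=0}^\infty\subset S^1$ with $a_0\in S^1$ arbitrary and, for each $n\ge1$, $a_n$ any point satisfying $\sum_{\ell=0}^{n-1}K_s(a_n,a_\ell)=\min_{x\in S^1}\sum_{\ell=0}^{n-1}K_s(x,a_\ell)$. Put $U_{N,s}(x):=\sum_{k=0}^{N-1}|x-a_k|^{-s}$. Write $N\in\mathbb{N}=\{1,2,\ldots\}$ in binary as $N=2^{n_1}+\cdots+2^{n_p}$ with integers $n_1>\cdots>n_p\ge 0$, and set $\eta(N):=\left(\frac{2^{n_1}}{N},\ldots,\frac{2^{n_p}}{N}\right)$. For a vector $\vec\theta=(\theta_1,\ldots,\theta_p)$ with positive components, $G(\vec\theta;t):=\sum_{k=1}^p\theta_k^t$. For $s\in\mathbb{C}\setminus\{1,3,5,\ldots\}$,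 $v_s:=\dfrac{2^{-s}\,\Gamma(\frac{1-s}{2})}{\sqrt\pi\,\Gamma(1-\frac s2)}$ (an analytic function of $s$ in this domain, with $1/\Gamma$ understood as an entire function). Let $\mathrm{sinc}\,z:=(\sin\pi z)/(\pi z)$ for $z\ne0$ and $\mathrm{sinc}\,0:=1$. For $s\in\mathbb{C}$, $|z|<1$, $\mathrm{sinc}^{-s}z:=\exp(-s\log\mathrm{sinc}\,z)$ with the analytic branch of $\log\mathrm{sinc}\,z$ vanishing at $z=0$; the coefficients $\alpha_n(s)$, $n\ge0$, are defined by $\mathrm{sinc}^{-s}z=\sum_{n=0}^\infty\alpha_n(s)z^{2n}$, $|z|<1$. $\zeta$ is the Riemann zeta function (analytically continued), and $\lfloor x\rfloor$ is the integer part of $x$. *)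

theory Defs
  imports "HOL-Complex_Analysis.Complex_Analysis"
begin

definition riesz_kernel :: "real \<Rightarrow> complex \<Rightarrow> complex \<Rightarrow> ereal" where
  "riesz_kernel s x y = (if x = y then \<infinity> else ereal (norm (x - y) powr (- s)))"

definition potential :: "real \<Rightarrow> (nat \<Rightarrow> complex) \<Rightarrow> nat \<Rightarrow> complex \<Rightarrow> ereal" where
  "potential s a N x = (\<Sum>k<N. riesz_kernel s x (a k))"

definition greedy_energy_seq :: "real \<Rightarrow> (nat \<Rightarrow> complex) \<Rightarrow> bool" where
  "greedy_energy_seq s a \<longleftrightarrow>
     (\<forall>n. a n \<in> sphere 0 1) \<and>
     (\<forall>n\<ge>1. \<forall>x\<in>sphere 0 1. potential s a n (a n) \<le> potential s a n x)"

text \<open>\<open>bit N k\<close> says that \<open>2 ^ k\<close> occurs in the binary expansion of \<open>N\<close>;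
  \<open>rev\<close> puts the exponents in decreasing order.\<close>

definition binary_exponents :: "nat \<Rightarrow> nat list" where
  "binary_exponents N = rev (sorted_list_of_set {k. bit N k})"

definition eta :: "nat \<Rightarrow> real list" where
  "eta N = map (\<lambda>k. 2 ^ k / real N) (binary_exponents N)"

definition G :: "real list \<Rightarrow> real \<Rightarrow> real" where
  "G \<theta> t = (\<Sum>x\<leftarrow>\<theta>. x powr t)"

text \<open>\<open>rGamma\<close> is the entire function \<open>1 / \<Gamma>\<close>.\<close>

definition v :: "complex \<Rightarrow> complex" where
  "v s = 2 powr (- s) * Gamma ((1 - s) / 2) * rGamma (1 - s / 2) / of_real (sqrt pi)"

definition sinc :: "complex \<Rightarrow> complex" where
  "sinc z = (if z = 0 then 1 else sin (of_real pi * z) / (of_real pi * z))"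

text \<open>The branch is unique on the unit disc; its values elsewhere are irrelevant.\<close>

definition log_sinc :: "complex \<Rightarrow> complex" where
  "log_sinc = (SOME L. L holomorphic_on ball 0 1 \<and> L 0 = 0 \<and> (\<forall>z\<in>ball 0 1. exp (L z) = sinc z))"

definition sinc_neg_power :: "complex \<Rightarrow> complex \<Rightarrow> complex" where
  "sinc_neg_power s z = exp (- s * log_sinc z)"

definition alpha :: "complex \<Rightarrow> nat \<Rightarrow> complex" where
  "alpha s = (THE c. \<forall>z\<in>ball 0 1. (\<lambda>n. c n * z ^ (2 * n)) sums sinc_neg_power s z)"

text \<open>The Riemann zeta function as the analytic continuation of its Dirichlet series to
  the plane without \<open>1\<close>; the value at the pole \<open>1\<close> is unspecified.\<close>

definition riemann_zeta :: "complex \<Rightarrow> complex" where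
  "riemann_zeta = (SOME f. f holomorphic_on - {1} \<and>
     (\<forall>w. Re w > 1 \<longrightarrow> (\<lambda>n. 1 / of_nat (Suc n) powr w) sums f w))"

end

theory Submission
  imports Defs
begin

text \<open>Greedy points on the circle come in blocks of equally spaced points. The potential of
  \<open>M\<close> equally spaced points is smallest exactly at the midpoints of the gaps between them, and these
  midpoints are again \<open>M\<close> equally spaced points. By induction, the first \<open>2 ^ n\<close> greedy points are the
  \<open>2 ^ n\<close>-th roots of unity up to a rotation. The points after them form a greedy sequence of their own, because
  this sequence always has a minimiser among the midpoints, where the potential of the full block is
  minimal too. So each minimiser of the total potential minimises both parts, and
  \<open>U\<^sub>N(a\<^sub>N)\<close> is the sum, over the powers \<open>2 ^ k\<close> in the binary expansion of \<open>N\<close>, of the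
  potential \<open>T(2 ^ k)\<close> of \<open>2 ^ k\<close> equally spaced points at the midpoint of a gap
  (\<open>greedy_potential\<close>).

  It remains to expand \<open>T(M) = \<Sum>i<M. (2 sin (\<pi>(2i+1)/(2M))) powr -s\<close> along \<open>M = 2 ^ n\<close> with an error that
  decays geometrically in \<open>n\<close>; the sum of these errors over the binary digits is then \<open>H\<close>. Near \<open>0\<close>
  the function \<open>(2 sin \<pi>x) powr -s\<close> is \<open>(2\<pi>) powr -s\<close> times
  \<open>\<Sum>j. \<alpha>\<^sub>j x powr (2j - s)\<close>. The terms with \<open>2j \<le> s\<close> are summed by
  \<open>\<Sum>i<m. (i+1/2) powr -\<sigma> = m powr (1-\<sigma>) / (1-\<sigma>) + (2 powr \<sigma> - 1) \<zeta>(\<sigma>) + o(m powr -\<sigma>)\<close>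
  with \<open>\<sigma> = s - 2j\<close>. The rest vanishes at \<open>0\<close> like a positive power of \<open>x\<close>, which suffices for the midpoint
  rule to converge faster than \<open>1/M\<close> (\<open>midpoint_chord_asymptotics\<close>).

  The coefficient of \<open>M\<close> is the finite part of a divergent integral over \<open>{0..1/2}\<close>. For \<open>s < 1\<close>
  the integral converges and is a Beta integral. A second-order differential equation passes from
  \<open>s\<close> to \<open>s + 2\<close>, as the functional equation of \<open>\<Gamma>\<close> does for \<open>v\<^sub>s\<close>
  (\<open>singular_const_eq\<close>). This starts from \<open>-1 < s < 1\<close> and breaks down at \<open>s = 0\<close>, so it leaves out even
  \<open>s\<close>. For these, \<open>1/sin\<^sup>2 x + 1/cos\<^sup>2 x = 4/sin\<^sup>2 2x\<close> shows that \<open>T(2 ^ n)\<close> is exactly a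
  combination of the sequences \<open>4 ^ n\<close>, \<open>16 ^ n\<close>, \<open>\<dots>\<close>. Its difference from the asymptotic expansion
  tends to \<open>0\<close> and is a combination of distinct sequences \<open>r ^ n\<close> with \<open>r > 1\<close>, hence is \<open>0\<close>: neither
  the linear term nor an error survives (\<open>dyadic_remainder_even\<close>).

  The function \<open>riemann_zeta\<close> is a chosen continuation of the Dirichlet series, so one has to exist on
  the whole plane. Expanding \<open>(n+1) powr (1-s)\<close> about \<open>n\<close> by Taylor's formula and summing over \<open>n\<close> expresses
  \<open>(s-1) \<zeta>(s)\<close> by the values at \<open>s+1\<close>, \<open>s+2\<close>, \<open>\<dots>\<close> and a series that converges further to the left
  (\<open>zeta_recursion\<close>). The recursion without any further value of \<open>\<zeta>\<close> gives the partial sums of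
  the Dirichlet series for \<open>s > 0\<close>.\<close>

section \<open>Greedy sequences on the circle\<close>

text \<open>The potential of \<open>M\<close> equally spaced points on the circle at the midpoint of a gap between two
  neighbours. The arguments of the sine are half the angles between this midpoint and the points.\<close>

definition midpoint_energy :: "real \<Rightarrow> nat \<Rightarrow> real" where
  "midpoint_energy s M = (\<Sum>i<M. (2 * sin (pi * real (2 * i + 1) / real (2 * M))) powr - s)"

lemma sin_mult_less_midpoint:
  assumes "0 < y" "y < pi" "0 < y'" "y' < pi" "y \<noteq> y'"
  shows "sin y * sin y' < sin ((y + y') / 2) ^ 2"
proof -
  define m d where "m = (y + y') / 2" and "d = (y - y') / 2"
  have y: "y = m + d" "y' = m - d" by (simp_all add: m_def d_def field_simps)
  have "sin d \<noteq> 0"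
    using sin_eq_0_pi[of d] assms by (auto simp: d_def)
  moreover have "sin y * sin y' = sin m ^ 2 * cos d ^ 2 - cos m ^ 2 * sin d ^ 2"
    unfolding y sin_add sin_diff by (simp add: algebra_simps power2_eq_square)
  then have "sin y * sin y' = sin m ^ 2 - sin d ^ 2"
    unfolding cos_squared_eq by (simp add: algebra_simps)
  ultimately show ?thesis by (simp add: m_def)
qed

text \<open>This is strict convexity of the kernel in the angle, in the only form that is used. By the inequality
  of arithmetic and geometric means it reduces to \<open>sin_mult_less_midpoint\<close>.\<close>

lemma riesz_midpoint_less:
  assumes s: "s > 0" and y: "0 < y" "y < pi" "0 < y'" "y' < pi" "y \<noteq> y'"
  shows "2 * (2 * sin ((y + y') / 2)) powr - s < (2 * sin y) powr - s + (2 * sin y') powr - s"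
proof -
  define a b q where "a = 2 * sin y" and "b = 2 * sin y'" and "q = 2 * sin ((y + y') / 2)"
  have pos: "a > 0" "b > 0" "q > 0"
    using y by (auto simp: a_def b_def q_def intro!: sin_gt_zero)
  have "a * b < q ^ 2"
    using sin_mult_less_midpoint[OF y] by (simp add: a_def b_def q_def power_mult_distrib)
  then have "(q ^ 2) powr (- s / 2) < (a * b) powr (- s / 2)"
    using s pos by (intro powr_less_mono2_neg) auto
  moreover have "(q ^ 2) powr (- s / 2) = q powr - s"
    using pos by (simp add: powr_powr powr_realpow[symmetric] del: powr_numeral)
  moreover have "(a * b) powr (- s / 2) = a powr (- s / 2) * b powr (- s / 2)"
    using pos by (simp add: powr_mult)
  moreover have "a powr - s = (a powr (- s / 2)) ^ 2" "b powr - s = (b powr (- s / 2)) ^ 2"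
    using pos by (simp_all add: power2_eq_square powr_add[symmetric])
  moreover have "2 * (a powr (- s / 2) * b powr (- s / 2)) \<le> (a powr (- s / 2)) ^ 2 + (b powr (- s / 2)) ^ 2"
    using zero_le_power2[of "a powr (- s / 2) - b powr (- s / 2)"]
    by (simp add: power2_diff)
  ultimately show ?thesis unfolding a_def[symmetric] b_def[symmetric] q_def[symmetric] by linarith
qed

text \<open>The reflection \<open>\<theta> \<mapsto> 2\<pi>/M - \<theta>\<close> of a gap only permutes the summands, so \<open>2 U\<close> pairs each angle
  with its mirror image and convexity applies to every pair.\<close>

lemma shifted_energy_ge_midpoint_energy:
  assumes s: "s > 0" and M: "M > 0" and \<theta>: "0 < \<theta>" "\<theta> < 2 * pi / M"
  defines "U \<equiv> (\<Sum>j<M. (2 * sin ((\<theta> + 2 * pi * real j / M) / 2)) powr - s)"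
  shows "midpoint_energy s M \<le> U" and "U = midpoint_energy s M \<longleftrightarrow> \<theta> = pi / M"
proof -
  define y where "y t j = (t + 2 * pi * real j / M) / 2" for t and j :: nat
  let ?f = "\<lambda>x. (2 * sin x) powr - s"
  have mid: "midpoint_energy s M = (\<Sum>j<M. ?f (y (pi / M) j))"
    unfolding midpoint_energy_def y_def using M by (intro sum.cong refl arg_cong[where f = ?f]) (simp add: field_simps)
  have rng: "0 < y t j" "y t j < pi" if "0 < t" "t < 2 * pi / M" "j < M" for t j
  proof -
    show "0 < y t j" using that add_pos_nonneg[of t "2 * pi * real j / M"] by (simp add: y_def)
    have "real j + 1 \<le> real M" using that by linarith
    then have "2 * pi * (real j + 1) \<le> 2 * pi * real M" by (intro mult_left_mono) auto
    then have "2 * pi * (real j + 1) / M \<le> 2 * pi" using M by (simp add: pos_divide_le_eq)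
    also have "2 * pi * (real j + 1) / M = 2 * pi / M + 2 * pi * real j / M" by (simp add: field_simps add_divide_distrib)
    finally have "t + 2 * pi * real j / M < 2 * pi" by (rule less_le_trans[OF add_strict_right_mono[OF that(2)]])
    then show "y t j < pi" by (simp add: y_def)
  qed
  have U: "U = (\<Sum>j<M. ?f (y \<theta> j))" by (simp add: U_def y_def)
  have "U = (\<Sum>j<M. ?f (y \<theta> (M - Suc j)))"
    unfolding U by (rule sum.nat_diff_reindex[symmetric])
  also have "\<dots> = (\<Sum>j<M. ?f (y (2 * pi / M - \<theta>) j))"
  proof (rule sum.cong[OF refl])
    fix j assume "j \<in> {..<M}"
    then have "y \<theta> (M - Suc j) = pi - y (2 * pi / M - \<theta>) j"
      using M by (simp add: y_def of_nat_diff field_simps)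
    then show "?f (y \<theta> (M - Suc j)) = ?f (y (2 * pi / M - \<theta>) j)" by simp
  qed
  finally have U2: "2 * U = (\<Sum>j<M. ?f (y \<theta> j) + ?f (y (2 * pi / M - \<theta>) j))"
    unfolding sum.distrib using U by simp
  have mm: "(y \<theta> j + y (2 * pi / M - \<theta>) j) / 2 = y (pi / M) j" for j
    by (simp add: y_def field_simps)
  have strict: "2 * midpoint_energy s M < 2 * U" if "\<theta> \<noteq> pi / M"
  proof -
    have "(\<Sum>j<M. 2 * ?f (y (pi / M) j)) < (\<Sum>j<M. ?f (y \<theta> j) + ?f (y (2 * pi / M - \<theta>) j))"
    proof (rule sum_strict_mono)
      fix j assume j: "j \<in> {..<M}"
      have "y \<theta> j \<noteq> y (2 * pi / M - \<theta>) j"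
      proof
        assume "y \<theta> j = y (2 * pi / M - \<theta>) j"
        then have "\<theta> + \<theta> = 2 * (pi / M)" by (simp add: y_def)
        then show False using that by linarith
      qed
      then show "2 * ?f (y (pi / M) j) < ?f (y \<theta> j) + ?f (y (2 * pi / M - \<theta>) j)"
        using riesz_midpoint_less[OF s rng[of \<theta> j] rng[of "2 * pi / M - \<theta>" j]] \<theta> j
        unfolding mm by auto
    qed (use M in auto)
    then show ?thesis unfolding U2 mid by (simp add: sum_distrib_left)
  qed
  have eq: "U = midpoint_energy s M" if "\<theta> = pi / M" unfolding U mid that by simp
  show "midpoint_energy s M \<le> U" using strict eq by fastforce
  show "U = midpoint_energy s M \<longleftrightarrow> \<theta> = pi / M" using strict eq by fastforce
qed

lemma riesz_kernel_nonneg: "0 \<le> riesz_kernel s x y"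
  by (simp add: riesz_kernel_def)

text \<open>The equality case is what forces greedy points to be midpoints. Rotating by a root of unity brings
  \<open>x\<close> into the gap after \<open>c\<close>; the angle \<open>\<theta>\<close> from the start of its gap is \<open>1/M\<close> times the argument of
  \<open>(x/c) ^ M\<close>.\<close>

lemma roots_potential:
  assumes s: "s > 0" and M: "M > 0" and c: "norm c = 1" and x: "norm x = 1"
  defines "U \<equiv> (\<Sum>z | z ^ M = c ^ M. riesz_kernel s x z)"
  shows "ereal (midpoint_energy s M) \<le> U" and "U = ereal (midpoint_energy s M) \<longleftrightarrow> x ^ M = - (c ^ M)"
proof -
  have c0: "c \<noteq> 0" and x0: "x \<noteq> 0" using c x by auto
  define \<psi> where "\<psi> = Arg2pi ((x / c) ^ M)"
  define \<theta> where "\<theta> = \<psi> / M"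
  \<comment> \<open>the \<open>M\<close>-th root of \<open>c ^ M\<close> at which the gap containing \<open>x\<close> starts\<close>
  define c' where "c' = x * cis (- \<theta>)"
  have \<psi>: "0 \<le> \<psi>" "\<psi> < 2 * pi" by (auto simp: \<psi>_def Arg2pi_lt_2pi Arg2pi_ge_0)
  have cis\<psi>: "(x / c) ^ M = cis \<psi>"
    using Arg2pi_eq[of "(x / c) ^ M"] c x by (simp add: \<psi>_def cis_conv_exp norm_power norm_divide)
  have \<theta>: "0 \<le> \<theta>" "\<theta> < 2 * pi / M" using \<psi> M by (auto simp: \<theta>_def field_simps)
  have xc': "x = c' * cis \<theta>" by (simp add: c'_def mult.assoc cis_mult)
  have c'M: "c' ^ M = c ^ M"
  proof -
    have "real M * - \<theta> = - \<psi>" using M by (simp add: \<theta>_def)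
    then have "cis (- \<theta>) ^ M = cis (- \<psi>)" using Complex.DeMoivre[of "- \<theta>" M] by (simp only:)
    then have "c' ^ M = x ^ M * cis (- \<psi>)" by (simp only: c'_def power_mult_distrib)
    also have "x ^ M = c ^ M * cis \<psi>" using cis\<psi> c0 by (simp add: power_divide field_simps)
    finally show ?thesis by (simp add: mult.assoc cis_mult)
  qed
  have c'0: "c' \<noteq> 0" "norm c' = 1" using x0 x by (auto simp: c'_def norm_mult)
  have bij: "bij_betw (\<lambda>j. c' / cis (2 * pi * real j / real M)) {..<M} {z. z ^ M = c ^ M}"
  proof -
    have "bij_betw (\<lambda>w. c' / w) {z. z ^ M = 1} {z. z ^ M = c ^ M}"
      using c'0 M c0 by (intro bij_betwI[of _ _ _ "\<lambda>w. c' / w"]) (auto simp: power_divide c'M power_0_left)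
    from bij_betw_trans[OF Complex.bij_betw_roots_unity[OF M] this] show ?thesis by (simp add: o_def)
  qed
  define y where "y j = (\<theta> + 2 * pi * real j / M) / 2" for j :: nat
  have dist: "norm (x - c' / cis (2 * pi * real j / real M)) = 2 * \<bar>sin (y j)\<bar>" for j
  proof -
    have "cis (- (2 * pi * real j / M)) * cis (2 * y j) = cis \<theta>"
    proof -
      have half: "2 * (a / 2) = a" for a :: real by simp
      show ?thesis unfolding cis_mult y_def half by simp
    qed
    moreover have "c' / cis (2 * pi * real j / M) = c' * cis (- (2 * pi * real j / M))"
      by (simp only: divide_inverse cis_inverse)
    ultimately have "x - c' / cis (2 * pi * real j / M) = c' * cis (- (2 * pi * real j / M)) * (cis (2 * y j) - 1)"
      by (simp only: xc' right_diff_distrib mult.assoc mult_1_right)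
    then show ?thesis using dist_exp_i_1[of "2 * y j"] c'0
      by (simp only: norm_mult norm_cis cis_conv_exp mult_1_left mult_1_right) simp
  qed
  have yr: "0 \<le> y j" "y j < pi" if "j < M" for j
  proof -
    have p: "2 * pi * real j / M \<ge> 0" by simp
    then show "0 \<le> y j" using \<theta> by (simp add: y_def)
    have "real j + 1 \<le> real M" using that by linarith
    then have "2 * pi * (real j + 1) \<le> 2 * pi * real M" by (intro mult_left_mono) auto
    then have "2 * pi * (real j + 1) / M \<le> 2 * pi" using M by (simp add: pos_divide_le_eq)
    also have "2 * pi * (real j + 1) / M = 2 * pi / M + 2 * pi * real j / M" by (simp add: field_simps add_divide_distrib)
    finally have "\<theta> + 2 * pi * real j / M < 2 * pi" by (rule less_le_trans[OF add_strict_right_mono[OF \<theta>(2)]])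
    then show "y j < pi" by (simp add: y_def)
  qed
  have U: "U = (\<Sum>j<M. riesz_kernel s x (c' / cis (2 * pi * real j / real M)))"
    unfolding U_def by (rule sum.reindex_bij_betw[OF bij, symmetric])
  have key: "ereal (midpoint_energy s M) \<le> U \<and> (U = ereal (midpoint_energy s M) \<longleftrightarrow> \<psi> = pi)"
  proof (cases "\<theta> = 0")
    case True
    have "riesz_kernel s x (c' / cis (2 * pi * real 0 / real M)) = \<infinity>"
      using True xc' by (simp add: riesz_kernel_def)
    then have "U = \<infinity>" unfolding U sum_Pinfty using M by blast
    moreover have "\<psi> \<noteq> pi" using True M by (auto simp: \<theta>_def)
    ultimately show ?thesis by simp
  next
    case False
    have "riesz_kernel s x (c' / cis (2 * pi * real j / real M)) = ereal ((2 * sin (y j)) powr - s)"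
      if "j < M" for j
    proof -
      have "0 < y j" using yr[OF that] False \<theta> by (auto simp: y_def add_pos_nonneg)
      then have "sin (y j) > 0" using yr[OF that] by (intro sin_gt_zero)
      then show ?thesis using dist[of j] by (auto simp: riesz_kernel_def)
    qed
    then have "U = ereal (\<Sum>j<M. (2 * sin ((\<theta> + 2 * pi * real j / M) / 2)) powr - s)"
      unfolding U by (simp add: y_def)
    moreover have "\<theta> = pi / M \<longleftrightarrow> \<psi> = pi" using M by (simp add: \<theta>_def field_simps)
    ultimately show ?thesis
      using shifted_energy_ge_midpoint_energy[OF s M, of \<theta>] False \<theta> by simp
  qed
  have "\<psi> = pi \<longleftrightarrow> cis \<psi> = -1"
  proof
    assume e: "cis \<psi> = -1"
    then have "cos \<psi> = -1" "sin \<psi> = 0" by (simp_all add: complex_eq_iff)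
    then have "\<psi> \<noteq> 0" "sin (\<psi> - pi) = 0" by (auto simp: sin_diff)
    then show "\<psi> = pi" using sin_eq_0_pi[of "\<psi> - pi"] \<psi> by simp
  qed (simp add: cis_pi)
  also have "\<dots> \<longleftrightarrow> x ^ M = - (c ^ M)"
  proof -
    have "x ^ M = cis \<psi> * c ^ M" using cis\<psi> c0 by (simp add: power_divide field_simps)
    then show ?thesis using mult_right_cancel[of "c ^ M" "cis \<psi>" "-1"] c0 by simp
  qed
  finally show "ereal (midpoint_energy s M) \<le> U" and "U = ereal (midpoint_energy s M) \<longleftrightarrow> x ^ M = - (c ^ M)"
    using key by auto
qed

text \<open>Greediness of finitely many points: unlike the condition on the whole sequence, it can be stated for a
  block of a sequence and for a block whose last point has been exchanged.\<close>

definition greedy_prefix :: "real \<Rightarrow> (nat \<Rightarrow> complex) \<Rightarrow> nat \<Rightarrow> bool" where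
  "greedy_prefix s a L \<longleftrightarrow>
     (\<forall>k<L. norm (a k) = 1 \<and> (\<forall>x. norm x = 1 \<longrightarrow> potential s a k (a k) \<le> potential s a k x))"

lemma greedy_prefix_mono: "greedy_prefix s a L \<Longrightarrow> L' \<le> L \<Longrightarrow> greedy_prefix s a L'"
  by (auto simp: greedy_prefix_def)

lemma potential_cong: "(\<And>i. i < k \<Longrightarrow> a i = b i) \<Longrightarrow> potential s a k x = potential s b k x"
  by (auto simp: potential_def intro!: sum.cong)

lemma potential_nonneg: "0 \<le> potential s a k x"
  unfolding potential_def by (intro sum_nonneg riesz_kernel_nonneg)

lemma potential_add: "potential s a (m + j) x = potential s a m x + potential s (\<lambda>i. a (m + i)) j x"
  by (induction j) (simp_all add: potential_def add.assoc)

lemma potential_eq_infinity_iff: "potential s a k x = \<infinity> \<longleftrightarrow> x \<in> a ` {..<k}"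
  by (auto simp: potential_def sum_Pinfty riesz_kernel_def)

lemma infinite_unit_circle: "infinite {x::complex. norm x = 1}"
proof
  assume f: "finite {x::complex. norm x = 1}"
  let ?n = "Suc (card {x::complex. norm x = 1})"
  have "{z::complex. z ^ ?n = 1} \<subseteq> {x. norm x = 1}"
    using power_eq_1_iff by (auto simp del: power_Suc)
  then have "card {z::complex. z ^ ?n = 1} \<le> card {x::complex. norm x = 1}"
    by (rule card_mono[OF f])
  then show False by (simp add: card_roots_unity_eq del: power_Suc)
qed

text \<open>Cancelling summands in \<open>ereal\<close> needs finite values. The circle is infinite, so it has a
  point that avoids the \<open>k\<close> singularities, and a minimum is at most the value there.\<close>

lemma min_potential_finite:
  assumes "\<And>x. norm x = 1 \<Longrightarrow> potential s a k y \<le> potential s a k x"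
  shows "potential s a k y \<noteq> \<infinity>"
proof -
  have "\<not> {x. norm x = 1} \<subseteq> a ` {..<k}" using infinite_unit_circle finite_surj by blast
  then obtain x where "norm x = 1" "x \<notin> a ` {..<k}" by blast
  then show ?thesis using assms[of x] potential_eq_infinity_iff[of s a k x] by auto
qed

lemma greedy_prefix_inj: "greedy_prefix s a L \<Longrightarrow> inj_on a {..<L}"
proof (rule linorder_inj_onI)
  fix i j assume L: "greedy_prefix s a L" and ij: "i < j" "j \<in> {..<L}"
  then have "potential s a j (a j) \<noteq> \<infinity>"
    by (intro min_potential_finite) (auto simp: greedy_prefix_def)
  then have "a j \<notin> a ` {..<j}" by (simp add: potential_eq_infinity_iff)
  moreover have "a i \<in> a ` {..<j}" using ij by simp
  ultimately show "a i \<noteq> a j" by metis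
qed auto

text \<open>In \<open>ereal\<close> the inverse of \<open>0\<close> is \<open>\<infinity>\<close>, so the kernel is the inverse of a continuous nonnegative
  function, the singularity included.\<close>

lemma riesz_kernel_continuous:
  assumes "s > 0"
  shows "continuous_on A (\<lambda>x. riesz_kernel s x y)"
proof -
  have "riesz_kernel s x y = inverse (ereal (norm (x - y) powr s))" for x
    by (simp add: riesz_kernel_def powr_minus)
  moreover have "continuous_on A (\<lambda>x. inverse (ereal (norm (x - y) powr s)))"
    using assms by (intro continuous_on_compose2[OF continuous_on_inverse_ereal] continuous_intros continuous_on_powr') auto
  ultimately show ?thesis by simp
qed

lemma potential_continuous:
  assumes "s > 0"
  shows "continuous_on A (potential s a k)"
proof (induction k)
  case (Suc k)
  have "((\<lambda>x. potential s a k x + riesz_kernel s x (a k)) \<longlongrightarrow> potential s a k x + riesz_kernel s x (a k)) (at x within A)"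
    if "x \<in> A" for x
    using Suc riesz_kernel_continuous[OF assms] that potential_nonneg[of s a k x] riesz_kernel_nonneg[of s x "a k"]
    by (intro tendsto_add_ereal_nonneg) (auto simp: continuous_on_def)
  then show ?case by (simp add: continuous_on_def potential_def)
qed (simp add: potential_def)

lemma potential_attains_min:
  assumes "s > 0"
  obtains y where "norm y = 1" "\<And>x. norm x = 1 \<Longrightarrow> potential s a k y \<le> potential s a k x"
proof -
  have "\<exists>y\<in>sphere 0 1. \<forall>x\<in>sphere 0 1. potential s a k y \<le> potential s a k x"
    by (rule continuous_attains_inf[OF compact_sphere _ potential_continuous[OF assms]]) auto
  then show ?thesis using that by auto
qed

text \<open>There are only \<open>M\<close> roots, so \<open>M\<close> different ones are all of them.\<close>

lemma roots_prefix_potential: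
  assumes "\<And>k. k < M \<Longrightarrow> a k ^ M = c ^ M" and "inj_on a {..<M}" and "c \<noteq> 0" and "M > 0"
  shows "potential s a M x = (\<Sum>z | z ^ M = c ^ M. riesz_kernel s x z)"
proof -
  have "card {z. z ^ M = c ^ M} = M" using assms by (simp add: card_nth_roots)
  moreover have "finite {z. z ^ M = c ^ M}" using assms by (simp add: finite_nth_roots)
  moreover have "a ` {..<M} \<subseteq> {z. z ^ M = c ^ M}" using assms by auto
  moreover have "card (a ` {..<M}) = M" using assms by (simp add: card_image)
  ultimately have "a ` {..<M} = {z. z ^ M = c ^ M}" by (intro card_subset_eq) auto
  then show ?thesis unfolding potential_def using assms(2)
    by (metis (no_types, lifting) sum.reindex_cong)
qed

text \<open>The premise \<open>IH\<close> is \<open>greedy_prefix_roots\<close> for \<open>M = 2 ^ n\<close>; it is a premise because both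
  statements are proved in one induction on \<open>n\<close>. Under it a full block of \<open>M\<close> points is equally spaced.
  The points \<open>b\<close> after the block are shown to be greedy one at a time: some minimiser \<open>y\<close> of the potential of
  the earlier points of \<open>b\<close> is a midpoint, by \<open>IH\<close> applied to \<open>b\<close> continued by \<open>y\<close>. So the minimum of the sum of
  both potentials is the sum of the minima, and the next point attains both.\<close>

lemma greedy_block:
  assumes s: "s > 0"
    and IH: "\<And>b L k. greedy_prefix s b L \<Longrightarrow> L \<le> M \<Longrightarrow> k < L \<Longrightarrow> b k ^ M = b 0 ^ M"
    and M: "M > 0"
    and a: "greedy_prefix s a (M + j)" and j: "j \<le> M"
  defines "b \<equiv> \<lambda>i. a (M + i)"
  shows "greedy_prefix s b j \<and> (\<forall>i<j. b i ^ M = - (a 0 ^ M)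
     \<and> potential s a (M + i) (b i) = ereal (midpoint_energy s M) + potential s b i (b i))"
  using a j
proof (induction j)
  case 0
  then show ?case by (simp add: greedy_prefix_def)
next
  case (Suc j)
  let ?T = "ereal (midpoint_energy s M)"
  have a': "greedy_prefix s a (M + Suc j)" using Suc.prems by simp
  have b: "greedy_prefix s b j" and bM: "\<And>i. i < j \<Longrightarrow> b i ^ M = - (a 0 ^ M)"
    and bp: "\<And>i. i < j \<Longrightarrow> potential s a (M + i) (b i) = ?T + potential s b i (b i)"
    using Suc.IH greedy_prefix_mono[OF a'] Suc.prems by auto
  have aM: "greedy_prefix s a M" by (rule greedy_prefix_mono[OF a']) simp
  have a0: "norm (a 0) = 1" using aM M by (simp add: greedy_prefix_def)
  define U where "U = potential s a M"
  have U: "U x = (\<Sum>z | z ^ M = a 0 ^ M. riesz_kernel s x z)" for x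
    unfolding U_def
  proof (rule roots_prefix_potential)
    show "a k ^ M = a 0 ^ M" if "k < M" for k using IH[OF aM _ that] by simp
  qed (use greedy_prefix_inj[OF aM] a0 M in auto)
  have Uge: "?T \<le> U x" and Ueq: "U x = ?T \<longleftrightarrow> x ^ M = - (a 0 ^ M)" if "norm x = 1" for x
    unfolding U by (rule roots_potential[OF s M a0 that])+
  have split: "potential s a (M + j) x = U x + potential s b j x" for x
    unfolding U_def b_def by (rule potential_add)
  obtain y where y: "norm y = 1" "\<And>x. norm x = 1 \<Longrightarrow> potential s b j y \<le> potential s b j x"
    and yM: "y ^ M = - (a 0 ^ M)"
  proof (cases j)
    case 0
    have "card {z. z ^ M = - (a 0 ^ M)} = M" using a0 M by (intro card_nth_roots) auto
    then have "{z. z ^ M = - (a 0 ^ M)} \<noteq> {}" using M by (metis card.empty less_numeral_extra(3))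
    then obtain y where e: "y ^ M = - (a 0 ^ M)" by blast
    then have "norm (y ^ M) = norm (a 0 ^ M)" by (simp only: norm_minus_cancel)
    then have "norm y ^ M = 1" by (simp only: norm_power a0 power_one)
    then have "norm y = 1" using M power_eq_imp_eq_base[of "norm y" M 1] by simp
    moreover have "potential s b j y \<le> potential s b j x" for x unfolding 0 by (simp add: potential_def)
    ultimately show ?thesis using e by (intro that)
  next
    case j: (Suc j')
    obtain y where y: "norm y = 1" "\<And>x. norm x = 1 \<Longrightarrow> potential s b j y \<le> potential s b j x"
      using potential_attains_min[OF s] by blast
    define b' where "b' = b(j := y)"
    \<comment> \<open>only the point with index \<open>j\<close> has changed, and it does not enter the potentials up to \<open>j\<close>\<close>
    have pb: "potential s b' k x = potential s b k x" if "k \<le> j" for k x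
      using that by (intro potential_cong) (simp add: b'_def)
    have "greedy_prefix s b' (Suc j)"
      unfolding greedy_prefix_def
    proof (intro allI impI)
      fix k assume k: "k < Suc j"
      show "norm (b' k) = 1 \<and> (\<forall>x. norm x = 1 \<longrightarrow> potential s b' k (b' k) \<le> potential s b' k x)"
        using b k y pb[of k] by (cases "k = j") (auto simp: b'_def greedy_prefix_def)
    qed
    then have "b' j ^ M = b' 0 ^ M" using IH[of b' "Suc j" j] Suc.prems by simp
    then have "y ^ M = - (a 0 ^ M)" using bM[of 0] j by (simp add: b'_def)
    then show ?thesis using that y by blast
  qed
  let ?w = "b j"
  have w: "norm ?w = 1" "potential s a (M + j) ?w \<le> potential s a (M + j) y"
    using a' y(1) by (auto simp: greedy_prefix_def b_def)
  have Vfin: "potential s b j y \<noteq> \<infinity>" by (rule min_potential_finite[OF y(2)])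
  have le: "U ?w + potential s b j ?w \<le> ?T + potential s b j y"
    using w Ueq[OF y(1)] yM by (simp add: split)
  have ge: "?T \<le> U ?w" "potential s b j y \<le> potential s b j ?w" using Uge w y by auto
  have "U ?w = ?T \<and> potential s b j ?w = potential s b j y"
  proof -
    obtain p where p: "potential s b j y = ereal p"
      using Vfin potential_nonneg[of s b j y] by (cases "potential s b j y") auto
    show ?thesis
      using le ge unfolding p by (cases "U ?w"; cases "potential s b j ?w") auto
  qed
  then have Uw: "U ?w = ?T" and Vw: "potential s b j ?w = potential s b j y" by auto
  have "greedy_prefix s b (Suc j)"
    using b w(1) y(2) unfolding greedy_prefix_def less_Suc_eq by (auto simp: Vw)
  then show ?case using Ueq[OF w(1)] Uw bM bp split[of ?w] by (auto simp: less_Suc_eq)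
qed

lemma greedy_prefix_roots:
  assumes s: "s > 0"
  shows "greedy_prefix s a L \<Longrightarrow> L \<le> 2 ^ n \<Longrightarrow> k < L \<Longrightarrow> a k ^ 2 ^ n = a 0 ^ 2 ^ n"
proof (induction n arbitrary: a L k)
  case 0
  then have "k = 0" by simp
  then show ?case by simp
next
  case (Suc n)
  have sq: "z ^ 2 ^ Suc n = (z ^ 2 ^ n) ^ 2" for z :: complex
    by (simp add: power_mult[symmetric] mult.commute)
  show ?case
  proof (cases "k < 2 ^ n")
    case True
    have "a k ^ 2 ^ n = a 0 ^ 2 ^ n"
    proof (rule Suc.IH)
      show "greedy_prefix s a (min L (2 ^ n))" by (rule greedy_prefix_mono[OF Suc.prems(1)]) simp
    qed (use True Suc.prems in auto)
    then show ?thesis unfolding sq by simp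
  next
    case False
    define i where "i = k - 2 ^ n"
    have k: "k = 2 ^ n + i" and i: "i < 2 ^ n" using False Suc.prems by (auto simp: i_def)
    have "greedy_prefix s a (2 ^ n + Suc i)"
      by (rule greedy_prefix_mono[OF Suc.prems(1)]) (use k Suc.prems in simp)
    have "greedy_prefix s (\<lambda>i. a (2 ^ n + i)) (Suc i) \<and> (\<forall>l<Suc i. a (2 ^ n + l) ^ 2 ^ n = - (a 0 ^ 2 ^ n)
        \<and> potential s a (2 ^ n + l) (a (2 ^ n + l))
          = ereal (midpoint_energy s (2 ^ n)) + potential s (\<lambda>i. a (2 ^ n + i)) l (a (2 ^ n + l)))"
      by (rule greedy_block[OF s Suc.IH _ \<open>greedy_prefix s a (2 ^ n + Suc i)\<close>]) (use i in auto)
    then have "a k ^ 2 ^ n = - (a 0 ^ 2 ^ n)" by (simp only: k lessI)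
    then show ?thesis unfolding sq by simp
  qed
qed

lemma bit_high:
  fixes N :: nat
  assumes "2 ^ n \<le> N" "N < 2 ^ Suc n"
  shows "{k. bit N k} = insert n {k. bit (N - 2 ^ n) k}" "\<not> bit (N - 2 ^ n) n"
proof -
  define N' where "N' = N - 2 ^ n"
  have N: "N = 2 ^ n + N'" "N' < 2 ^ n" using assms by (auto simp: N'_def)
  have no: "\<not> bit N' k" if "k \<ge> n" for k
  proof -
    have "N' < 2 ^ k" using N(2) power_increasing[OF that, of "2::nat"] by linarith
    then show ?thesis by (simp add: bit_iff_odd)
  qed
  have "N = or (2 ^ n) N'"
    unfolding N(1) by (rule disjunctive_add) (use no in \<open>auto simp: bit_exp_iff\<close>)
  then show "{k. bit N k} = insert n {k. bit (N - 2 ^ n) k}"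
    unfolding N'_def[symmetric] by (auto simp: bit_or_iff bit_exp_iff)
  show "\<not> bit (N - 2 ^ n) n" using no[of n] by (simp add: N'_def)
qed

lemma finite_bits: "finite {k. bit (N::nat) k}"
proof (rule finite_subset)
  show "{k. bit N k} \<subseteq> {..N}"
  proof clarsimp
    fix k assume "bit N k"
    then have "2 ^ k \<le> N" using bit_iff_odd[of N k] by (metis div_less even_zero not_le)
    then show "k \<le> N" using less_exp[of k] by linarith
  qed
qed simp

text \<open>Each recursion step splits off the largest full block, that is, the leading binary digit of \<open>N\<close>.\<close>

lemma greedy_potential:
  assumes s: "s > 0"
  shows "greedy_prefix s a (Suc N) \<Longrightarrow> potential s a N (a N) = ereal (\<Sum>k | bit N k. midpoint_energy s (2 ^ k))"
proof (induction N arbitrary: a rule: less_induct)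
  case (less N)
  show ?case
  proof (cases "N = 0")
    case True
    then show ?thesis by (simp add: potential_def)
  next
    case False
    then obtain n where n: "2 ^ n \<le> N" "N < 2 ^ Suc n" using ex_power_ivl1[of 2 N] by auto
    define N' where "N' = N - 2 ^ n"
    have N: "N = 2 ^ n + N'" "N' < 2 ^ n" using n by (auto simp: N'_def)
    let ?b = "\<lambda>i. a (2 ^ n + i)"
    have "greedy_prefix s a (2 ^ n + Suc N')" using less.prems N by simp
    have "greedy_prefix s ?b (Suc N') \<and> (\<forall>l<Suc N'. a (2 ^ n + l) ^ 2 ^ n = - (a 0 ^ 2 ^ n)
        \<and> potential s a (2 ^ n + l) (a (2 ^ n + l))
          = ereal (midpoint_energy s (2 ^ n)) + potential s ?b l (a (2 ^ n + l)))"
      by (rule greedy_block[OF s greedy_prefix_roots[OF s] _ \<open>greedy_prefix s a (2 ^ n + Suc N')\<close>]) (use N in auto)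
    then have b: "greedy_prefix s ?b (Suc N')"
      and p: "potential s a N (a N) = ereal (midpoint_energy s (2 ^ n)) + potential s ?b N' (?b N')"
      by (auto simp: N(1))
    have "potential s ?b N' (?b N') = ereal (\<Sum>k | bit N' k. midpoint_energy s (2 ^ k))"
      by (rule less.IH[OF _ b]) (simp add: N)
    moreover have "(\<Sum>k | bit N k. midpoint_energy s (2 ^ k))
       = midpoint_energy s (2 ^ n) + (\<Sum>k | bit N' k. midpoint_energy s (2 ^ k))"
      using bit_high[OF n] finite_bits[of N'] by (simp add: N'_def)
    ultimately show ?thesis using p by simp
  qed
qed

lemma greedy_energy_seq_prefix: "greedy_energy_seq s a \<Longrightarrow> greedy_prefix s a L"
proof -
  assume "greedy_energy_seq s a"
  then have *: "\<And>n. norm (a n) = 1"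
    "\<And>n x. n \<ge> 1 \<Longrightarrow> norm x = 1 \<Longrightarrow> potential s a n (a n) \<le> potential s a n x"
    by (auto simp: greedy_energy_seq_def)
  have "potential s a k (a k) \<le> potential s a k x" if "norm x = 1" for k x
    using *(2)[of k x] that by (cases k) (auto simp: potential_def)
  with * show ?thesis by (simp add: greedy_prefix_def)
qed

section \<open>Analytic continuation of the zeta function\<close>

text \<open>Weierstrass' test with a majorant near each point: the remainder series below converge
  only locally uniformly on their half-planes.\<close>

lemma holomorphic_suminf_locally_dominated:
  fixes f :: "nat \<Rightarrow> complex \<Rightarrow> complex"
  assumes S: "open S" and hol: "\<And>n. f n holomorphic_on S"
    and dom: "\<And>x. x \<in> S \<Longrightarrow> \<exists>d>0. \<exists>h. summable h \<and> (\<forall>n. \<forall>y\<in>ball x d \<inter> S. norm (f n y) \<le> h n)"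
  shows "(\<lambda>z. \<Sum>n. f n z) holomorphic_on S" and "\<And>z. z \<in> S \<Longrightarrow> summable (\<lambda>n. f n z)"
proof -
  have fd: "f n field_differentiable (at x)" if "x \<in> S" for n x
    using hol S that holomorphic_on_imp_differentiable_at by blast
  obtain g where g: "\<forall>x\<in>S. ((\<lambda>n. f n x) sums g x) \<and> g field_differentiable (at x)"
  proof (rule series_differentiable_comparison_complex[OF S fd])
    fix x assume x: "x \<in> S"
    obtain d h where d: "d > 0" "summable h" and h: "\<And>n y. y \<in> ball x d \<inter> S \<Longrightarrow> norm (f n y) \<le> h n"
      using dom[OF x] by blast
    have h0: "0 \<le> h n" for n
      using h[of x n] x d norm_ge_zero order_trans by (metis IntI centre_in_ball)
    show "\<exists>d h. 0 < d \<and> summable h \<and> range h \<subseteq> \<real>\<^sub>\<ge>\<^sub>0 \<and>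
        (\<forall>\<^sub>F n in sequentially. \<forall>y\<in>ball x d \<inter> S. cmod (f n y) \<le> cmod (h n))"
      using d h h0 summable_of_real[OF d(2), where 'a=complex]
      by (intro exI[of _ d] exI[of _ "\<lambda>n. complex_of_real (h n)"]) (auto intro!: always_eventually)
  qed blast
  show s: "\<And>z. z \<in> S \<Longrightarrow> summable (\<lambda>n. f n z)"
    using g sums_summable by blast
  have "g holomorphic_on S"
    using g field_differentiable_at_within holomorphic_on_def by blast
  then show "(\<lambda>z. \<Sum>n. f n z) holomorphic_on S"
    by (rule holomorphic_transform) (use g sums_unique in blast)
qed

text \<open>The binomial series of \<open>(x + 1) powr a\<close> in powers of \<open>1/x\<close> need not converge at \<open>x = 1\<close>, hence a
  Taylor remainder on the segment from \<open>x\<close> to \<open>x + 1\<close> takes its place.\<close>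

lemma powr_gbinomial_remainder:
  fixes a :: complex
  assumes x: "x > 0" and a: "Re a \<le> real (Suc K)"
  shows "norm (of_real (x + 1) powr a - (\<Sum>i\<le>K. (a gchoose i) * of_real x powr (a - of_nat i)))
    \<le> real (Suc K) * norm (a gchoose Suc K) * x powr (Re a - real (Suc K))"
proof -
  define f where "f i z = fact i * (a gchoose i) * z powr (a - of_nat i)" for i and z :: complex
  let ?S = "complex_of_real ` {x..x+1}"
  have "convex ?S"
    by (rule convex_linear_image) (auto intro: bounded_linear.linear bounded_linear_of_real)
  have der: "(f i has_field_derivative f (Suc i) z) (at z within ?S)" if "z \<in> ?S" for i z
  proof -
    have z: "z \<notin> \<real>\<^sub>\<le>\<^sub>0" using that x by auto
    have e: "fact i * (a gchoose i) * ((a - of_nat i) * z powr (a - of_nat i - 1)) = f (Suc i) z"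
    proof -
      have "(a gchoose i) * (a - of_nat i) = of_nat (Suc i) * (a gchoose Suc i)"
        using gbinomial_mult_1[of a i] by (simp add: algebra_simps)
      note c = this
      have c2: "a - of_nat i - 1 = a - of_nat (Suc i)" by simp
      have "fact i * (a gchoose i) * ((a - of_nat i) * z powr (a - of_nat i - 1))
          = fact i * ((a gchoose i) * (a - of_nat i)) * z powr (a - of_nat i - 1)"
        by (simp only: mult_ac)
      also have "\<dots> = f (Suc i) z" unfolding c c2 f_def fact_Suc by (simp only: mult_ac)
      finally show ?thesis .
    qed
    show ?thesis unfolding f_def[of i]
      using DERIV_cmult[OF has_field_derivative_powr[OF z, of "a - of_nat i"], of "fact i * (a gchoose i)"]
      unfolding e by (rule has_field_derivative_at_within)
  qed
  have B: "cmod (f (Suc K) z) \<le> fact (Suc K) * norm (a gchoose Suc K) * x powr (Re a - real (Suc K))"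
    if zS: "z \<in> ?S" for z
  proof -
    obtain t where t: "z = of_real t" "t \<ge> x" using zS by (elim imageE) auto
    have "t powr (Re a - real (Suc K)) \<le> x powr (Re a - real (Suc K))"
      using powr_mono2'[of "-(Re a - real (Suc K))" x t] t x a by (simp add: powr_mono2')
    then show ?thesis unfolding f_def norm_mult t(1) using t x
      by (subst norm_powr_real_powr) (auto intro!: mult_left_mono simp del: fact_Suc of_nat_Suc)
  qed
  have m: "of_real (x+1) \<in> ?S" "of_real x \<in> ?S" by (rule imageI, simp)+
  have "cmod (f 0 (of_real (x+1)) - (\<Sum>i\<le>K. f i (of_real x) * (of_real (x+1) - of_real x) ^ i / fact i))
    \<le> fact (Suc K) * norm (a gchoose Suc K) * x powr (Re a - real (Suc K))
      * cmod (of_real (x+1) - of_real x) ^ Suc K / fact K"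
    by (rule complex_Taylor[OF \<open>convex ?S\<close> _ _ m(2) m(1)]) (use der B in auto)
  then show ?thesis by (simp add: f_def)
qed

text \<open>The Taylor remainder of \<open>(x + 1) powr (1 - s)\<close> at \<open>x = n + 1\<close> after \<open>K + 1\<close> terms; the shift
  of \<open>n\<close> lets series start at \<open>0\<close>.\<close>

definition zeta_rem :: "nat \<Rightarrow> nat \<Rightarrow> complex \<Rightarrow> complex" where
  "zeta_rem K n s = of_nat (Suc (Suc n)) powr (1 - s)
     - (\<Sum>i\<le>K. ((1 - s) gchoose i) * of_nat (Suc n) powr (1 - s - of_nat i))"

lemma zeta_rem_bound:
  assumes "Re s \<ge> - real K"
  shows "norm (zeta_rem K n s) \<le> real (Suc K) * norm ((1 - s) gchoose Suc K) * real (Suc n) powr (- Re s - real K)"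
  using powr_gbinomial_remainder[of "real (Suc n)" "1 - s" K] assms
  unfolding zeta_rem_def by (simp add: algebra_simps)

lemma summable_Suc_powr: "e < -1 \<Longrightarrow> summable (\<lambda>n. real (Suc n) powr e)"
  using summable_Suc_iff[of "\<lambda>n. real n powr e"] summable_real_powr_iff[of e] by simp

lemma gbinomial_holomorphic [holomorphic_intros]:
  "(\<lambda>s::complex. (1 - s) gchoose k) holomorphic_on A"
  unfolding gbinomial_prod_rev by (intro holomorphic_intros) auto

text \<open>The gain of \<open>K\<close> powers of \<open>n\<close> in the remainder moves the half-plane of convergence to the left by \<open>K\<close>.\<close>

lemma zeta_rem_sum_holomorphic:
  shows "(\<lambda>s. \<Sum>n. zeta_rem K n s) holomorphic_on {s. Re s > 1 - real K}"
    and "Re s > 1 - real K \<Longrightarrow> summable (\<lambda>n. zeta_rem K n s)"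
proof -
  let ?S = "{s. Re s > 1 - real K}"
  have o: "open ?S" by (rule open_halfspace_Re_gt)
  have hol: "zeta_rem K n holomorphic_on ?S" for n
    unfolding zeta_rem_def by (intro holomorphic_intros) (auto simp del: of_nat_Suc)
  have dom: "\<exists>d>0. \<exists>h. summable h \<and> (\<forall>n. \<forall>y\<in>ball x d \<inter> ?S. norm (zeta_rem K n y) \<le> h n)"
    if x: "x \<in> ?S" for x
  proof -
    define d where "d = (Re x - (1 - real K)) / 2"
    have d: "d > 0" using x by (simp add: d_def)
    have "continuous_on (cball x d) (\<lambda>s. norm ((1 - s) gchoose Suc K))"
      by (intro continuous_intros holomorphic_on_imp_continuous_on gbinomial_holomorphic)
    then obtain B where B: "\<And>y. y \<in> cball x d \<Longrightarrow> norm ((1 - y) gchoose Suc K) \<le> B"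
      using compact_continuous_image[OF _ compact_cball, of x d] compact_imp_bounded bounded_imp_bdd_above
      unfolding bdd_above_def by (metis (no_types, lifting) imageI)
    have B0: "B \<ge> 0" using B[of x] d by (smt (verit) norm_ge_zero centre_in_cball)
    let ?h = "\<lambda>n. real (Suc K) * B * real (Suc n) powr (- 1 - d)"
    have "norm (zeta_rem K n y) \<le> ?h n" if y: "y \<in> ball x d \<inter> ?S" for n y
    proof -
      have "\<bar>Re y - Re x\<bar> < d" using y abs_Re_le_cmod[of "y - x"]
        by (auto simp: dist_norm norm_minus_commute)
      then have e: "- Re y - real K \<le> - 1 - d" unfolding d_def by (simp add: field_simps abs_if split: if_splits)
      have "norm (zeta_rem K n y) \<le> real (Suc K) * norm ((1 - y) gchoose Suc K) * real (Suc n) powr (- Re y - real K)"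
        using y by (intro zeta_rem_bound) auto
      also have "\<dots> \<le> ?h n"
        using e y B[of y] B0 by (intro mult_mono powr_mono mult_nonneg_nonneg) (auto simp: powr_mono)
      finally show ?thesis .
    qed
    moreover have "summable ?h" using d by (intro summable_mult summable_Suc_powr) auto
    ultimately show ?thesis using d by blast
  qed
  show "(\<lambda>s. \<Sum>n. zeta_rem K n s) holomorphic_on ?S"
    by (rule holomorphic_suminf_locally_dominated(1)[OF o hol dom])
  show "Re s > 1 - real K \<Longrightarrow> summable (\<lambda>n. zeta_rem K n s)"
    using holomorphic_suminf_locally_dominated(2)[OF o hol dom] by blast
qed

definition dirichlet_zeta :: "complex \<Rightarrow> complex" where
  "dirichlet_zeta s = (\<Sum>n. of_nat (Suc n) powr - s)"

lemma dirichlet_zeta_sums: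
  assumes "Re s > 1"
  shows "(\<lambda>n. of_nat (Suc n) powr - s) sums dirichlet_zeta s"
proof -
  have "summable (\<lambda>n. norm (complex_of_nat (Suc n) powr - s))"
    using summable_Suc_powr[of "- Re s"] assms
    by (simp add: norm_powr_real_powr del: of_nat_Suc)
  then show ?thesis unfolding dirichlet_zeta_def by (rule summable_sums[OF summable_norm_cancel])
qed

text \<open>Summing \<open>zeta_rem K n s\<close> over \<open>n\<close>, the differences \<open>(n+2) powr (1-s) - (n+1) powr (1-s)\<close> telescope and each
  Taylor term becomes a Dirichlet series. Everything is written for \<open>(s - 1) \<zeta>(s)\<close>: the
  factor \<open>s + i - 2\<close> that compensates the pole of the shifted zeta function is the last factor of the binomial
  coefficient, so that only entire functions occur.\<close>

lemma zeta_recursion: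
  assumes s: "Re s > 1" and K: "K \<ge> 1"
  shows "(s - 1) * dirichlet_zeta s = 1 + (\<Sum>n. zeta_rem K n s)
    - (\<Sum>i\<in>{2..K}. ((1 - s) gchoose (i - 1)) / of_nat i
          * ((s + of_nat (i - 1) - 1) * dirichlet_zeta (s + of_nat (i - 1))))"
proof -
  have "(\<lambda>n. of_nat (Suc n) powr (1 - s)) \<longlonglongrightarrow> 0"
    using s by (intro tendsto_neg_powr_complex_of_nat filterlim_Suc) auto
  from telescope_sums[OF this]
  have 1: "(\<lambda>n. of_nat (Suc (Suc n)) powr (1 - s) - of_nat (Suc n) powr (1 - s)) sums (- 1)" by simp
  have D: "(\<lambda>n. ((1 - s) gchoose i) * of_nat (Suc n) powr (1 - s - of_nat i)) sums
      (((1 - s) gchoose i) * dirichlet_zeta (s + of_nat (i - 1)))" if "i \<in> {1..K}" for i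
  proof -
    have e: "1 - s - of_nat i = - (s + of_nat (i - 1))" using that by (simp add: of_nat_diff)
    show ?thesis unfolding e by (intro sums_mult dirichlet_zeta_sums) (use s in simp)
  qed
  have 2: "(\<lambda>n. \<Sum>i\<in>{1..K}. ((1 - s) gchoose i) * of_nat (Suc n) powr (1 - s - of_nat i)) sums
      (\<Sum>i\<in>{1..K}. ((1 - s) gchoose i) * dirichlet_zeta (s + of_nat (i - 1)))"
    by (intro sums_sum D)
  have r: "zeta_rem K n s = (of_nat (Suc (Suc n)) powr (1 - s) - of_nat (Suc n) powr (1 - s))
     - (\<Sum>i\<in>{1..K}. ((1 - s) gchoose i) * of_nat (Suc n) powr (1 - s - of_nat i))" for n
  proof -
    have "{..K} = insert 0 {1..K}" by auto
    then show ?thesis unfolding zeta_rem_def by (simp add: algebra_simps)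
  qed
  have "(\<lambda>n. zeta_rem K n s) sums (- 1 - (\<Sum>i\<in>{1..K}. ((1 - s) gchoose i) * dirichlet_zeta (s + of_nat (i - 1))))"
    unfolding r by (intro sums_diff 1 2)
  then have S: "(\<Sum>n. zeta_rem K n s) = - 1 - (\<Sum>i\<in>{1..K}. ((1 - s) gchoose i) * dirichlet_zeta (s + of_nat (i - 1)))"
    by (rule sums_unique[symmetric])
  have "{1..K} = insert 1 {2..K}" using K by auto
  then have e: "(\<Sum>i\<in>{1..K}. ((1 - s) gchoose i) * dirichlet_zeta (s + of_nat (i - 1)))
    = (1 - s) * dirichlet_zeta s + (\<Sum>i\<in>{2..K}. ((1 - s) gchoose i) * dirichlet_zeta (s + of_nat (i - 1)))"
    by simp
  have g: "((1 - s) gchoose i) * dirichlet_zeta (s + of_nat (i - 1)) =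
     - (((1 - s) gchoose (i - 1)) / of_nat i * ((s + of_nat (i - 1) - 1) * dirichlet_zeta (s + of_nat (i - 1))))"
    if "i \<in> {2..K}" for i
  proof -
    have i: "i = Suc (i - 1)" using that by auto
    have "((1 - s) gchoose (i - 1)) * (1 - s - of_nat (i - 1)) = of_nat i * ((1 - s) gchoose i)"
      using gbinomial_mult_1[of "1 - s" "i - 1"] i by (simp add: algebra_simps)
    moreover have "complex_of_nat i \<noteq> 0" using that by auto
    ultimately have "(1 - s) gchoose i = - (((1 - s) gchoose (i - 1)) / of_nat i * (s + of_nat (i - 1) - 1))"
      by (simp add: field_simps)
    then show ?thesis by simp
  qed
  have T: "(\<Sum>i\<in>{2..K}. ((1 - s) gchoose i) * dirichlet_zeta (s + of_nat (i - 1))) =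
     - (\<Sum>i\<in>{2..K}. ((1 - s) gchoose (i - 1)) / of_nat i
          * ((s + of_nat (i - 1) - 1) * dirichlet_zeta (s + of_nat (i - 1))))"
    unfolding sum_negf[symmetric] by (rule sum.cong[OF refl g])
  show ?thesis unfolding S e T by (simp add: left_diff_distrib)
qed

text \<open>Each application of \<open>zeta_recursion\<close> calls the function only at \<open>s + 1\<close> and further right, so it
  extends a half-plane by \<open>1\<close>.\<close>

lemma zeta_continuation_halfplane:
  "\<exists>Z. Z holomorphic_on {s. Re s > - real k} \<and> (\<forall>s. Re s > 1 \<longrightarrow> Z s = (s - 1) * dirichlet_zeta s)"
proof (induction k)
  case 0
  let ?Z = "\<lambda>s. 1 + (\<Sum>n. zeta_rem 1 n s)"
  have "?Z holomorphic_on {s. Re s > - real 0}"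
    using zeta_rem_sum_holomorphic(1)[of 1] by (intro holomorphic_intros) simp
  moreover have "?Z s = (s - 1) * dirichlet_zeta s" if "Re s > 1" for s
    using zeta_recursion[OF that, of 1] by simp
  ultimately show ?case by blast
next
  case (Suc k)
  then obtain Z where Z: "Z holomorphic_on {s. Re s > - real k}"
    "\<And>s. Re s > 1 \<Longrightarrow> Z s = (s - 1) * dirichlet_zeta s" by blast
  \<comment> \<open>the remainder series converges for \<open>Re s > 1 - K\<close>, and \<open>1 - K = - (k + 1)\<close>\<close>
  define K where "K = k + 2"
  let ?Z = "\<lambda>s. 1 + (\<Sum>n. zeta_rem K n s)
    - (\<Sum>i\<in>{2..K}. ((1 - s) gchoose (i - 1)) / of_nat i * Z (s + of_nat (i - 1)))"
  have h: "(\<lambda>s. Z (s + of_nat (i - 1))) holomorphic_on {s. Re s > - real (Suc k)}" if "i \<in> {2..K}" for i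
    using that by (intro holomorphic_on_compose_gen[unfolded o_def, OF _ Z(1)] holomorphic_intros)
      (auto simp: of_nat_diff)
  have "?Z holomorphic_on {s. Re s > - real (Suc k)}"
    using zeta_rem_sum_holomorphic(1)[of K] h
    by (intro holomorphic_intros) (auto simp: K_def)
  moreover have "?Z s = (s - 1) * dirichlet_zeta s" if "Re s > 1" for s
  proof -
    have "Z (s + of_nat (i - 1)) = (s + of_nat (i - 1) - 1) * dirichlet_zeta (s + of_nat (i - 1))" for i
      using that by (intro Z(2)) simp
    then show ?thesis using zeta_recursion[OF that, of K] by (simp only: K_def)
  qed
  ultimately show ?case by blast
qed

text \<open>The continuations to the half-planes agree where two of them are defined, so they can be glued by
  taking at each point one half-plane that contains it.\<close>

lemma zeta_continuation:
  "\<exists>f. f holomorphic_on - {1} \<and> (\<forall>w. Re w > 1 \<longrightarrow> (\<lambda>n. 1 / of_nat (Suc n) powr w) sums f w)"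
proof -
  obtain Z where Z: "\<And>k. Z k holomorphic_on {s. Re s > - real k}"
    "\<And>k s. Re s > 1 \<Longrightarrow> Z k s = (s - 1) * dirichlet_zeta s"
    using zeta_continuation_halfplane by metis
  have agree: "Z k s = Z l s" if kl: "k \<le> l" and s: "Re s > - real k" for k l s
  proof (rule analytic_continuation_open[where s = "{s. Re s > 1}" and s' = "{s. Re s > - real k}"
        and f = "Z k" and g = "Z l"])
    show "{s. Re s > 1} \<noteq> {}" by (auto intro!: exI[of _ 2])
    show "connected {s. - real k < Re s}" by (intro convex_connected convex_halfspace_Re_gt)
    show "Z l holomorphic_on {s. - real k < Re s}"
      by (rule holomorphic_on_subset[OF Z(1)]) (use kl in auto)
  qed (use Z s in \<open>auto intro: open_halfspace_Re_gt\<close>)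
  define E where "E s = Z (nat \<lceil>\<bar>Re s\<bar>\<rceil> + 1) s" for s
  have E: "E s = Z k s" if "Re s > - real k" for s k
  proof -
    let ?l = "nat \<lceil>\<bar>Re s\<bar>\<rceil> + 1"
    have "Re s > - real ?l" by linarith
    then show ?thesis using agree[of k ?l s] agree[of ?l k s] that
      unfolding E_def by (metis nat_le_linear)
  qed
  have "E field_differentiable at s" for s
  proof -
    obtain k where "- Re s < real k" using reals_Archimedean2 by blast
    then have k: "Re s > - real k" by simp
    have "E holomorphic_on {s. Re s > - real k}"
      by (rule holomorphic_transform[OF Z(1)]) (use E in auto)
    then show ?thesis using k open_halfspace_Re_gt holomorphic_on_imp_differentiable_at by blast
  qed
  then have "E holomorphic_on A" for A
    by (simp add: holomorphic_on_def field_differentiable_at_within)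
  then have "(\<lambda>s. E s / (s - 1)) holomorphic_on - {1}"
    by (intro holomorphic_intros) auto
  moreover have "(\<lambda>n. 1 / of_nat (Suc n) powr w) sums (E w / (w - 1))" if "Re w > 1" for w
  proof -
    have "E w / (w - 1) = dirichlet_zeta w" using E[of 0 w] Z(2)[of w 0] that by auto
    then show ?thesis using dirichlet_zeta_sums[OF that] by (simp add: powr_minus_divide)
  qed
  ultimately show ?thesis by blast
qed

lemma riemann_zeta_holomorphic: "riemann_zeta holomorphic_on - {1}"
  and riemann_zeta_eq: "Re w > 1 \<Longrightarrow> riemann_zeta w = dirichlet_zeta w"
proof -
  note * = someI_ex[OF zeta_continuation, folded riemann_zeta_def]
  show "riemann_zeta holomorphic_on - {1}" using * by blast
  show "riemann_zeta w = dirichlet_zeta w" if "Re w > 1"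
  proof -
    have "(\<lambda>n. 1 / of_nat (Suc n) powr w) sums riemann_zeta w" using * that by blast
    then have "(\<lambda>n. of_nat (Suc n) powr - w) sums riemann_zeta w"
      by (simp only: powr_minus_divide)
    then show ?thesis by (rule sums_unique2) (rule dirichlet_zeta_sums[OF that])
  qed
qed

text \<open>With \<open>K = 1\<close> the recursion contains no other value of the zeta function; the identity theorem on the
  punctured half-plane carries it over from \<open>Re s > 1\<close>.\<close>

lemma riemann_zeta_right_halfplane:
  assumes s: "Re s > 0" "s \<noteq> 1"
  shows "(s - 1) * riemann_zeta s = 1 + (\<Sum>n. zeta_rem 1 n s)"
proof (rule analytic_continuation_open[where s = "{s. Re s > 1}" and s' = "{s. Re s > 0} - {1}"
      and f = "\<lambda>s. (s - 1) * riemann_zeta s" and g = "\<lambda>s. 1 + (\<Sum>n. zeta_rem 1 n s)"])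
  show "{s. Re s > 1} \<noteq> {}" by (auto intro!: exI[of _ 2])
  show "connected ({s. 0 < Re s} - {1})"
    by (intro connected_open_delete convex_connected convex_halfspace_Re_gt open_halfspace_Re_gt) auto
  show "(\<lambda>s. (s - 1) * riemann_zeta s) holomorphic_on {s. 0 < Re s} - {1}"
    by (intro holomorphic_intros holomorphic_on_subset[OF riemann_zeta_holomorphic]) auto
  show "(\<lambda>s. 1 + (\<Sum>n. zeta_rem 1 n s)) holomorphic_on {s. 0 < Re s} - {1}"
    by (rule holomorphic_on_add[OF holomorphic_on_const
          holomorphic_on_subset[OF zeta_rem_sum_holomorphic(1)[of 1]]]) auto
  show "(z - 1) * riemann_zeta z = 1 + (\<Sum>n. zeta_rem 1 n z)" if "z \<in> {s. 1 < Re s}" for z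
    using zeta_recursion[of z 1] that riemann_zeta_eq[of z] by simp
qed (use s in \<open>auto intro: open_halfspace_Re_gt open_delete\<close>)

text \<open>The partial sums of \<open>zeta_rem 1\<close> are elementary, so \<open>riemann_zeta_right_halfplane\<close> becomes a statement
  about partial sums of the Dirichlet series.\<close>

lemma zeta_partial_sums:
  fixes s :: real
  assumes s: "s > 0" "s \<noteq> 1"
  shows "(\<lambda>M. (\<Sum>n<M. real (Suc n) powr - s) - real (Suc M) powr (1 - s) / (1 - s)) \<longlonglongrightarrow> Re (riemann_zeta (of_real s))"
    and "riemann_zeta (of_real s) \<in> \<real>"
proof -
  let ?f = "\<lambda>M. (\<Sum>n<M. real (Suc n) powr - s) - real (Suc M) powr (1 - s) / (1 - s)"
  have part: "(\<Sum>n<M. zeta_rem 1 n (of_real s)) =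
    of_real (real (Suc M) powr (1 - s) - 1 - (1 - s) * (\<Sum>n<M. real (Suc n) powr - s))" for M
  proof (induction M)
    case (Suc M)
    have "zeta_rem 1 M (of_real s) = of_real (real (Suc (Suc M)) powr (1 - s) - real (Suc M) powr (1 - s)
       - (1 - s) * real (Suc M) powr (- s))"
      unfolding zeta_rem_def
      by (simp add: powr_of_real[symmetric] of_nat_Suc[of 0] del: of_nat_Suc)
    then show ?case unfolding sum.lessThan_Suc Suc by (simp add: algebra_simps del: of_nat_Suc)
  qed simp
  have "(\<lambda>n. zeta_rem 1 n (of_real s)) sums (\<Sum>n. zeta_rem 1 n (of_real s))"
    using zeta_rem_sum_holomorphic(2)[of 1 "of_real s"] s by (intro summable_sums) simp
  then have "(\<lambda>M. (of_real (real (Suc M) powr (1 - s) - 1 - (1 - s) * (\<Sum>n<M. real (Suc n) powr - s))::complex))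
     \<longlonglongrightarrow> (of_real s - 1) * riemann_zeta (of_real s) - 1"
    using riemann_zeta_right_halfplane[of "of_real s"] s unfolding sums_def part by simp
  then have "(\<lambda>M. ((of_real (real (Suc M) powr (1 - s) - 1 - (1 - s) * (\<Sum>n<M. real (Suc n) powr - s)) + 1) / (of_real s - 1)::complex))
     \<longlonglongrightarrow> ((of_real s - 1) * riemann_zeta (of_real s) - 1 + 1) / (of_real s - 1)"
    using s by (intro tendsto_intros) auto
  moreover have "((of_real (real (Suc M) powr (1 - s) - 1 - (1 - s) * (\<Sum>n<M. real (Suc n) powr - s)) + 1) / (of_real s - 1)::complex)
     = of_real (?f M)" for M
    using s by (simp add: field_simps)
  ultimately have L: "(\<lambda>M. complex_of_real (?f M)) \<longlonglongrightarrow> riemann_zeta (of_real s)"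
    using s by simp
  show "?f \<longlonglongrightarrow> Re (riemann_zeta (of_real s))"
    using tendsto_Re[OF L] by simp
  show "riemann_zeta (of_real s) \<in> \<real>"
    by (rule closed_sequentially[OF closed_complex_Reals _ L]) simp
qed

section \<open>Coefficients of powers of sinc\<close>

lemma powser_coeffs_unique:
  fixes c d :: "nat \<Rightarrow> complex"
  assumes "\<And>z. norm z < 1 \<Longrightarrow> (\<lambda>n. c n * z ^ n) sums f z"
    and "\<And>z. norm z < 1 \<Longrightarrow> (\<lambda>n. d n * z ^ n) sums f z"
  shows "c = d"
proof (rule ccontr)
  assume "c \<noteq> d"
  define e where "e n = c n - d n" for n
  have e: "(\<lambda>n. e n * z ^ n) sums 0" if "norm z < 1" for z
    using sums_diff[OF assms[OF that]] by (simp add: e_def algebra_simps)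
  have "e 0 = 0"
  proof (rule sums_unique2[OF powser_sums_zero])
    show "(\<lambda>n. e n * 0 ^ n) sums 0" by (rule e) simp
  qed
  then obtain m where m: "m > 0" "e m \<noteq> 0"
    using \<open>c \<noteq> d\<close> by (metis e_def eq_iff_diff_eq_0 ext gr0I)
  show False
  proof (rule powser_0_nonzero[of 1 0 e "\<lambda>_. 0" m])
    fix s :: real assume s: "s > 0" "\<And>z::complex. z \<in> cball 0 s - {0} \<Longrightarrow> (0::complex) \<noteq> 0"
    have "complex_of_real s \<in> cball 0 s - {0}" using s(1) by simp
    from s(2)[OF this] show False by simp
  qed (use e m in auto)
qed

text \<open>The difference of two logarithms has derivative \<open>0\<close> because its exponential is constant.\<close>

lemma holomorphic_log_unique:
  assumes "open S" "connected S" "z0 \<in> S" "K holomorphic_on S" "L holomorphic_on S" "K z0 = L z0"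
    and e: "\<And>z. z \<in> S \<Longrightarrow> exp (K z) = exp (L z)" and z: "z \<in> S"
  shows "K z = L z"
proof -
  define D where "D z = K z - L z" for z
  have D: "D holomorphic_on S" unfolding D_def by (intro holomorphic_intros assms)
  have ex: "exp (D z) = 1" if "z \<in> S" for z using e[OF that] by (simp add: D_def exp_diff)
  have "(D has_field_derivative 0) (at w)" if w: "w \<in> S" for w
  proof -
    obtain D' where D': "(D has_field_derivative D') (at w)"
      using holomorphic_on_imp_differentiable_at[OF D \<open>open S\<close> w] by (auto simp: field_differentiable_def)
    have 1: "((\<lambda>z. exp (D z)) has_field_derivative exp (D w) * D') (at w)"
      by (rule DERIV_chain2[OF DERIV_exp D'])
    have 2: "((\<lambda>z. exp (D z)) has_field_derivative 0) (at w)"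
      by (rule has_field_derivative_transform_within_open[OF DERIV_const[of 1] \<open>open S\<close> w]) (use ex in simp)
    show ?thesis using DERIV_unique[OF 1 2] D' by simp
  qed
  then have "D constant_on S" using assms by (intro has_field_derivative_0_imp_constant_on)
  then have "D z = D z0" using z assms(3) by (auto simp: constant_on_def)
  then show ?thesis using assms(6) by (simp add: D_def)
qed

lemma sinc_holomorphic: "sinc holomorphic_on UNIV"
proof -
  have "((\<lambda>z. sin (of_real pi * z) / of_real pi) has_field_derivative 1) (at 0)"
    by (auto intro!: derivative_eq_intros)
  then have d: "deriv (\<lambda>z. sin (of_real pi * z) / of_real pi) 0 = (1::complex)" by (rule DERIV_imp_deriv)
  show ?thesis
    by (rule pole_theorem_0[where a = 0 and g = "\<lambda>z. sin (of_real pi * z) / of_real pi"])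
      (use d in \<open>auto simp: sinc_def intro!: holomorphic_intros\<close>)
qed

lemma sinc_nonzero:
  assumes "norm z < 1"
  shows "sinc z \<noteq> 0"
proof (cases "z = 0")
  case False
  have "sin (of_real pi * z) \<noteq> 0"
  proof
    assume "sin (of_real pi * z) = 0"
    then obtain n :: int where "of_real pi * z = complex_of_real (of_int n * pi)"
      unfolding Complex_Transcendental.sin_eq_0 by (auto simp: mult.commute)
    then have "z = of_int n" by (simp add: field_simps)
    then have "\<bar>real_of_int n\<bar> < 1" using assms by simp
    then have "n = 0" by linarith
    then show False using \<open>z = of_int n\<close> False by simp
  qed
  then show ?thesis using False by (simp add: sinc_def)
qed (simp add: sinc_def)

lemma log_sinc:
  shows log_sinc_holomorphic: "log_sinc holomorphic_on ball 0 1"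
    and log_sinc_0: "log_sinc 0 = 0"
    and exp_log_sinc: "\<And>z. z \<in> ball 0 1 \<Longrightarrow> exp (log_sinc z) = sinc z"
proof -
  obtain g where g: "g holomorphic_on ball 0 1" "\<And>z. z \<in> ball 0 1 \<Longrightarrow> sinc z = exp (g z)"
  proof (rule contractible_imp_holomorphic_log[of sinc "ball 0 1"])
    show "contractible (ball 0 1 :: complex set)" by (rule convex_imp_contractible) simp
  qed (auto intro: holomorphic_on_subset[OF sinc_holomorphic] dest!: sinc_nonzero)
  have "exp (g 0) = 1" using g(2)[of 0] by (simp add: sinc_def)
  then have "\<exists>L. L holomorphic_on ball 0 1 \<and> L 0 = 0 \<and> (\<forall>z\<in>ball 0 1. exp (L z) = sinc z)"
    using g by (intro exI[of _ "\<lambda>z. g z - g 0"]) (auto intro!: holomorphic_intros simp: exp_diff)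
  note * = someI_ex[OF this, folded log_sinc_def]
  show "log_sinc holomorphic_on ball 0 1" "log_sinc 0 = 0" "\<And>z. z \<in> ball 0 1 \<Longrightarrow> exp (log_sinc z) = sinc z"
    using * by blast+
qed

text \<open>Both sides are logarithms of the even function \<open>sinc\<close> that vanish at \<open>0\<close>.\<close>

lemma log_sinc_minus: "norm z < 1 \<Longrightarrow> log_sinc (- z) = log_sinc z"
proof (rule holomorphic_log_unique[of "ball 0 1" 0 "\<lambda>z. log_sinc (- z)"])
  show "(\<lambda>z. log_sinc (- z)) holomorphic_on ball 0 1"
    by (rule holomorphic_on_compose_gen[unfolded o_def, OF _ log_sinc_holomorphic]) (auto intro!: holomorphic_intros)
  show "exp (log_sinc (- z)) = exp (log_sinc z)" if "z \<in> ball 0 1" for z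
    using that by (simp add: exp_log_sinc sinc_def)
qed (auto simp: log_sinc_holomorphic)

text \<open>Both sides are logarithms of \<open>sinc\<close>, which commutes with conjugation, and vanish at \<open>0\<close>.\<close>

lemma log_sinc_cnj: "norm z < 1 \<Longrightarrow> cnj (log_sinc (cnj z)) = log_sinc z"
proof (rule holomorphic_log_unique[of "ball 0 1" 0 "\<lambda>z. cnj (log_sinc (cnj z))"])
  have "cnj ` ball 0 1 = ball 0 1"
    by (auto simp: image_iff intro!: bexI[of _ "cnj _"])
  then show "(\<lambda>z. cnj (log_sinc (cnj z))) holomorphic_on ball 0 1"
    using holomorphic_on_compose_cnj_cnj[of log_sinc "ball 0 1"] log_sinc_holomorphic by (simp add: o_def)
  show "exp (cnj (log_sinc (cnj z))) = exp (log_sinc z)" if "z \<in> ball 0 1" for z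
    using that by (simp add: exp_log_sinc sinc_def cnj_sin flip: exp_cnj)
qed (auto simp: log_sinc_holomorphic log_sinc_0)

text \<open>Evenness of \<open>sinc\<close> removes the odd Taylor coefficients. Uniqueness of the coefficients is needed for the
  definite description in \<open>alpha\<close>; it is a statement on power series in \<open>y = z ^ 2\<close>.\<close>

lemma alpha_sums:
  assumes z: "norm z < 1"
  shows "(\<lambda>n. alpha s n * z ^ (2 * n)) sums sinc_neg_power s z"
proof -
  let ?g = "sinc_neg_power s"
  have hol: "?g holomorphic_on ball 0 1"
    unfolding sinc_neg_power_def by (intro holomorphic_intros log_sinc_holomorphic)
  define c where "c n = (deriv ^^ n) ?g 0 / fact n" for n
  have c: "(\<lambda>n. c n * z ^ n) sums ?g z" if "norm z < 1" for z
    using holomorphic_power_series[OF hol, of z] that by (simp add: c_def)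
  have "(\<lambda>n. c n * (- 1) ^ n) = c"
  proof (rule powser_coeffs_unique[OF _ c])
    fix z :: complex assume z: "norm z < 1"
    have "(\<lambda>n. c n * (- z) ^ n) sums ?g z"
      using c[of "- z"] z by (simp add: sinc_neg_power_def log_sinc_minus)
    then show "(\<lambda>n. c n * (- 1) ^ n * z ^ n) sums ?g z"
      by (simp add: power_minus[of z] mult.assoc)
  qed
  then have odd: "c n = 0" if "odd n" for n
    using that fun_cong[of _ _ n] by fastforce
  have even: "(\<lambda>n. c (2 * n) * z ^ (2 * n)) sums ?g z" if "norm z < 1" for z
  proof -
    have "(\<lambda>n. c (2 * n) * z ^ (2 * n)) sums ?g z \<longleftrightarrow> (\<lambda>n. c n * z ^ n) sums ?g z"
    proof (rule sums_mono_reindex)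
      show "strict_mono (\<lambda>n::nat. 2 * n)" by (simp add: strict_mono_def)
      show "c n * z ^ n = 0" if "n \<notin> range ((*) 2)" for n
        using odd[of n] that by (auto elim!: evenE)
    qed
    then show ?thesis using c[OF that] by simp
  qed
  have "alpha s = (\<lambda>n. c (2 * n))"
    unfolding alpha_def
  proof (rule the_equality)
    show "\<forall>z\<in>ball 0 1. (\<lambda>n. c (2 * n) * z ^ (2 * n)) sums ?g z" using even by simp
    fix d assume d: "\<forall>z\<in>ball 0 1. (\<lambda>n. d n * z ^ (2 * n)) sums ?g z"
    show "d = (\<lambda>n. c (2 * n))"
    proof (rule powser_coeffs_unique)
      fix y :: complex assume y: "norm y < 1"
      have "norm (csqrt y) < 1" using y by (simp add: norm_csqrt real_sqrt_lt_1_iff)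
      moreover have "csqrt y ^ (2 * n) = y ^ n" for n by (simp add: power_mult)
      ultimately show "(\<lambda>n. d n * y ^ n) sums ?g (csqrt y)" "(\<lambda>n. c (2 * n) * y ^ n) sums ?g (csqrt y)"
        using bspec[OF d, of "csqrt y"] even[of "csqrt y"] by simp_all
    qed
  qed
  then show ?thesis using even[OF z] by simp
qed

lemma alpha_coeffs_unique:
  assumes "\<And>z. norm z < 1 \<Longrightarrow> (\<lambda>n. d n * z ^ (2 * n)) sums sinc_neg_power s z"
  shows "d = alpha s"
proof (rule powser_coeffs_unique)
  fix y :: complex assume y: "norm y < 1"
  have "norm (csqrt y) < 1" using y by (simp add: norm_csqrt real_sqrt_lt_1_iff)
  moreover have "csqrt y ^ (2 * n) = y ^ n" for n by (simp add: power_mult)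
  ultimately show "(\<lambda>n. d n * y ^ n) sums sinc_neg_power s (csqrt y)" "(\<lambda>n. alpha s n * y ^ n) sums sinc_neg_power s (csqrt y)"
    using assms[of "csqrt y"] alpha_sums[of "csqrt y"] by simp_all
qed

text \<open>Conjugating the coefficients gives another expansion of the same function.\<close>

lemma alpha_real: "alpha (of_real s) n \<in> \<real>"
proof -
  have "(\<lambda>n. cnj (alpha (of_real s) n)) = alpha (of_real s)"
  proof (rule alpha_coeffs_unique)
    fix z :: complex assume z: "norm z < 1"
    have "cnj (sinc_neg_power (of_real s) (cnj z)) = sinc_neg_power (of_real s) z"
      unfolding sinc_neg_power_def using log_sinc_cnj[OF z] by (simp add: exp_cnj)
    then show "(\<lambda>n. cnj (alpha (of_real s) n) * z ^ (2 * n)) sums sinc_neg_power (of_real s) z"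
      using alpha_sums[of "cnj z" "of_real s"] z sums_cnj[of "\<lambda>n. alpha (of_real s) n * cnj z ^ (2 * n)" "sinc_neg_power (of_real s) (cnj z)"]
      by simp
  qed
  then show ?thesis by (metis Reals_cnj_iff)
qed

definition alpha_re :: "real \<Rightarrow> nat \<Rightarrow> real" where
  "alpha_re s n = Re (alpha (of_real s) n)"

lemma alpha_eq_alpha_re: "alpha (of_real s) n = of_real (alpha_re s n)"
  using alpha_real by (simp add: alpha_re_def)

lemma alpha_re_sums:
  fixes x :: real
  assumes x: "0 < x" "x < 1"
  shows "(\<lambda>n. alpha_re s n * x ^ (2 * n)) sums ((sin (pi * x) / (pi * x)) powr - s)"
proof -
  have "0 < sin (pi * x)" using x by (intro sin_gt_zero) auto
  then have pos: "0 < sin (pi * x) / (pi * x)" using x by simp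
  have "sinc (of_real x) = of_real (sin (pi * x) / (pi * x))"
    using x by (simp add: sinc_def flip: sin_of_real of_real_mult)
  moreover have re: "log_sinc (of_real x) = of_real (Re (log_sinc (of_real x)))"
    using log_sinc_cnj[of "of_real x"] x by (simp add: Reals_cnj_iff)
  ultimately have "of_real (exp (Re (log_sinc (of_real x)))) = complex_of_real (sin (pi * x) / (pi * x))"
    using exp_log_sinc[of "of_real x"] x by (metis exp_of_real mem_ball_0 norm_of_real abs_of_pos)
  then have "exp (Re (log_sinc (of_real x))) = sin (pi * x) / (pi * x)"
    using of_real_eq_iff by blast
  then have "Re (log_sinc (of_real x)) = ln (sin (pi * x) / (pi * x))"
    by (metis ln_exp)
  then have "sinc_neg_power (of_real s) (of_real x) = of_real ((sin (pi * x) / (pi * x)) powr - s)"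
    unfolding sinc_neg_power_def using pos x \<open>0 < sin (pi * x)\<close>
    by (subst re) (simp add: powr_def exp_of_real[symmetric])
  then have "(\<lambda>n. complex_of_real (alpha_re s n * x ^ (2 * n))) sums of_real ((sin (pi * x) / (pi * x)) powr - s)"
    using alpha_sums[of "of_real x" "of_real s"] x by (simp add: alpha_eq_alpha_re)
  then show ?thesis by (simp only: sums_of_real_iff)
qed

section \<open>Midpoint energies for even exponents\<close>

text \<open>Dividing by the power of the largest base leaves its coefficient and null sequences; the rest is
  induction on the number of bases. It turns an asymptotic expansion with error \<open>o(1)\<close> into an identity of
  coefficients.\<close>

lemma geometric_independence:
  fixes r d :: "'a \<Rightarrow> real"
  assumes fin: "finite K" and inj: "inj_on r K" and r: "\<And>k. k \<in> K \<Longrightarrow> r k \<ge> 1"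
    and lim: "(\<lambda>n. \<Sum>k\<in>K. d k * r k ^ n) \<longlonglongrightarrow> 0"
  shows "\<And>k. k \<in> K \<Longrightarrow> d k = 0"
proof -
  have "finite K \<Longrightarrow> inj_on r K \<Longrightarrow> (\<forall>k\<in>K. r k \<ge> 1) \<Longrightarrow> (\<lambda>n. \<Sum>k\<in>K. d k * r k ^ n) \<longlonglongrightarrow> 0 \<Longrightarrow> \<forall>k\<in>K. d k = 0"
  proof (induction "card K" arbitrary: K)
    case 0
    then show ?case by simp
  next
    case (Suc m)
    have "K \<noteq> {}" using Suc.hyps by auto
    then have "Max (r ` K) \<in> r ` K" using Suc.prems by (intro Max_in) auto
    then obtain k0 where k0: "k0 \<in> K" "r k0 = Max (r ` K)" by auto
    have less: "r k < r k0" if "k \<in> K - {k0}" for k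
    proof -
      have "r k \<le> r k0" using k0 that Suc.prems by simp
      moreover have "r k \<noteq> r k0" using that k0(1) inj_on_eq_iff[OF Suc.prems(2), of k k0] by auto
      ultimately show ?thesis by simp
    qed
    have r0: "r k0 \<ge> 1" using k0 Suc.prems by auto
    have bd: "\<forall>\<^sub>F n in sequentially. norm (inverse (r k0) ^ n) \<le> 1"
      using r0 by (intro always_eventually allI) (simp add: norm_power power_le_one inverse_le_1_iff)
    have "(\<lambda>n. inverse (r k0) ^ n * (\<Sum>k\<in>K. d k * r k ^ n)) \<longlonglongrightarrow> 0"
      by (rule lim_null_mult_left_bounded[OF bd Suc.prems(4)])
    moreover have "inverse (r k0) ^ n * (\<Sum>k\<in>K. d k * r k ^ n) = d k0 + (\<Sum>k\<in>K - {k0}. d k * (r k / r k0) ^ n)" for n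
    proof -
      have "inverse (r k0) ^ n * (\<Sum>k\<in>K. d k * r k ^ n) = (\<Sum>k\<in>K. d k * (r k / r k0) ^ n)"
        by (simp add: sum_distrib_left divide_inverse power_mult_distrib power_inverse mult_ac)
      also have "\<dots> = d k0 * (r k0 / r k0) ^ n + (\<Sum>k\<in>K - {k0}. d k * (r k / r k0) ^ n)"
        using k0 Suc.prems by (intro sum.remove) auto
      finally show ?thesis using r0 by simp
    qed
    moreover have "(\<lambda>n. d k0 + (\<Sum>k\<in>K - {k0}. d k * (r k / r k0) ^ n)) \<longlonglongrightarrow> d k0 + (\<Sum>k\<in>K - {k0}. d k * 0)"
      using less Suc.prems r0
      by (intro tendsto_intros LIMSEQ_realpow_zero) (force simp: divide_less_eq_1)+
    ultimately have d0: "d k0 = 0" using LIMSEQ_unique by fastforce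
    have "(\<Sum>k\<in>K. d k * r k ^ n) = (\<Sum>k\<in>K - {k0}. d k * r k ^ n)" for n
      using k0 Suc.prems(1) d0 by (simp add: sum.remove)
    then have "\<forall>k\<in>K - {k0}. d k = 0"
      using Suc.prems Suc.hyps(2) k0 by (intro Suc.hyps(1)) (auto intro: inj_on_subset)
    then show ?case using d0 by auto
  qed
  then show "\<And>k. k \<in> K \<Longrightarrow> d k = 0" using assms by blast
qed

text \<open>If \<open>y + y' = y y' = w\<close>, then \<open>p\<^sub>m = y ^ m + y' ^ m\<close> satisfies
  \<open>p\<^sub>m = w (p\<^bsub>m-1\<^esub> - p\<^bsub>m-2\<^esub>)\<close>; started from \<open>p\<^sub>1 = w\<close> and \<open>p\<^sub>2 = w\<^sup>2 - 2 w\<close> it never produces a constant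
  term.\<close>

lemma power_sum_of_sum_eq_prod:
  fixes m :: nat
  assumes "m \<ge> 1"
  shows "\<exists>c. \<forall>y y' w :: real. y + y' = w \<longrightarrow> y * y' = w \<longrightarrow> y ^ m + y' ^ m = w ^ m + (\<Sum>k\<in>{1..<m}. c k * w ^ k)"
  using assms
proof (induction m rule: less_induct)
  case (less m)
  consider "m = 1" | "m = 2" | "m \<ge> 3" using less.prems by linarith
  then show ?case
  proof cases
    case 1
    then show ?thesis by simp
  next
    case 2
    have "y ^ 2 + y' ^ 2 = w ^ 2 + (\<Sum>k\<in>{1..<2}. - 2 * w ^ k)" if "y + y' = w" "y * y' = w" for y y' w :: real
    proof -
      have "y ^ 2 + y' ^ 2 = (y + y') ^ 2 - 2 * (y * y')" by (simp add: power2_eq_square algebra_simps)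
      then show ?thesis using that by (simp add: numeral_2_eq_2)
    qed
    then show ?thesis unfolding 2 by (intro exI[of _ "\<lambda>_. - 2"]) blast
  next
    case 3
    obtain l where m: "m = Suc (Suc l)" and l: "l \<ge> 1" using 3
      by (metis One_nat_def Suc_le_D Suc_le_mono numeral_3_eq_3)
    obtain c1 where c1: "\<And>y y' w :: real. y + y' = w \<Longrightarrow> y * y' = w \<Longrightarrow>
        y ^ Suc l + y' ^ Suc l = w ^ Suc l + (\<Sum>k\<in>{1..<Suc l}. c1 k * w ^ k)"
      using less.IH[of "Suc l"] m by auto
    obtain c0 where c0: "\<And>y y' w :: real. y + y' = w \<Longrightarrow> y * y' = w \<Longrightarrow>
        y ^ l + y' ^ l = w ^ l + (\<Sum>k\<in>{1..<l}. c0 k * w ^ k)"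
      using less.IH[of l] m l by auto
    define c where "c k = (if k = 1 then 0 else c1 (k - 1)) - (if k = Suc l then 1 else if k = 1 then 0 else c0 (k - 1))" for k
    have "y ^ m + y' ^ m = w ^ m + (\<Sum>k\<in>{1..<m}. c k * w ^ k)" if w: "y + y' = w" "y * y' = w" for y y' w :: real
    proof -
      have "y ^ m + y' ^ m = (y + y') * (y ^ Suc l + y' ^ Suc l) - (y * y') * (y ^ l + y' ^ l)"
        by (simp add: m algebra_simps)
      also have "\<dots> = w * (w ^ Suc l + (\<Sum>k\<in>{1..<Suc l}. c1 k * w ^ k)) - w * (w ^ l + (\<Sum>k\<in>{1..<l}. c0 k * w ^ k))"
        unfolding c1[OF w] c0[OF w] w ..
      also have "\<dots> = w ^ m + ((\<Sum>k\<in>{1..<Suc l}. c1 k * w ^ Suc k) - (w ^ Suc l + (\<Sum>k\<in>{1..<l}. c0 k * w ^ Suc k)))"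
        by (simp add: m distrib_left sum_distrib_left mult_ac)
      also have "(\<Sum>k\<in>{1..<Suc l}. c1 k * w ^ Suc k) = (\<Sum>k\<in>{2..<m}. c1 (k - 1) * w ^ k)"
        using sum.shift_bounds_Suc_ivl[of "\<lambda>k. c1 (k - 1) * w ^ k" 1 "Suc l"] by (simp add: m numeral_2_eq_2)
      also have "\<dots> = (\<Sum>k\<in>{1..<m}. (if k = 1 then 0 else c1 (k - 1)) * w ^ k)"
        by (rule sum.mono_neutral_cong_left) auto
      also have "(\<Sum>k\<in>{1..<l}. c0 k * w ^ Suc k) = (\<Sum>k\<in>{2..<Suc l}. c0 (k - 1) * w ^ k)"
        using sum.shift_bounds_Suc_ivl[of "\<lambda>k. c0 (k - 1) * w ^ k" 1 l] by (simp add: numeral_2_eq_2)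
      also have "w ^ Suc l + \<dots> = (\<Sum>k\<in>insert (Suc l) {2..<Suc l}. (if k = Suc l then 1 else c0 (k - 1)) * w ^ k)"
        by (subst sum.insert) (auto intro!: sum.cong)
      also have "\<dots> = (\<Sum>k\<in>{1..<m}. (if k = Suc l then 1 else if k = 1 then 0 else c0 (k - 1)) * w ^ k)"
        using l by (intro sum.mono_neutral_cong_left) (auto simp: m)
      finally show ?thesis by (simp add: c_def left_diff_distrib sum_subtractf)
    qed
    then show ?thesis by blast
  qed
qed

text \<open>Up to the factor \<open>4 ^ m\<close> this is the midpoint energy of \<open>2 ^ n\<close> points for the exponent \<open>2 m\<close>.\<close>

definition csc2_power_sum :: "nat \<Rightarrow> nat \<Rightarrow> real" where
  "csc2_power_sum m n = (\<Sum>i<2 ^ n. (1 / sin (pi * real (2 * i + 1) / 2 ^ Suc n) ^ 2) ^ m)"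

lemma sum_split_double: "(\<Sum>i<2 * N. f i) = (\<Sum>i<N. f i + f (N + i))" for f :: "nat \<Rightarrow> 'a::comm_monoid_add"
proof -
  have "(\<Sum>i<N + k. f i) = (\<Sum>i<N. f i) + (\<Sum>i<k. f (N + i))" for k
    by (induction k) (simp_all add: add.assoc)
  from this[of N] show ?thesis by (simp add: sum.distrib mult_2)
qed

text \<open>The nodes for \<open>2 ^ (n+1)\<close> points fall into pairs \<open>z\<close>, \<open>z + \<pi>/2\<close>. For such a pair, \<open>1/sin\<^sup>2 z\<close> and
  \<open>1/cos\<^sup>2 z\<close> have both sum and product \<open>4/sin\<^sup>2 2z\<close>, and \<open>2z\<close> runs through the nodes for \<open>2 ^ n\<close> points.\<close>

lemma csc2_power_sum_Suc:
  assumes c: "\<And>y y' w :: real. y + y' = w \<Longrightarrow> y * y' = w \<Longrightarrow> y ^ m + y' ^ m = w ^ m + (\<Sum>k\<in>{1..<m}. c k * w ^ k)"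
  shows "csc2_power_sum m (Suc n) = 4 ^ m * csc2_power_sum m n + (\<Sum>k\<in>{1..<m}. c k * 4 ^ k * csc2_power_sum k n)"
proof -
  define z where "z i = pi * real (2 * i + 1) / 2 ^ Suc (Suc n)" for i
  define y where "y i = 1 / sin (2 * z i) ^ 2" for i
  have z2: "2 * z i = pi * real (2 * i + 1) / 2 ^ Suc n" for i by (simp add: z_def field_simps)
  have E: "csc2_power_sum k n = (\<Sum>i<2 ^ n. y i ^ k)" for k
    unfolding csc2_power_sum_def y_def z2 ..
  have step: "(1 / sin (z i) ^ 2) ^ m + (1 / sin (z (2 ^ n + i)) ^ 2) ^ m
      = 4 ^ m * y i ^ m + (\<Sum>k\<in>{1..<m}. c k * 4 ^ k * y i ^ k)" if i: "i < 2 ^ n" for i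
  proof -
    have "z (2 ^ n + i) = z i + pi / 2" by (simp add: z_def field_simps)
    then have s': "sin (z (2 ^ n + i)) = cos (z i)" by (simp add: sin_add)
    have "real (2 * i + 1) < 2 * 2 ^ n"
    proof -
      have "2 * i + 1 < 2 * 2 ^ n" using i by linarith
      then have "real (2 * i + 1) < real (2 * 2 ^ n)" by (simp only: of_nat_less_iff)
      then show ?thesis by simp
    qed
    then have "pi * real (2 * i + 1) < pi * (2 * 2 ^ n)" by (intro mult_strict_left_mono) auto
    then have z': "z i < pi / 2" by (simp add: z_def field_simps)
    have z: "0 < z i" unfolding z_def by (intro divide_pos_pos mult_pos_pos) auto
    have s0: "sin (z i) > 0" using z z' by (intro sin_gt_zero) auto
    have c0: "cos (z i) > 0" using z z' by (intro cos_gt_zero) auto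
    have "1 / sin (z i) ^ 2 + 1 / cos (z i) ^ 2 = (cos (z i) ^ 2 + sin (z i) ^ 2) / (sin (z i) ^ 2 * cos (z i) ^ 2)"
      using s0 c0 by (simp add: field_simps)
    also have "\<dots> = 4 * y i"
      using s0 c0 by (simp add: y_def sin_double power_mult_distrib)
    finally have 1: "1 / sin (z i) ^ 2 + 1 / cos (z i) ^ 2 = 4 * y i" .
    have 2: "1 / sin (z i) ^ 2 * (1 / cos (z i) ^ 2) = 4 * y i"
      using s0 c0 by (simp add: y_def sin_double power_mult_distrib)
    show ?thesis unfolding s' c[OF 1 2] by (simp add: power_mult_distrib mult.assoc)
  qed
  have "csc2_power_sum m (Suc n) = (\<Sum>i<2 * 2 ^ n. (1 / sin (z i) ^ 2) ^ m)"
    unfolding csc2_power_sum_def z_def by simp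
  also have "\<dots> = (\<Sum>i<2 ^ n. 4 ^ m * y i ^ m + (\<Sum>k\<in>{1..<m}. c k * 4 ^ k * y i ^ k))"
    unfolding sum_split_double by (intro sum.cong refl step) simp
  also have "\<dots> = 4 ^ m * (\<Sum>i<2 ^ n. y i ^ m) + (\<Sum>k\<in>{1..<m}. c k * 4 ^ k * (\<Sum>i<2 ^ n. y i ^ k))"
    unfolding sum.distrib sum_distrib_left by (subst sum.swap) simp
  finally show ?thesis unfolding E .
qed

lemma linear_recurrence_solution:
  fixes X :: "nat \<Rightarrow> real"
  assumes rec: "\<And>n. X (Suc n) = q * X n + (\<Sum>k\<in>K. b k * r k ^ n)" and r: "\<And>k. k \<in> K \<Longrightarrow> r k \<noteq> q"
  shows "X n = (X 0 - (\<Sum>k\<in>K. b k / (r k - q))) * q ^ n + (\<Sum>k\<in>K. b k / (r k - q) * r k ^ n)"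
proof (induction n)
  case (Suc n)
  have "(\<Sum>k\<in>K. b k / (r k - q) * r k ^ Suc n) = q * (\<Sum>k\<in>K. b k / (r k - q) * r k ^ n) + (\<Sum>k\<in>K. b k * r k ^ n)"
    unfolding sum_distrib_left sum.distrib[symmetric]
  proof (rule sum.cong[OF refl])
    fix k assume "k \<in> K"
    define e where "e = b k / (r k - q)"
    have be: "b k = (r k - q) * e" using r[OF \<open>k \<in> K\<close>] by (simp add: e_def)
    show "b k / (r k - q) * r k ^ Suc n = q * (b k / (r k - q) * r k ^ n) + b k * r k ^ n"
      unfolding e_def[symmetric] by (simp add: be algebra_simps)
  qed
  then show ?case unfolding rec Suc by (simp add: algebra_simps)
qed simp

text \<open>The recursion \<open>csc2_power_sum_Suc\<close> is triangular in \<open>m\<close> with the distinct diagonal entries \<open>4 ^ m\<close>.\<close>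

lemma csc2_power_sum_exponentials:
  "m \<ge> 1 \<Longrightarrow> \<exists>d. \<forall>n. csc2_power_sum m n = (\<Sum>k\<in>{1..m}. d k * (4 ^ k) ^ n)"
proof (induction m rule: less_induct)
  case (less m)
  obtain c where c: "\<And>y y' w :: real. y + y' = w \<Longrightarrow> y * y' = w \<Longrightarrow>
      y ^ m + y' ^ m = w ^ m + (\<Sum>k\<in>{1..<m}. c k * w ^ k)"
    using power_sum_of_sum_eq_prod[OF less.prems] by blast
  have "\<forall>k\<in>{1..<m}. \<exists>d. \<forall>n. csc2_power_sum k n = (\<Sum>l\<in>{1..k}. d l * (4 ^ l) ^ n)"
    using less.IH by auto
  then obtain D where D: "\<And>k n. k \<in> {1..<m} \<Longrightarrow> csc2_power_sum k n = (\<Sum>l\<in>{1..k}. D k l * (4 ^ l) ^ n)"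
    by (metis (no_types) bchoice)
  define b where "b l = (\<Sum>k\<in>{1..<m}. if l \<le> k then c k * 4 ^ k * D k l else 0)" for l
  have "(\<Sum>k\<in>{1..<m}. c k * 4 ^ k * csc2_power_sum k n) = (\<Sum>l\<in>{1..<m}. b l * (4 ^ l) ^ n)" for n
  proof -
    have "(\<Sum>k\<in>{1..<m}. c k * 4 ^ k * csc2_power_sum k n)
        = (\<Sum>k\<in>{1..<m}. \<Sum>l\<in>{1..<m}. (if l \<le> k then c k * 4 ^ k * D k l else 0) * (4 ^ l) ^ n)"
    proof (rule sum.cong[OF refl])
      fix k assume k: "k \<in> {1..<m}"
      show "c k * 4 ^ k * csc2_power_sum k n
          = (\<Sum>l\<in>{1..<m}. (if l \<le> k then c k * 4 ^ k * D k l else 0) * (4 ^ l) ^ n)"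
        unfolding D[OF k] sum_distrib_left
        using k by (intro sum.mono_neutral_cong_left) (auto simp: mult.assoc)
    qed
    then show ?thesis unfolding b_def sum_distrib_right by (subst sum.swap)
  qed
  then have rec: "csc2_power_sum m (Suc n) = 4 ^ m * csc2_power_sum m n + (\<Sum>l\<in>{1..<m}. b l * (4 ^ l) ^ n)" for n
    using csc2_power_sum_Suc[OF c] by simp
  have ne: "(4::real) ^ l \<noteq> 4 ^ m" if "l \<in> {1..<m}" for l using that by simp
  \<comment> \<open>the homogeneous solution \<open>4 ^ m\<close> is fixed by the value at \<open>n = 0\<close>\<close>
  define d where "d k = (if k = m then csc2_power_sum m 0 - (\<Sum>k\<in>{1..<m}. b k / (4 ^ k - 4 ^ m)) else b k / (4 ^ k - 4 ^ m))" for k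
  have "csc2_power_sum m n = (\<Sum>k\<in>{1..m}. d k * (4 ^ k) ^ n)" for n
  proof -
    have "{1..m} = insert m {1..<m}" using less.prems by auto
    then show ?thesis
      using linear_recurrence_solution[where X = "csc2_power_sum m" and r = "\<lambda>k. 4 ^ k", OF rec ne, of n] by (simp add: d_def)
  qed
  then show ?case by blast
qed

lemma midpoint_energy_even:
  assumes "m \<ge> 1"
  shows "\<exists>d. \<forall>n. midpoint_energy (real (2 * m)) (2 ^ n) = (\<Sum>k\<in>{1..m}. d k * (4 ^ k) ^ n)"
proof -
  have e: "midpoint_energy (real (2 * m)) (2 ^ n) = csc2_power_sum m n / 4 ^ m" for n
    unfolding midpoint_energy_def csc2_power_sum_def sum_divide_distrib
  proof (rule sum.cong[OF refl])
    fix i :: nat assume "i \<in> {..<2 ^ n}"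
    define x where "x = pi * real (2 * i + 1) / 2 ^ Suc n"
    have "2 * i + 1 < 2 * 2 ^ n" using \<open>i \<in> _\<close> by auto
    then have "real (2 * i + 1) < real (2 * 2 ^ n)" by (simp only: of_nat_less_iff)
    then have "pi * real (2 * i + 1) < pi * (2 * 2 ^ n)" by (intro mult_strict_left_mono) auto
    then have "x < pi" by (simp add: x_def field_simps)
    moreover have "0 < x" unfolding x_def by (intro divide_pos_pos mult_pos_pos) auto
    ultimately have "sin x > 0" by (intro sin_gt_zero)
    then have "(2 * sin x) powr - real (2 * m) = (1 / sin x ^ 2) ^ m / 4 ^ m"
      by (simp add: powr_minus_divide powr_realpow power_mult_distrib power_mult power_one_over divide_simps del: of_nat_mult)
    then show "(2 * sin (pi * real (2 * i + 1) / real (2 * 2 ^ n))) powr - real (2 * m) =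
        (1 / (sin (pi * real (2 * i + 1) / 2 ^ Suc n))\<^sup>2) ^ m / 4 ^ m"
      unfolding x_def by simp
  qed
  obtain d where "\<And>n. csc2_power_sum m n = (\<Sum>k\<in>{1..m}. d k * (4 ^ k) ^ n)"
    using csc2_power_sum_exponentials[OF assms] by blast
  then show ?thesis unfolding e by (intro exI[of _ "\<lambda>k. d k / 4 ^ m"]) (simp add: sum_divide_distrib)
qed

section \<open>Midpoint sums of functions with a singularity at the left end\<close>

definition pser :: "(nat \<Rightarrow> real) \<Rightarrow> real \<Rightarrow> real" where
  "pser c y = (\<Sum>n. c n * y ^ n)"

definition unit_summable :: "(nat \<Rightarrow> real) \<Rightarrow> bool" where
  "unit_summable c \<longleftrightarrow> (\<forall>y. \<bar>y\<bar> < 1 \<longrightarrow> summable (\<lambda>n. c n * y ^ n))"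

lemma unit_summableI:
  assumes "\<And>x. 0 < x \<Longrightarrow> x < 1 \<Longrightarrow> summable (\<lambda>n. c n * x ^ n)"
  shows "unit_summable c"
  unfolding unit_summable_def
proof (intro allI impI)
  fix y :: real assume y: "\<bar>y\<bar> < 1"
  define x where "x = (\<bar>y\<bar> + 1) / 2"
  have x: "0 < x" "x < 1" "\<bar>y\<bar> < x" using y by (auto simp: x_def)
  show "summable (\<lambda>n. c n * y ^ n)"
    using powser_inside[OF assms[OF x(1,2)], of y] x by simp
qed

lemma pser_deriv:
  assumes "unit_summable c" "\<bar>y\<bar> < 1"
  shows "(pser c has_real_derivative pser (diffs c) y) (at y)"
  unfolding pser_def[abs_def]
  by (rule termdiffs_strong'[where K = 1]) (use assms in \<open>auto simp: unit_summable_def\<close>)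

lemma unit_summable_diffs: "unit_summable c \<Longrightarrow> unit_summable (diffs c)"
  unfolding unit_summable_def by (auto intro!: termdiff_converges[where K = 1])

lemma pser_continuous: "unit_summable c \<Longrightarrow> A \<subseteq> {-1<..<1} \<Longrightarrow> continuous_on A (pser c)"
proof (rule DERIV_continuous_on)
  fix x assume "unit_summable c" "A \<subseteq> {-1<..<1}" "x \<in> A"
  then show "(pser c has_real_derivative pser (diffs c) x) (at x within A)"
    by (intro has_field_derivative_at_within[OF pser_deriv]) (auto simp: abs_less_iff)
qed

text \<open>The operator \<open>x d/dx\<close> multiplies the term \<open>c\<^sub>n x powr (b + 2 n)\<close> of \<open>x powr b * p(x ^ 2)\<close> by its exponent.\<close>

lemma euler_coeffs_sums:
  assumes "unit_summable c" "\<bar>y\<bar> < 1"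
  shows "(\<lambda>n. (b + 2 * real n) * c n * y ^ n) sums (b * pser c y + 2 * y * pser (diffs c) y)"
proof -
  have s: "summable (\<lambda>n. diffs c n * y ^ n)"
    using unit_summable_diffs[OF assms(1)] assms(2) by (simp add: unit_summable_def)
  have "(\<lambda>n. 2 * y * (real n * c n * y ^ (n - Suc 0))) sums (2 * y * pser (diffs c) y)"
    using sums_mult[OF diffs_equiv[OF s], of "2 * y"] by (simp add: pser_def)
  moreover have "2 * y * (real n * c n * y ^ (n - Suc 0)) = 2 * real n * c n * y ^ n" for n
    by (cases n) (simp_all add: mult_ac)
  ultimately have 1: "(\<lambda>n. 2 * real n * c n * y ^ n) sums (2 * y * pser (diffs c) y)" by (simp only:)
  have 2: "(\<lambda>n. b * (c n * y ^ n)) sums (b * pser c y)"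
    using assms by (auto simp: pser_def unit_summable_def intro!: sums_mult summable_sums)
  have "(b + 2 * real n) * c n * y ^ n = b * (c n * y ^ n) + 2 * real n * c n * y ^ n" for n
    by (simp add: algebra_simps)
  then show ?thesis using sums_add[OF 2 1] by (simp only:)
qed

lemma unit_summable_euler: "unit_summable c \<Longrightarrow> unit_summable (\<lambda>n. (b + 2 * real n) * c n)"
  unfolding unit_summable_def[of "\<lambda>n. (b + 2 * real n) * c n"]
  using euler_coeffs_sums[of c _ b] by (auto simp: sums_iff)

text \<open>The class of functions \<open>x powr b * p(x ^ 2)\<close> is closed under differentiation, with \<open>b\<close> lowered by \<open>1\<close>.
  So bounds for the derivatives follow from boundedness of power series on \<open>{0..1/4}\<close>.\<close>

lemma powr_pser_deriv:
  assumes c: "unit_summable c" and x: "0 < x" "x < 1"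
  shows "((\<lambda>x. x powr b * pser c (x ^ 2)) has_real_derivative
     x powr (b - 1) * pser (\<lambda>n. (b + 2 * real n) * c n) (x ^ 2)) (at x)"
proof -
  have x2: "\<bar>x ^ 2\<bar> < 1" using x by (simp add: power_less_one_iff)
  have "((\<lambda>x. x powr b * pser c (x ^ 2)) has_real_derivative
      (b * x powr (b - 1)) * pser c (x ^ 2) + (pser (diffs c) (x ^ 2) * (2 * x)) * x powr b) (at x)"
    using x by (auto intro!: derivative_eq_intros
        DERIV_chain2[where f = "pser c" and g = "\<lambda>x. x ^ 2", OF pser_deriv[OF c x2]])
  moreover have "x powr b = x powr (b - 1) * x"
    using x by (simp add: powr_diff)
  moreover have "pser (\<lambda>n. (b + 2 * real n) * c n) (x ^ 2) = b * pser c (x ^ 2) + 2 * x ^ 2 * pser (diffs c) (x ^ 2)"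
    using euler_coeffs_sums[OF c x2, of b] by (simp add: pser_def sums_iff)
  ultimately show ?thesis by (simp add: algebra_simps power2_eq_square)
qed

lemma pser_bounded:
  assumes "unit_summable c"
  obtains B where "B \<ge> 0" "\<And>x. 0 \<le> x \<Longrightarrow> x \<le> 1/2 \<Longrightarrow> \<bar>pser c (x ^ 2)\<bar> \<le> B"
proof -
  have "compact (pser c ` {0..1/4})"
    by (intro compact_continuous_image pser_continuous assms) auto
  then have "bounded (pser c ` {0..1/4})" by (rule compact_imp_bounded)
  then obtain B where "\<forall>z\<in>pser c ` {0..1/4}. norm z \<le> B"
    unfolding bounded_iff by blast
  then have B: "\<And>y. y \<in> {0..1/4} \<Longrightarrow> \<bar>pser c y\<bar> \<le> B" by auto
  have "\<bar>pser c (x ^ 2)\<bar> \<le> B" if "0 \<le> x" "x \<le> 1/2" for x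
    using that power_mono[of x "1/2" 2] by (intro B) (simp add: power2_eq_square)
  moreover have "B \<ge> 0" using B[of 0] abs_ge_zero[of "pser c 0"] by (simp del: abs_ge_zero)
  ultimately show ?thesis using that by blast
qed

lemma unit_summable_shift: "unit_summable c \<Longrightarrow> unit_summable (\<lambda>n. c (n + K))"
proof (rule unit_summableI)
  fix x :: real assume c: "unit_summable c" and x: "0 < x" "x < 1"
  then have "summable (\<lambda>n. c (n + K) * x ^ (n + K))"
    by (subst summable_iff_shift) (simp add: unit_summable_def)
  then have "summable (\<lambda>n. inverse (x ^ K) * (c (n + K) * x ^ (n + K)))"
    by (rule summable_mult)
  then show "summable (\<lambda>n. c (n + K) * x ^ n)"
    using x by (simp add: power_add field_simps)
qed

lemma pser_split:
  assumes "unit_summable c" "\<bar>y\<bar> < 1"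
  shows "pser c y = (\<Sum>n<K. c n * y ^ n) + y ^ K * pser (\<lambda>n. c (n + K)) y"
proof -
  have s: "summable (\<lambda>n. c n * y ^ n)" using assms by (simp add: unit_summable_def)
  have "(\<Sum>n. y ^ K * (c (n + K) * y ^ n)) = y ^ K * pser (\<lambda>n. c (n + K)) y"
    unfolding pser_def using unit_summable_shift[OF assms(1), of K] assms(2)
    by (intro suminf_mult) (simp add: unit_summable_def)
  then show ?thesis using suminf_split_initial_segment[OF s, of K]
    by (simp add: pser_def power_add mult_ac)
qed

text \<open>The linear Taylor polynomial at the midpoint is integrated exactly.\<close>

lemma midpoint_cell:
  fixes f :: "real \<Rightarrow> real"
  assumes r: "r \<ge> 0"
    and d1: "\<And>x. x \<in> {c - r..c + r} \<Longrightarrow> (f has_real_derivative f1 x) (at x)"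
    and d2: "\<And>x. x \<in> {c - r..c + r} \<Longrightarrow> (f1 has_real_derivative f2 x) (at x)"
    and B: "\<And>x. x \<in> {c - r..c + r} \<Longrightarrow> \<bar>f2 x\<bar> \<le> B"
  shows "\<bar>2 * r * f c - integral {c - r..c + r} f\<bar> \<le> 2 * r ^ 3 * B"
proof -
  let ?S = "{c - r..c + r}"
  have B0: "B \<ge> 0" using B[of c] r by auto
  have "continuous_on ?S f" by (rule DERIV_continuous_on[OF has_field_derivative_at_within[OF d1]])
  then have fi: "(f has_integral integral ?S f) ?S" by (intro integrable_integral integrable_continuous_interval)
  define g where "g x = f x - (f c + f1 c * (x - c))" for x
  have "((\<lambda>x. f c + f1 c * (x - c)) has_integral
      (f c * (c + r) + f1 c * ((c + r) - c) ^ 2 / 2) - (f c * (c - r) + f1 c * ((c - r) - c) ^ 2 / 2)) ?S"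
    by (rule fundamental_theorem_of_calculus)
      (use r in \<open>auto intro!: derivative_eq_intros simp flip: has_real_derivative_iff_has_vector_derivative\<close>)
  then have "((\<lambda>x. f c + f1 c * (x - c)) has_integral 2 * r * f c) ?S"
    by (simp add: algebra_simps power2_eq_square)
  then have g: "(g has_integral integral ?S f - 2 * r * f c) ?S"
    unfolding g_def by (rule has_integral_diff[OF fi])
  have gb: "norm (g x) \<le> B * r ^ 2" if x: "x \<in> ?S" for x
  proof -
    define F where "F i = (if i = 0 then f else if i = 1 then f1 else f2)" for i :: nat
    have "norm (F 0 x - (\<Sum>i\<le>1. F i c * (x - c) ^ i / fact i)) \<le> B * norm (x - c) ^ Suc 1 / fact 1"
    proof (rule field_Taylor[of ?S])
      show "(F i has_field_derivative F (Suc i) y) (at y within ?S)" if "y \<in> ?S" "i \<le> 1" for i y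
        using that by (cases i) (auto simp: F_def intro: has_field_derivative_at_within[OF d1] has_field_derivative_at_within[OF d2])
    qed (use r x B in \<open>auto simp: F_def\<close>)
    then have "norm (g x) \<le> B * \<bar>x - c\<bar> ^ 2"
      by (simp add: F_def g_def power2_eq_square)
    also have "\<dots> \<le> B * r ^ 2" using x B0 by (intro mult_left_mono power_mono) auto
    finally show ?thesis .
  qed
  have "norm (integral ?S f - 2 * r * f c) \<le> B * r ^ 2 * measure lborel (cbox (c - r) (c + r))"
    by (rule has_integral_bound[of _ g]) (use g gb B0 in auto)
  also have "measure lborel (cbox (c - r) (c + r)) = 2 * r" using r by simp
  finally show ?thesis by (simp add: power3_eq_cube power2_eq_square mult_ac abs_minus_commute)
qed

text \<open>All error sums below are reduced to the exponent \<open>-3/2\<close>, which is summable and leaves a power \<open>-1/2\<close> or \<open>-\<delta>\<close>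
  for the decay.\<close>

definition tail_const :: real where
  "tail_const = (\<Sum>n. real n powr (- 3/2))"

lemma tail_const_sum_le: "finite A \<Longrightarrow> (\<Sum>n\<in>A. real n powr (- 3/2)) \<le> tail_const"
  unfolding tail_const_def by (intro sum_le_suminf) (auto simp: summable_real_powr_iff)

lemma tail_const_nonneg: "tail_const \<ge> 0"
  using tail_const_sum_le[of "{}"] by simp

lemma telescoping_rate:
  fixes A :: "nat \<Rightarrow> real"
  assumes lim: "A \<longlonglongrightarrow> Z" and e: "e \<ge> 0" and B: "B \<ge> 0"
    and d: "\<And>i. i \<ge> 1 \<Longrightarrow> \<bar>A (Suc i) - A i\<bar> \<le> B * real i powr (- e - 3/2)"
    and m: "m \<ge> 1"
  shows "\<bar>A m - Z\<bar> \<le> B * tail_const * real m powr - e"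
proof (rule tendsto_upperbound)
  show "(\<lambda>l. \<bar>A m - A l\<bar>) \<longlonglongrightarrow> \<bar>A m - Z\<bar>" by (intro tendsto_intros lim)
  have "\<bar>A m - A l\<bar> \<le> B * tail_const * real m powr - e" if l: "l \<ge> m" for l
  proof -
    have "\<bar>A m - A l\<bar> = \<bar>\<Sum>i\<in>{m..<l}. A (Suc i) - A i\<bar>"
      using sum_Suc_diff'[OF l, of A] by (simp add: abs_minus_commute)
    also have "\<dots> \<le> (\<Sum>i\<in>{m..<l}. \<bar>A (Suc i) - A i\<bar>)" by (rule sum_abs)
    also have "\<dots> \<le> (\<Sum>i\<in>{m..<l}. B * real m powr - e * real i powr (- 3/2))"
    proof (rule sum_mono)
      fix i assume i: "i \<in> {m..<l}"
      have "real i powr (- e - 3/2) = real i powr - e * real i powr (- 3/2)"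
        by (simp flip: powr_add)
      also have "\<dots> \<le> real m powr - e * real i powr (- 3/2)"
        using i m e by (intro mult_right_mono powr_mono2') auto
      finally show "\<bar>A (Suc i) - A i\<bar> \<le> B * real m powr - e * real i powr (- 3/2)"
        using d[of i] i m B mult_left_mono[of "real i powr (- e - 3/2)" _ B] by (fastforce simp: mult.assoc)
    qed
    also have "\<dots> \<le> B * real m powr - e * tail_const"
      unfolding sum_distrib_left[symmetric] using B by (intro mult_left_mono tail_const_sum_le) auto
    finally show ?thesis by (simp add: mult_ac)
  qed
  then show "\<forall>\<^sub>F l in sequentially. \<bar>A m - A l\<bar> \<le> B * tail_const * real m powr - e"
    unfolding eventually_sequentially by blast
qed simp

lemma integral_powr:
  fixes a b e :: real
  assumes "0 < a" "a \<le> b" "e \<noteq> 1"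
  shows "((\<lambda>x. x powr - e) has_integral (b powr (1 - e) - a powr (1 - e)) / (1 - e)) {a..b}"
proof -
  have "((\<lambda>x. x powr - e) has_integral (b powr (1 - e) / (1 - e) - a powr (1 - e) / (1 - e))) {a..b}"
  proof (rule fundamental_theorem_of_calculus[OF assms(2)])
    fix x assume x: "x \<in> {a..b}"
    have "((\<lambda>x. x powr (1 - e) / (1 - e)) has_real_derivative ((1 - e) * x powr (1 - e - 1)) / (1 - e)) (at x)"
      using x assms by (intro DERIV_cdivide has_real_derivative_powr) auto
    then have "((\<lambda>x. x powr (1 - e) / (1 - e)) has_real_derivative x powr - e) (at x)"
      using assms by simp
    then show "((\<lambda>x. x powr (1 - e) / (1 - e)) has_vector_derivative x powr - e) (at x within {a..b})"
      unfolding has_real_derivative_iff_has_vector_derivative[symmetric] by (rule has_field_derivative_at_within)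
  qed
  then show ?thesis by (simp add: diff_divide_distrib)
qed

lemma powr_midpoint_cell:
  assumes e: "e \<ge> 0" "e \<noteq> 1" and i: "i \<ge> (1::nat)"
  shows "\<bar>(real i + 1/2) powr - e - (real (Suc i) powr (1 - e) - real i powr (1 - e)) / (1 - e)\<bar>
     \<le> e * (e + 1) * real i powr (- (e + 1/2) - 3/2)"
proof -
  define c where "c = real i + 1/2"
  have I: "{c - 1/2..c + 1/2} = {real i..real (Suc i)}" by (simp add: c_def)
  have int: "integral {c - 1/2..c + 1/2} (\<lambda>x. x powr - e) = (real (Suc i) powr (1 - e) - real i powr (1 - e)) / (1 - e)"
    unfolding I using i e by (intro integral_unique integral_powr) auto
  have "\<bar>2 * (1/2) * c powr - e - integral {c - 1/2..c + 1/2} (\<lambda>x. x powr - e)\<bar>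
      \<le> 2 * (1/2) ^ 3 * (e * (e + 1) * real i powr (- e - 2))"
  proof (rule midpoint_cell[where ?f1.0 = "\<lambda>x. - e * x powr (- e - 1)" and ?f2.0 = "\<lambda>x. - e * ((- e - 1) * x powr (- e - 1 - 1))"])
    fix x assume x: "x \<in> {c - 1/2..c + 1/2}"
    then have x0: "x > 0" "x \<ge> real i" using i by (auto simp: c_def)
    show "((\<lambda>x. x powr - e) has_real_derivative - e * x powr (- e - 1)) (at x)"
      by (rule has_real_derivative_powr[OF x0(1)])
    show "((\<lambda>x. - e * x powr (- e - 1)) has_real_derivative - e * ((- e - 1) * x powr (- e - 1 - 1))) (at x)"
      by (intro DERIV_cmult has_real_derivative_powr x0)
    have "x powr (- e - 2) \<le> real i powr (- e - 2)"
      using x0 i e powr_mono2'[of "- e - 2" "real i" x] by (simp add: algebra_simps)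
    then have "e * (e + 1) * x powr (- e - 2) \<le> e * (e + 1) * real i powr (- e - 2)"
      using e by (intro mult_left_mono) auto
    moreover have "- e * ((- e - 1) * x powr (- e - 1 - 1)) = e * (e + 1) * x powr (- e - 2)"
      by (simp add: algebra_simps)
    ultimately show "\<bar>- e * ((- e - 1) * x powr (- e - 1 - 1))\<bar> \<le> e * (e + 1) * real i powr (- e - 2)"
      using e by (simp add: abs_mult)
  qed simp
  also have "\<dots> \<le> e * (e + 1) * real i powr (- e - 2)"
    using e by (simp add: power3_eq_cube)
  also have "- e - 2 = - (e + 1/2) - 3/2" by simp
  finally show ?thesis unfolding int by (simp add: c_def)
qed

text \<open>With \<open>i + 1/2 = (2i+1)/2\<close> this is a sum over odd numbers, that is, a sum over all numbers up to \<open>2k+1\<close>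
  minus the sum over the even ones. The combination \<open>2 powr e * L (2k+1) - L k\<close> of partial sums
  \<open>L\<close> of the zeta series, with their growth removed, is exact.\<close>

lemma half_power_sum_limit:
  assumes e: "e > 0" "e \<noteq> 1"
  shows "(\<lambda>m. (\<Sum>i<m. (real i + 1/2) powr - e) - real m powr (1 - e) / (1 - e))
    \<longlonglongrightarrow> (2 powr e - 1) * Re (riemann_zeta (of_real e))"
proof -
  define L where "L M = (\<Sum>n<M. real (Suc n) powr - e) - real (Suc M) powr (1 - e) / (1 - e)" for M
  have L: "L \<longlonglongrightarrow> Re (riemann_zeta (of_real e))"
    using zeta_partial_sums(1)[OF e] by (simp add: L_def[abs_def])
  have odd: "(\<Sum>n<2 * k + 1. real (Suc n) powr - e)
      = (\<Sum>i<Suc k. real (2 * i + 1) powr - e) + 2 powr - e * (\<Sum>i<k. real (Suc i) powr - e)" for k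
  proof (induction k)
    case (Suc k)
    have "real (2 * Suc k) powr - e = 2 powr - e * real (Suc k) powr - e"
      by (simp add: powr_mult[symmetric])
    moreover have "2 * Suc k + 1 = Suc (Suc (2 * k + 1))" by simp
    ultimately show ?case using Suc by (simp add: algebra_simps)
  qed simp
  have A: "2 powr e * L (2 * k + 1) - L k = (\<Sum>i<Suc k. (real i + 1/2) powr - e) - real (Suc k) powr (1 - e) / (1 - e)" for k
  proof -
    have 1: "2 powr e * real (2 * i + 1) powr - e = (real i + 1/2) powr - e" for i
    proof -
      have "real (2 * i + 1) = 2 * (real i + 1/2)" by simp
      then have "real (2 * i + 1) powr - e = 2 powr - e * (real i + 1/2) powr - e"
        by (simp only: powr_mult)
      then show ?thesis by (simp add: powr_minus)
    qed
    have 2: "2 powr e * real (Suc (2 * k + 1)) powr (1 - e) = 2 * real (Suc k) powr (1 - e)"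
    proof -
      have "real (Suc (2 * k + 1)) = 2 * real (Suc k)" by simp
      then have "real (Suc (2 * k + 1)) powr (1 - e) = 2 powr (1 - e) * real (Suc k) powr (1 - e)"
        by (simp only: powr_mult)
      moreover have "2 powr e * 2 powr (1 - e) = (2::real)" by (simp flip: powr_add)
      ultimately show ?thesis by (simp flip: mult.assoc)
    qed
    have "2 powr e * L (2 * k + 1) = (\<Sum>i<Suc k. (real i + 1/2) powr - e)
        + (2 powr e * 2 powr - e) * (\<Sum>i<k. real (Suc i) powr - e) - 2 * real (Suc k) powr (1 - e) / (1 - e)"
      unfolding L_def odd right_diff_distrib distrib_left sum_distrib_left 1 times_divide_eq_right 2
      by (simp add: sum_distrib_left mult_ac)
    also have "2 powr e * 2 powr - e = (1::real)" by (simp flip: powr_add)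
    finally show ?thesis by (simp add: L_def)
  qed
  have "(\<lambda>k. 2 powr e * L (2 * k + 1) - L k) \<longlonglongrightarrow> 2 powr e * Re (riemann_zeta (of_real e)) - Re (riemann_zeta (of_real e))"
  proof (intro tendsto_intros L)
    have "filterlim (\<lambda>k::nat. 2 * k + 1) sequentially sequentially"
      by (rule filterlim_subseq) (simp add: strict_mono_def)
    then show "(\<lambda>k. L (2 * k + 1)) \<longlonglongrightarrow> Re (riemann_zeta (of_real e))"
      by (rule filterlim_compose[OF L])
  qed
  then show ?thesis unfolding A
    by (subst filterlim_sequentially_Suc[symmetric]) (simp add: algebra_simps)
qed

text \<open>At \<open>e = 0\<close> both the sum and its main term are \<open>m\<close> and the factor \<open>2 powr e - 1\<close> annihilates the zeta value,
  so the formula holds without an error.\<close>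

lemma half_power_sum_rate:
  assumes e: "e \<ge> 0" "e \<noteq> 1"
  shows "\<exists>C\<ge>0. \<forall>m\<ge>1. \<bar>(\<Sum>i<m. (real i + 1/2) powr - e) - real m powr (1 - e) / (1 - e)
    - (2 powr e - 1) * Re (riemann_zeta (of_real e))\<bar> \<le> C * real m powr (- (e + 1/2))"
proof (cases "e = 0")
  case True
  have "(real i + 1/2) powr 0 = 1" for i by simp
  then show ?thesis unfolding True by (intro exI[of _ 0]) simp
next
  case False
  define A where "A m = (\<Sum>i<m. (real i + 1/2) powr - e) - real m powr (1 - e) / (1 - e)" for m
  have d: "\<bar>A (Suc i) - A i\<bar> \<le> e * (e + 1) * real i powr (- (e + 1/2) - 3/2)" if "i \<ge> 1" for i
    using powr_midpoint_cell[OF e that] by (simp add: A_def diff_divide_distrib algebra_simps)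
  have "\<bar>A m - (2 powr e - 1) * Re (riemann_zeta (of_real e))\<bar> \<le> e * (e + 1) * tail_const * real m powr - (e + 1/2)"
    if "m \<ge> 1" for m
    using half_power_sum_limit[of e] False e that
    by (intro telescoping_rate d) (auto simp: A_def[abs_def])
  then show ?thesis using e tail_const_nonneg
    by (intro exI[of _ "e * (e + 1) * tail_const"]) (auto simp: A_def)
qed

text \<open>The midpoint rule with step \<open>1/(2m)\<close> on \<open>{0..1/2}\<close>. The cell at the singularity is estimated by the size of
  \<open>f\<close>, the others by \<open>midpoint_cell\<close>.\<close>

lemma midpoint_sum_singular:
  fixes f :: "real \<Rightarrow> real"
  assumes cont: "continuous_on {0..1/2} f"
    and d1: "\<And>x. 0 < x \<Longrightarrow> x \<le> 1/2 \<Longrightarrow> (f has_real_derivative f1 x) (at x)"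
    and d2: "\<And>x. 0 < x \<Longrightarrow> x \<le> 1/2 \<Longrightarrow> (f1 has_real_derivative f2 x) (at x)"
    and \<delta>: "0 < \<delta>" "\<delta> \<le> 1/2" and C: "C \<ge> 0"
    and b0: "\<And>x. 0 \<le> x \<Longrightarrow> x \<le> 1/2 \<Longrightarrow> \<bar>f x\<bar> \<le> C * x powr \<delta>"
    and b2: "\<And>x. 0 < x \<Longrightarrow> x \<le> 1/2 \<Longrightarrow> \<bar>f2 x\<bar> \<le> C * x powr (\<delta> - 2)"
    and m: "m \<ge> 1"
  shows "\<bar>(\<Sum>i<m. f (real (2 * i + 1) / real (4 * m))) - 2 * real m * integral {0..1/2} f\<bar>
    \<le> C * (2 + tail_const) * real (2 * m) powr - \<delta>"
proof -
  define h where "h = 1 / (2 * real m)"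
  have h: "h > 0" "real m * h = 1/2" using m by (auto simp: h_def)
  have hle: "real i * h \<le> 1/2" if "i \<le> m" for i
    using mult_right_mono[of "real i" "real m" h] that h by simp
  have int: "f integrable_on {a..b}" if "0 \<le> a" "b \<le> 1/2" for a b
    using that by (intro integrable_continuous_interval continuous_on_subset[OF cont]) auto
  have parts: "k \<le> m \<Longrightarrow> integral {0..real k * h} f = (\<Sum>i<k. integral {real i * h..real (Suc i) * h} f)" for k
  proof (induction k)
    case (Suc k)
    have "integral {0..real k * h} f + integral {real k * h..real (Suc k) * h} f = integral {0..real (Suc k) * h} f"
      using h hle[of "Suc k"] Suc.prems by (intro Henstock_Kurzweil_Integration.integral_combine int) auto
    then show ?case using Suc by simp
  qed simp
  have node: "real (2 * i + 1) / real (4 * m) = real i * h + h / 2" for i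
    using m by (simp add: h_def field_simps)
  define E where "E i = f (real i * h + h / 2) - integral {real i * h..real (Suc i) * h} f / h" for i
  have "2 * real m = 1 / h" by (simp add: h_def)
  then have total: "(\<Sum>i<m. f (real (2 * i + 1) / real (4 * m))) - 2 * real m * integral {0..1/2} f = (\<Sum>i<m. E i)"
    unfolding node using parts[of m] h by (simp add: E_def sum_subtractf sum_divide_distrib)
  have E0: "\<bar>E 0\<bar> \<le> 2 * (C * h powr \<delta>)"
  proof -
    have h2: "h \<le> 1/2" using hle[of 1] m by simp
    have "\<bar>f (h / 2)\<bar> \<le> C * (h / 2) powr \<delta>" using h h2 by (intro b0) auto
    also have "\<dots> \<le> C * h powr \<delta>" using h \<delta> C by (intro mult_left_mono powr_mono2) auto
    finally have 1: "\<bar>f (h / 2)\<bar> \<le> C * h powr \<delta>" .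
    have "norm (integral {0..h} f) \<le> C * h powr \<delta> * measure lborel (cbox 0 h)"
    proof (rule has_integral_bound)
      show "(f has_integral integral {0..h} f) (cbox 0 h)" using integrable_integral[OF int[of 0 h]] h2 by simp
      show "norm (f x) \<le> C * h powr \<delta>" if "x \<in> cbox 0 h" for x
      proof -
        have "\<bar>f x\<bar> \<le> C * x powr \<delta>" using that h2 by (intro b0) auto
        also have "\<dots> \<le> C * h powr \<delta>" using that \<delta> C by (intro mult_left_mono powr_mono2) auto
        finally show ?thesis by simp
      qed
    qed (use C in auto)
    then have "\<bar>integral {0..h} f / h\<bar> \<le> C * h powr \<delta>" using h by (simp add: field_simps)
    moreover have "E 0 = f (h / 2) - integral {0..h} f / h" by (simp add: E_def)
    ultimately show ?thesis using 1 by linarith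
  qed
  have Ei: "\<bar>E i\<bar> \<le> C * h powr \<delta> * real i powr (- 3/2)" if i: "1 \<le> i" "i < m" for i
  proof -
    define c where "c = real i * h + h / 2"
    have ih: "real i * h > 0" using i h by simp
    have le: "real (Suc i) * h \<le> 1/2" using hle[of "Suc i"] i by simp
    have I: "{c - h / 2..c + h / 2} = {real i * h..real (Suc i) * h}" by (simp add: c_def algebra_simps)
    have "\<bar>2 * (h / 2) * f c - integral {c - h / 2..c + h / 2} f\<bar> \<le> 2 * (h / 2) ^ 3 * (C * (real i * h) powr (\<delta> - 2))"
    proof (rule midpoint_cell)
      fix x assume "x \<in> {c - h / 2..c + h / 2}"
      then have x: "real i * h \<le> x" "x \<le> 1/2" unfolding I using le by auto
      then have x0: "x > 0" using ih by linarith
      show "(f has_real_derivative f1 x) (at x)" "(f1 has_real_derivative f2 x) (at x)"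
        using d1 d2 x x0 by auto
      have "x powr (\<delta> - 2) \<le> (real i * h) powr (\<delta> - 2)"
        using powr_mono2'[of "\<delta> - 2" "real i * h" x] x ih \<delta> by simp
      then show "\<bar>f2 x\<bar> \<le> C * (real i * h) powr (\<delta> - 2)"
        using b2[OF x0 x(2)] C mult_left_mono[of "x powr (\<delta> - 2)" _ C] by fastforce
    qed (use h in simp)
    then have "\<bar>h * E i\<bar> \<le> 2 * (h / 2) ^ 3 * (C * (real i * h) powr (\<delta> - 2))"
      unfolding I using h by (simp add: E_def c_def right_diff_distrib)
    also have "2 * (h / 2) ^ 3 * (C * (real i * h) powr (\<delta> - 2)) = h * (C * h powr \<delta> * real i powr (\<delta> - 2) / 4)"
    proof -
      have "h powr (\<delta> - 2) = h powr \<delta> / h ^ 2" using h by (simp add: powr_diff powr_numeral)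
      then show ?thesis using h i by (simp add: powr_mult power3_eq_cube power2_eq_square field_simps)
    qed
    finally have "h * \<bar>E i\<bar> \<le> h * (C * h powr \<delta> * real i powr (\<delta> - 2) / 4)"
      using h by (simp add: abs_mult)
    then have "\<bar>E i\<bar> \<le> C * h powr \<delta> * real i powr (\<delta> - 2) / 4" using h by (simp only: mult_le_cancel_left_pos)
    also have "\<dots> \<le> C * h powr \<delta> * real i powr (\<delta> - 2)" using C by simp
    also have "\<dots> \<le> C * h powr \<delta> * real i powr (- 3/2)"
      using C i \<delta> by (intro mult_left_mono powr_mono) auto
    finally show ?thesis .
  qed
  have "{..<m} = insert 0 {1..<m}" using m by auto
  then have "(\<Sum>i<m. E i) = E 0 + (\<Sum>i\<in>{1..<m}. E i)" by simp
  also have "\<bar>\<dots>\<bar> \<le> \<bar>E 0\<bar> + (\<Sum>i\<in>{1..<m}. \<bar>E i\<bar>)"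
    using sum_abs[of E "{1..<m}"] by linarith
  also have "\<dots> \<le> 2 * (C * h powr \<delta>) + (\<Sum>i\<in>{1..<m}. C * h powr \<delta> * real i powr (- 3/2))"
    using E0 Ei by (intro add_mono sum_mono) auto
  also have "\<dots> \<le> 2 * (C * h powr \<delta>) + C * h powr \<delta> * tail_const"
    unfolding sum_distrib_left[symmetric] using C by (intro add_left_mono mult_left_mono tail_const_sum_le) auto
  also have "\<dots> = C * (2 + tail_const) * h powr \<delta>" by (simp add: algebra_simps)
  also have "h powr \<delta> = real (2 * m) powr - \<delta>" by (simp add: h_def powr_divide powr_minus_divide)
  finally show ?thesis unfolding total .
qed

section \<open>Expansion of the midpoint energy\<close>

text \<open>The chord that cuts off the fraction \<open>x\<close> of the circle has length \<open>2 sin \<pi>x\<close>. Dividing it by \<open>2\<pi>\<close>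
  makes \<open>chord_power s x\<close> asymptotic to \<open>x powr -s\<close> at \<open>0\<close>, with the coefficients \<open>\<alpha>\<^sub>j\<close> in its expansion.\<close>

definition chord_power :: "real \<Rightarrow> real \<Rightarrow> real" where
  "chord_power s x = (sin (pi * x) / pi) powr - s"

lemma unit_summable_alpha: "unit_summable (alpha_re s)"
proof (rule unit_summableI)
  fix x :: real assume x: "0 < x" "x < 1"
  have "summable (\<lambda>n. alpha_re s n * sqrt x ^ (2 * n))"
    using alpha_re_sums[of "sqrt x" s] x by (auto simp: real_sqrt_lt_1_iff intro: sums_summable)
  then show "summable (\<lambda>n. alpha_re s n * x ^ n)" using x by (simp add: power_mult)
qed

lemma chord_power_eq:
  assumes x: "0 < x" "x < 1"
  shows "chord_power s x = x powr - s * pser (alpha_re s) (x ^ 2)"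
proof -
  have "0 < sin (pi * x)" using x by (intro sin_gt_zero) auto
  moreover have "sin (pi * x) / pi = x * (sin (pi * x) / (pi * x))" using x by simp
  ultimately have "chord_power s x = x powr - s * (sin (pi * x) / (pi * x)) powr - s"
    unfolding chord_power_def using x by (simp only: powr_mult)
  then show ?thesis using alpha_re_sums[OF x, of s] by (simp add: pser_def power_mult sums_iff)
qed

lemma chord_power_split:
  assumes x: "0 < x" "x < 1"
  shows "chord_power s x = (\<Sum>j<K. alpha_re s j * x powr (2 * real j - s))
     + x powr (2 * real K - s) * pser (\<lambda>n. alpha_re s (n + K)) (x ^ 2)"
proof -
  have p: "x powr - s * (x ^ 2) ^ j = x powr (2 * real j - s)" for j
  proof -
    have "(x ^ 2) ^ j = x powr (2 * real j)"
      using x powr_realpow[of x "2 * j"] by (simp add: power_mult)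
    then show ?thesis by (simp flip: powr_add)
  qed
  have "\<bar>x ^ 2\<bar> < 1" using x by (simp add: power_less_one_iff)
  from pser_split[OF unit_summable_alpha this, of s K]
  have "chord_power s x = (\<Sum>j<K. alpha_re s j * (x powr - s * (x ^ 2) ^ j))
     + (x powr - s * (x ^ 2) ^ K) * pser (\<lambda>n. alpha_re s (n + K)) (x ^ 2)"
    unfolding chord_power_eq[OF x] by (simp add: distrib_left sum_distrib_left mult_ac)
  then show ?thesis unfolding p .
qed

definition chord_rest :: "real \<Rightarrow> nat \<Rightarrow> real \<Rightarrow> real" where
  "chord_rest s K x = x powr (2 * real K - s) * pser (\<lambda>n. alpha_re s (n + K)) (x ^ 2)"

lemma chord_rest_bound:
  assumes "2 * real K - s \<ge> \<delta>"
  obtains C where "C \<ge> 0" "\<And>x. 0 \<le> x \<Longrightarrow> x \<le> 1/2 \<Longrightarrow> \<bar>chord_rest s K x\<bar> \<le> C * x powr \<delta>"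
proof -
  obtain B where B: "B \<ge> 0" "\<And>x. 0 \<le> x \<Longrightarrow> x \<le> 1/2 \<Longrightarrow> \<bar>pser (\<lambda>n. alpha_re s (n + K)) (x ^ 2)\<bar> \<le> B"
    using pser_bounded[OF unit_summable_shift[OF unit_summable_alpha]] by blast
  have "\<bar>chord_rest s K x\<bar> \<le> B * x powr \<delta>" if x: "0 \<le> x" "x \<le> 1/2" for x
    unfolding chord_rest_def abs_mult
    using x assms B powr_mono'[of \<delta> "2 * real K - s" x]
    by (subst mult.commute) (intro mult_mono, auto)
  then show ?thesis using that B by blast
qed

lemma chord_rest_continuous:
  assumes "2 * real K - s > 0"
  shows "continuous_on {0..1/2} (chord_rest s K)"
  unfolding chord_rest_def[abs_def]
proof (rule continuous_on_mult[OF continuous_on_powr'])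
  show "continuous_on {0..1/2} (\<lambda>x. pser (\<lambda>n. alpha_re s (n + K)) (x ^ 2))"
  proof (rule continuous_on_compose2[OF pser_continuous])
    show "(\<lambda>x. x ^ 2) ` {0..1/2::real} \<subseteq> {0..1/4}"
    proof clarsimp
      fix x :: real assume "0 \<le> x" "x * 2 \<le> 1"
      then show "x ^ 2 * 4 \<le> 1" using power_mono[of x "1/2" 2] by (simp add: power2_eq_square)
    qed
  qed (auto intro!: continuous_intros unit_summable_shift unit_summable_alpha)
qed (use assms in \<open>auto intro!: continuous_intros\<close>)

text \<open>The finite part of the integral of \<open>chord_power s\<close> over \<open>{0..1/2}\<close>: the power \<open>x powr -\<sigma>\<close> contributes
  the value of its primitive \<open>x powr (1 - \<sigma>) / (1 - \<sigma>)\<close> at \<open>1/2\<close>, also for \<open>\<sigma> > 1\<close>.\<close>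

definition singular_const :: "real \<Rightarrow> nat \<Rightarrow> real" where
  "singular_const s K = integral {0..1/2} (chord_rest s K)
     + (\<Sum>j<K. alpha_re s j * (1/2) powr (1 - (s - 2 * real j)) / (1 - (s - 2 * real j)))"

text \<open>The coefficient of \<open>M powr (s - 2 j)\<close> in the expansion of the midpoint energy, without the common
  factor \<open>2 * (2\<pi>) powr -s\<close>.\<close>

definition zeta_coeff :: "real \<Rightarrow> nat \<Rightarrow> real" where
  "zeta_coeff s j = alpha_re s j * ((2 powr (s - 2 * real j) - 1) * Re (riemann_zeta (of_real (s - 2 * real j))))"

text \<open>The powers \<open>x powr (2j - s)\<close> with \<open>j < K\<close> are summed by \<open>half_power_sum_rate\<close>, scaled by the step, and
  \<open>chord_rest s K\<close> by the midpoint rule. Here \<open>K\<close> is the least number with \<open>2 K > s\<close>, so that \<open>chord_rest s K\<close>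
  vanishes at \<open>0\<close> and all \<open>\<sigma> = s - 2j\<close> are nonnegative.\<close>

lemma midpoint_chord_asymptotics:
  assumes s: "s > 0" and odd: "\<And>k::nat. s \<noteq> 2 * real k + 1"
  defines "K \<equiv> Suc (nat \<lfloor>s / 2\<rfloor>)"
  obtains C \<delta> where "\<delta> > 0" "C \<ge> 0"
    "\<And>m. m \<ge> 1 \<Longrightarrow> \<bar>(\<Sum>i<m. chord_power s (real (2 * i + 1) / real (4 * m)))
      - (real (2 * m) * singular_const s K
         + (\<Sum>j<K. zeta_coeff s j * real (2 * m) powr (s - 2 * real j)))\<bar> \<le> C * real (2 * m) powr - \<delta>"
proof -
  define \<beta> where "\<beta> = 2 * real K - s"
  have "s / 2 < real (nat \<lfloor>s / 2\<rfloor>) + 1"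
    using real_of_int_floor_add_one_gt[of "s / 2"] s by simp
  then have "s / 2 < real K" by (simp add: K_def)
  then have \<beta>: "\<beta> > 0" by (simp add: \<beta>_def)
  \<comment> \<open>capped at \<open>1/2\<close> so that \<open>\<delta> - 2 \<le> -3/2\<close> in the midpoint rule\<close>
  define \<delta> where "\<delta> = min \<beta> (1/2)"
  have \<delta>: "0 < \<delta>" "\<delta> \<le> 1/2" "\<delta> \<le> \<beta>" using \<beta> by (auto simp: \<delta>_def)
  define \<sigma> where "\<sigma> j = s - 2 * real j" for j
  have \<sigma>: "\<sigma> j \<ge> 0" "\<sigma> j \<noteq> 1" if "j < K" for j
  proof -
    have "j \<le> nat \<lfloor>s / 2\<rfloor>" using that by (simp add: K_def)
    then have "real j \<le> s / 2" using s by linarith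
    then show "\<sigma> j \<ge> 0" by (simp add: \<sigma>_def)
    show "\<sigma> j \<noteq> 1" using odd[of j] by (simp add: \<sigma>_def)
  qed
  have "\<forall>j\<in>{..<K}. \<exists>C\<ge>0. \<forall>m\<ge>1. \<bar>(\<Sum>i<m. (real i + 1/2) powr - \<sigma> j) - real m powr (1 - \<sigma> j) / (1 - \<sigma> j)
      - (2 powr \<sigma> j - 1) * Re (riemann_zeta (of_real (\<sigma> j)))\<bar> \<le> C * real m powr (- (\<sigma> j + 1/2))"
    using half_power_sum_rate \<sigma> by blast
  from bchoice[OF this] obtain D where "\<forall>j\<in>{..<K}. D j \<ge> 0 \<and> (\<forall>m\<ge>1. \<bar>(\<Sum>i<m. (real i + 1/2) powr - \<sigma> j) - real m powr (1 - \<sigma> j) / (1 - \<sigma> j)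
      - (2 powr \<sigma> j - 1) * Re (riemann_zeta (of_real (\<sigma> j)))\<bar> \<le> D j * real m powr (- (\<sigma> j + 1/2)))"
    by (rule exE)
  then have D0: "\<And>j. j < K \<Longrightarrow> D j \<ge> 0" and D: "\<And>j m. j < K \<Longrightarrow> m \<ge> 1 \<Longrightarrow>
      \<bar>(\<Sum>i<m. (real i + 1/2) powr - \<sigma> j) - real m powr (1 - \<sigma> j) / (1 - \<sigma> j)
      - (2 powr \<sigma> j - 1) * Re (riemann_zeta (of_real (\<sigma> j)))\<bar> \<le> D j * real m powr (- (\<sigma> j + 1/2))"
    by (simp_all only: Ball_def lessThan_iff)
  let ?c = "\<lambda>n. alpha_re s (n + K)"
  have us: "unit_summable ?c" by (intro unit_summable_shift unit_summable_alpha)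
  define c1 where "c1 n = (\<beta> + 2 * real n) * ?c n" for n
  define c2 where "c2 n = (\<beta> - 1 + 2 * real n) * c1 n" for n
  have us1: "unit_summable c1" unfolding c1_def[abs_def] by (rule unit_summable_euler[OF us])
  have us2: "unit_summable c2" unfolding c2_def[abs_def] by (rule unit_summable_euler[OF us1])
  obtain C0 where C0: "C0 \<ge> 0" "\<And>x. 0 \<le> x \<Longrightarrow> x \<le> 1/2 \<Longrightarrow> \<bar>chord_rest s K x\<bar> \<le> C0 * x powr \<delta>"
    using chord_rest_bound[of \<delta> K s] \<delta> unfolding \<beta>_def by blast
  obtain C2 where C2: "C2 \<ge> 0" "\<And>x. 0 \<le> x \<Longrightarrow> x \<le> 1/2 \<Longrightarrow> \<bar>pser c2 (x ^ 2)\<bar> \<le> C2"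
    using pser_bounded[OF us2] by blast
  define C where "C = max C0 C2"
  have rest: "\<bar>(\<Sum>i<m. chord_rest s K (real (2 * i + 1) / real (4 * m))) - 2 * real m * integral {0..1/2} (chord_rest s K)\<bar>
      \<le> C * (2 + tail_const) * real (2 * m) powr - \<delta>" if "m \<ge> 1" for m
  proof (rule midpoint_sum_singular)
    show "continuous_on {0..1/2} (chord_rest s K)"
      using \<beta> by (intro chord_rest_continuous) (simp add: \<beta>_def)
    fix x :: real assume x: "0 < x" "x \<le> 1/2"
    show "(chord_rest s K has_real_derivative x powr (\<beta> - 1) * pser c1 (x ^ 2)) (at x)"
      unfolding chord_rest_def[abs_def] \<beta>_def[symmetric] c1_def[abs_def]
      using x by (intro powr_pser_deriv us) auto
    show "((\<lambda>x. x powr (\<beta> - 1) * pser c1 (x ^ 2)) has_real_derivative x powr (\<beta> - 1 - 1) * pser c2 (x ^ 2)) (at x)"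
      unfolding c2_def[abs_def] using x by (intro powr_pser_deriv us1) auto
    have "\<bar>x powr (\<beta> - 1 - 1) * pser c2 (x ^ 2)\<bar> = \<bar>pser c2 (x ^ 2)\<bar> * x powr (\<beta> - 2)"
      by (simp add: abs_mult)
    also have "\<dots> \<le> C * x powr (\<delta> - 2)"
      using x \<delta> C2(2)[of x] C2(1) powr_mono'[of "\<delta> - 2" "\<beta> - 2" x] unfolding C_def by (intro mult_mono) auto
    finally show "\<bar>x powr (\<beta> - 1 - 1) * pser c2 (x ^ 2)\<bar> \<le> C * x powr (\<delta> - 2)" .
  next
    fix x :: real assume x: "0 \<le> x" "x \<le> 1/2"
    have "C0 * x powr \<delta> \<le> C * x powr \<delta>" by (intro mult_right_mono) (auto simp: C_def)
    then show "\<bar>chord_rest s K x\<bar> \<le> C * x powr \<delta>" using C0(2)[OF x] by linarith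
  qed (use \<delta> C0 that in \<open>auto simp: C_def\<close>)
  define L where "L j = (2 powr \<sigma> j - 1) * Re (riemann_zeta (of_real (\<sigma> j)))" for j
  define e where "e m j = (\<Sum>i<m. (real i + 1/2) powr - \<sigma> j) - real m powr (1 - \<sigma> j) / (1 - \<sigma> j) - L j" for m j
  have eb: "\<bar>real (2 * m) powr \<sigma> j * e m j\<bar> \<le> D j * 2 powr (\<sigma> j + 1/2) * real (2 * m) powr - \<delta>"
    if j: "j < K" and m: "m \<ge> 1" for m j
  proof -
    have "\<bar>real (2 * m) powr \<sigma> j * e m j\<bar> \<le> real (2 * m) powr \<sigma> j * (D j * real m powr (- (\<sigma> j + 1/2)))"
      unfolding abs_mult using D[OF j m] by (intro mult_mono) (auto simp: e_def L_def)
    also have "real m powr (- (\<sigma> j + 1/2)) = 2 powr (\<sigma> j + 1/2) * real (2 * m) powr (- (\<sigma> j + 1/2))"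
    proof -
      have "real (2 * m) = 2 * real m" by simp
      then have "real (2 * m) powr (- (\<sigma> j + 1/2)) = 2 powr (- (\<sigma> j + 1/2)) * real m powr (- (\<sigma> j + 1/2))"
        by (simp only: powr_mult)
      moreover have "2 powr (\<sigma> j + 1/2) * 2 powr (- (\<sigma> j + 1/2)) = (1::real)"
        by (simp only: powr_add[symmetric]) simp
      ultimately show ?thesis by (simp only: mult.assoc[symmetric] mult_1)
    qed
    also have "real (2 * m) powr \<sigma> j * (D j * (2 powr (\<sigma> j + 1/2) * real (2 * m) powr (- (\<sigma> j + 1/2))))
        = D j * 2 powr (\<sigma> j + 1/2) * (real (2 * m) powr \<sigma> j * real (2 * m) powr (- (\<sigma> j + 1/2)))"
      by (simp only: mult_ac)
    also have "real (2 * m) powr \<sigma> j * real (2 * m) powr (- (\<sigma> j + 1/2)) = real (2 * m) powr (- 1/2)"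
      by (simp only: powr_add[symmetric]) simp
    also have "D j * 2 powr (\<sigma> j + 1/2) * \<dots> \<le> D j * 2 powr (\<sigma> j + 1/2) * real (2 * m) powr - \<delta>"
      using D0[OF j] \<delta> m by (intro mult_left_mono powr_mono) auto
    finally show ?thesis .
  qed
  define C' where "C' = C * (2 + tail_const) + (\<Sum>j<K. \<bar>alpha_re s j\<bar> * (D j * 2 powr (\<sigma> j + 1/2)))"
  have C'0: "C' \<ge> 0" unfolding C'_def C_def
    using C0 tail_const_nonneg D0 by (intro add_nonneg_nonneg mult_nonneg_nonneg sum_nonneg) auto
  show ?thesis
  proof (rule that[OF \<delta>(1) C'0])
    fix m :: nat assume m: "m \<ge> 1"
    define M where "M = real (2 * m)"
    have M: "M > 0" using m by (simp add: M_def)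
    define x where "x i = real (2 * i + 1) / real (4 * m)" for i
    have xi: "x i = (real i + 1/2) / M" for i using m by (simp add: x_def M_def field_simps)
    have x: "0 < x i" "x i < 1" if "i < m" for i
      using that by (auto simp: x_def field_simps)
    have split: "(\<Sum>i<m. chord_power s (x i)) = (\<Sum>j<K. alpha_re s j * (\<Sum>i<m. x i powr - \<sigma> j)) + (\<Sum>i<m. chord_rest s K (x i))"
    proof -
      have "(\<Sum>i<m. chord_power s (x i)) = (\<Sum>i<m. (\<Sum>j<K. alpha_re s j * x i powr - \<sigma> j) + chord_rest s K (x i))"
        proof (rule sum.cong[OF refl])
        fix i assume "i \<in> {..<m}"
        then have "0 < x i" "x i < 1" using x by auto
        from chord_power_split[OF this, of s K]
        show "chord_power s (x i) = (\<Sum>j<K. alpha_re s j * x i powr - \<sigma> j) + chord_rest s K (x i)"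
          by (simp add: \<sigma>_def chord_rest_def)
      qed
      also have "\<dots> = (\<Sum>i<m. \<Sum>j<K. alpha_re s j * x i powr - \<sigma> j) + (\<Sum>i<m. chord_rest s K (x i))"
        by (rule sum.distrib)
      also have "(\<Sum>i<m. \<Sum>j<K. alpha_re s j * x i powr - \<sigma> j) = (\<Sum>j<K. alpha_re s j * (\<Sum>i<m. x i powr - \<sigma> j))"
        by (subst sum.swap) (simp add: sum_distrib_left)
      finally show ?thesis .
    qed
    have pw: "(\<Sum>i<m. x i powr - \<sigma> j) = M * ((1/2) powr (1 - \<sigma> j) / (1 - \<sigma> j)) + L j * M powr \<sigma> j + M powr \<sigma> j * e m j" for j
    proof -
      have "x i powr - \<sigma> j = M powr \<sigma> j * (real i + 1/2) powr - \<sigma> j" for i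
        unfolding xi powr_divide by (simp add: powr_minus_divide[of M])
      then have "(\<Sum>i<m. x i powr - \<sigma> j) = M powr \<sigma> j * (\<Sum>i<m. (real i + 1/2) powr - \<sigma> j)"
        by (simp add: sum_distrib_left)
      also have "(\<Sum>i<m. (real i + 1/2) powr - \<sigma> j) = real m powr (1 - \<sigma> j) / (1 - \<sigma> j) + L j + e m j"
        by (simp add: e_def)
      also have "real m = M * (1/2)" by (simp add: M_def)
      also have "(M * (1/2)) powr (1 - \<sigma> j) = M powr (1 - \<sigma> j) * (1/2) powr (1 - \<sigma> j)"
        by (rule powr_mult)
      also have "M powr \<sigma> j * (M powr (1 - \<sigma> j) * (1/2) powr (1 - \<sigma> j) / (1 - \<sigma> j) + L j + e m j)
          = (M powr \<sigma> j * M powr (1 - \<sigma> j)) * ((1/2) powr (1 - \<sigma> j) / (1 - \<sigma> j)) + L j * M powr \<sigma> j + M powr \<sigma> j * e m j"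
        by (simp add: algebra_simps)
      also have "M powr \<sigma> j * M powr (1 - \<sigma> j) = M" using M by (simp flip: powr_add)
      finally show ?thesis .
    qed
    define R where "R = (\<Sum>i<m. chord_rest s K (x i)) - M * integral {0..1/2} (chord_rest s K)"
    have R: "\<bar>R\<bar> \<le> C * (2 + tail_const) * M powr - \<delta>"
      using rest[OF m] by (simp add: R_def M_def x_def)
    have "(\<Sum>i<m. chord_power s (x i)) = (M * singular_const s K + (\<Sum>j<K. alpha_re s j * L j * M powr \<sigma> j))
        + (R + (\<Sum>j<K. alpha_re s j * (M powr \<sigma> j * e m j)))"
      unfolding split pw singular_const_def R_def \<sigma>_def[symmetric]
      by (simp add: distrib_left sum.distrib sum_distrib_left mult_ac)
    moreover have "\<bar>R + (\<Sum>j<K. alpha_re s j * (M powr \<sigma> j * e m j))\<bar> \<le> C' * M powr - \<delta>"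
    proof -
      have "\<bar>\<Sum>j<K. alpha_re s j * (M powr \<sigma> j * e m j)\<bar> \<le> (\<Sum>j<K. \<bar>alpha_re s j * (M powr \<sigma> j * e m j)\<bar>)"
        by (rule sum_abs)
      also have "\<dots> \<le> (\<Sum>j<K. \<bar>alpha_re s j\<bar> * (D j * 2 powr (\<sigma> j + 1/2) * M powr - \<delta>))"
        using eb[OF _ m] by (intro sum_mono) (auto simp: abs_mult[of "alpha_re s _"] M_def intro!: mult_left_mono)
      finally have "\<bar>R + (\<Sum>j<K. alpha_re s j * (M powr \<sigma> j * e m j))\<bar>
          \<le> C * (2 + tail_const) * M powr - \<delta> + (\<Sum>j<K. \<bar>alpha_re s j\<bar> * (D j * 2 powr (\<sigma> j + 1/2) * M powr - \<delta>))"
        using R by linarith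
      also have "\<dots> = C' * M powr - \<delta>"
        unfolding C'_def distrib_right sum_distrib_right by (simp only: mult.assoc)
      finally show ?thesis .
    qed
    ultimately show "\<bar>(\<Sum>i<m. chord_power s (real (2 * i + 1) / real (4 * m)))
      - (real (2 * m) * singular_const s K
         + (\<Sum>j<K. zeta_coeff s j * real (2 * m) powr (s - 2 * real j)))\<bar> \<le> C' * real (2 * m) powr - \<delta>"
      unfolding M_def[symmetric] x_def[symmetric] zeta_coeff_def \<sigma>_def[symmetric] L_def[symmetric] by simp
  qed
qed

section \<open>The linear term as a finite part\<close>

text \<open>\<open>C\<close> is the constant term of an expansion of \<open>g\<close> at \<open>0\<close> in the powers with exponents \<open>t\<close>, \<open>t + 2\<close>,
  \<open>t + 4\<close>, \<open>\<dots>\<close>; the number of powers is left open so that expansions can be added.\<close>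

definition finite_part :: "real \<Rightarrow> (real \<Rightarrow> real) \<Rightarrow> real \<Rightarrow> bool" where
  "finite_part t g C \<longleftrightarrow> (\<exists>K b. ((\<lambda>x. g x - (\<Sum>j<K::nat. b j * x powr (t + 2 * real j))) \<longlongrightarrow> C) (at_right 0))"

lemma finite_partI:
  "((\<lambda>x. g x - (\<Sum>j<K::nat. b j * x powr (t + 2 * real j))) \<longlongrightarrow> C) (at_right 0) \<Longrightarrow> finite_part t g C"
  by (auto simp: finite_part_def)

text \<open>Along \<open>x = 2 powr -n\<close> the powers become geometric sequences with bases different from \<open>1\<close>, to which
  \<open>geometric_independence\<close> applies after the decaying ones are dropped. A power with exponent \<open>0\<close> could not
  be told from the constant, and odd \<open>s\<close> would produce one.\<close>

lemma finite_part_unique: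
  assumes e: "\<And>j::nat. t + 2 * real j \<noteq> 0"
    and "finite_part t g C" "finite_part t g C'"
  shows "C = C'"
proof -
  obtain J b J' b' where 1: "((\<lambda>x. g x - (\<Sum>j<J::nat. b j * x powr (t + 2 * real j))) \<longlongrightarrow> C) (at_right 0)"
    and 2: "((\<lambda>x. g x - (\<Sum>j<J'::nat. b' j * x powr (t + 2 * real j))) \<longlongrightarrow> C') (at_right 0)"
    using assms(2,3) unfolding finite_part_def by blast
  define L where "L = max J J'"
  define d where "d j = (if j < J' then b' j else 0) - (if j < J then b j else 0)" for j
  have sum: "(\<Sum>j<n. c j * h j) = (\<Sum>j<L. (if j < n then c j else 0) * h j)"
    if "n \<le> L" for n and c h :: "nat \<Rightarrow> real"
    using that by (intro sum.mono_neutral_cong_left) auto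
  have "((\<lambda>x. (\<Sum>j<L. d j * x powr (t + 2 * real j))) \<longlongrightarrow> C - C') (at_right 0)"
    using tendsto_diff[OF 1 2] sum[of J b] sum[of J' b']
    by (simp add: L_def d_def left_diff_distrib sum_subtractf)
  moreover have "filterlim (\<lambda>n::nat. (1/2::real) ^ n) (at_right 0) sequentially"
    by (intro filterlim_at_withinI LIMSEQ_realpow_zero) (auto intro!: always_eventually)
  ultimately have "(\<lambda>n. \<Sum>j<L. d j * ((1/2) ^ n) powr (t + 2 * real j)) \<longlonglongrightarrow> C - C'"
    by (rule filterlim_compose)
  moreover have "((1/2::real) ^ n) powr e = (2 powr - e) ^ n" for n e
  proof -
    have "(1/2::real) ^ n = 2 powr (- real n)"
      by (simp add: powr_minus powr_realpow power_one_over inverse_eq_divide)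
    moreover have "(2 powr - e :: real) ^ n = (2 powr - e) powr real n"
      by (rule powr_realpow[symmetric]) simp
    ultimately show ?thesis by (simp only: powr_powr mult.commute mult_minus_left mult_minus_right)
  qed
  ultimately have lim: "(\<lambda>n. \<Sum>j<L. d j * (2 powr - (t + 2 * real j)) ^ n) \<longlonglongrightarrow> C - C'" by simp
  \<comment> \<open>the bases that do not decay\<close>
  define A where "A = {j. j < L \<and> t + 2 * real j < 0}"
  have decay: "(\<lambda>n. \<Sum>j\<in>{..<L} - A. d j * (2 powr - (t + 2 * real j)) ^ n) \<longlonglongrightarrow> (\<Sum>j\<in>{..<L} - A. d j * 0)"
  proof (intro tendsto_intros LIMSEQ_realpow_zero)
    fix j assume "j \<in> {..<L} - A"
    then have "t + 2 * real j > 0" using e[of j] by (auto simp: A_def not_less le_less)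
    then show "norm (2 powr - (t + 2 * real j)) < 1" by (simp add: powr_less_one)
  qed
  have "(\<lambda>n. (\<Sum>j<L. d j * (2 powr - (t + 2 * real j)) ^ n) - (\<Sum>j\<in>{..<L} - A. d j * (2 powr - (t + 2 * real j)) ^ n) - (C - C'))
      \<longlonglongrightarrow> (C - C') - (\<Sum>j\<in>{..<L} - A. d j * 0) - (C - C')"
    by (intro tendsto_diff lim decay tendsto_const)
  moreover have "(\<Sum>j<L. h j) - (\<Sum>j\<in>{..<L} - A. h j) = (\<Sum>j\<in>A. h j)" for h :: "nat \<Rightarrow> real"
  proof -
    have "A \<subseteq> {..<L}" by (auto simp: A_def)
    from sum.subset_diff[OF this finite_lessThan, of h] show ?thesis by simp
  qed
  ultimately have lim2: "(\<lambda>n. (\<Sum>j\<in>A. d j * (2 powr - (t + 2 * real j)) ^ n) - (C - C')) \<longlonglongrightarrow> 0" by simp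
  \<comment> \<open>the difference of the two constants joins the sum as a further sequence with base \<open>1\<close>\<close>
  let ?r = "\<lambda>k. case k of None \<Rightarrow> 1 | Some j \<Rightarrow> 2 powr - (t + 2 * real j)"
  let ?d = "\<lambda>k. case k of None \<Rightarrow> C' - C | Some j \<Rightarrow> d j"
  have "?d None = 0"
  proof (rule geometric_independence[where K = "insert None (Some ` A)" and r = ?r and d = ?d])
    show "inj_on ?r (insert None (Some ` A))"
      by (auto simp: inj_on_def A_def powr_eq_one_iff_gen powr_inj)
    show "?r k \<ge> 1" if "k \<in> insert None (Some ` A)" for k
      using that by (auto simp: A_def ge_one_powr_ge_zero)
    show "(\<lambda>n. \<Sum>k\<in>insert None (Some ` A). ?d k * ?r k ^ n) \<longlonglongrightarrow> 0"
      using lim2 by (subst sum.insert) (auto simp: A_def sum.reindex algebra_simps)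
  qed (auto simp: A_def)
  then show ?thesis by simp
qed

lemma finite_part_add:
  assumes "finite_part t g C" "finite_part t h D"
  shows "finite_part t (\<lambda>x. g x + h x) (C + D)"
proof -
  obtain K b L c where 1: "((\<lambda>x. g x - (\<Sum>j<K::nat. b j * x powr (t + 2 * real j))) \<longlongrightarrow> C) (at_right 0)"
    and 2: "((\<lambda>x. h x - (\<Sum>j<L::nat. c j * x powr (t + 2 * real j))) \<longlongrightarrow> D) (at_right 0)"
    using assms unfolding finite_part_def by blast
  define M where "M = max K L"
  have sum: "(\<Sum>j<n. c j * h j) = (\<Sum>j<M. (if j < n then c j else 0) * h j)"
    if "n \<le> M" for n and c h :: "nat \<Rightarrow> real"
    using that by (intro sum.mono_neutral_cong_left) auto
  have "((\<lambda>x. (g x + h x) - (\<Sum>j<M. ((if j < K then b j else 0) + (if j < L then c j else 0)) * x powr (t + 2 * real j))) \<longlongrightarrow> C + D) (at_right 0)"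
    using tendsto_add[OF 1 2] sum[of K b] sum[of L c]
    by (simp add: M_def distrib_right sum.distrib algebra_simps)
  then show ?thesis by (rule finite_partI)
qed

lemma finite_part_cmult:
  assumes "finite_part t g C"
  shows "finite_part t (\<lambda>x. k * g x) (k * C)"
proof -
  obtain K b where 1: "((\<lambda>x. g x - (\<Sum>j<K::nat. b j * x powr (t + 2 * real j))) \<longlongrightarrow> C) (at_right 0)"
    using assms unfolding finite_part_def by blast
  have "((\<lambda>x. k * g x - (\<Sum>j<K. (k * b j) * x powr (t + 2 * real j))) \<longlongrightarrow> k * C) (at_right 0)"
    using tendsto_mult_left[OF 1, of k] by (simp add: right_diff_distrib sum_distrib_left mult.assoc)
  then show ?thesis by (rule finite_partI)
qed

text \<open>An expansion in the powers from \<open>t + 2\<close> on is one from \<open>t\<close> on whose first coefficient is \<open>0\<close>.\<close>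

lemma finite_part_shift:
  assumes "finite_part (t + 2) g C"
  shows "finite_part t g C"
proof -
  obtain K b where 1: "((\<lambda>x. g x - (\<Sum>j<K::nat. b j * x powr (t + 2 + 2 * real j))) \<longlongrightarrow> C) (at_right 0)"
    using assms unfolding finite_part_def by blast
  have "(\<Sum>j<K. b j * x powr (t + 2 + 2 * real j)) = (\<Sum>j<Suc K. (if j = 0 then 0 else b (j - 1)) * x powr (t + 2 * real j))" for x
    by (subst sum.lessThan_Suc_shift) (simp add: algebra_simps)
  with 1 have "((\<lambda>x. g x - (\<Sum>j<Suc K. (if j = 0 then 0 else b (j - 1)) * x powr (t + 2 * real j))) \<longlongrightarrow> C) (at_right 0)"
    by (simp only:)
  then show ?thesis by (rule finite_partI)
qed

lemma eventually_near_zero: "eventually (\<lambda>x::real. 0 < x \<and> x < 1/2) (at_right 0)"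
  unfolding eventually_at_right_field by (intro exI[of _ "1/2"]) auto

lemma finite_part_cong:
  assumes "\<And>x. 0 < x \<Longrightarrow> x < 1/2 \<Longrightarrow> g x = h x"
  shows "finite_part t g C \<longleftrightarrow> finite_part t h C"
proof -
  note eventually_near_zero
  then have "eventually (\<lambda>x. g x = h x) (at_right 0)"
    by eventually_elim (use assms in auto)
  then have "((\<lambda>x. g x - f x) \<longlongrightarrow> C) (at_right 0) \<longleftrightarrow> ((\<lambda>x. h x - f x) \<longlongrightarrow> C) (at_right 0)" for f
    by (intro tendsto_cong) (auto elim: eventually_mono)
  then show ?thesis unfolding finite_part_def by simp
qed

lemma chord_power_continuous: "0 < a \<Longrightarrow> b < 1 \<Longrightarrow> continuous_on {a..b} (chord_power s)"
  unfolding chord_power_def[abs_def]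
proof (intro continuous_intros ballI)
  fix x assume "0 < a" "b < 1" "x \<in> {a..b}"
  then have "0 < sin (pi * x)" by (intro sin_gt_zero) auto
  then show "sin (pi * x) / pi \<noteq> 0" by simp
qed simp

lemma finite_part_singular_const:
  assumes odd: "\<And>k::nat. s \<noteq> 2 * real k + 1" and K: "2 * real K - s > 0"
  shows "finite_part (1 - s) (\<lambda>\<epsilon>. integral {\<epsilon>..1/2} (chord_power s)) (singular_const s K)"
proof -
  define \<sigma> where "\<sigma> j = s - 2 * real j" for j
  have \<sigma>: "\<sigma> j \<noteq> 1" for j using odd[of j] by (simp add: \<sigma>_def)
  define c where "c = (\<Sum>j<K. alpha_re s j * (1/2) powr (1 - \<sigma> j) / (1 - \<sigma> j))"
  define b where "b j = - alpha_re s j / (1 - \<sigma> j)" for j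
  have rint: "chord_rest s K integrable_on {0..1/2}"
    by (intro integrable_continuous_interval chord_rest_continuous K)
  have eq: "integral {\<epsilon>..1/2} (chord_power s) - (\<Sum>j<K. b j * \<epsilon> powr (1 - s + 2 * real j))
      = integral {\<epsilon>..1/2} (chord_rest s K) + c" if \<epsilon>: "0 < \<epsilon>" "\<epsilon> < 1/2" for \<epsilon>
  proof -
    have "((\<lambda>x. (\<Sum>j<K. alpha_re s j * x powr - \<sigma> j) + chord_rest s K x) has_integral
        (\<Sum>j<K. alpha_re s j * (((1/2) powr (1 - \<sigma> j) - \<epsilon> powr (1 - \<sigma> j)) / (1 - \<sigma> j)))
         + integral {\<epsilon>..1/2} (chord_rest s K)) {\<epsilon>..1/2}"
      using \<epsilon> \<sigma> rint
      by (intro has_integral_add has_integral_sum has_integral_mult_right integral_powr integrable_integral)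
        (auto intro: integrable_on_subinterval)
    then have "(chord_power s has_integral
        (\<Sum>j<K. alpha_re s j * (((1/2) powr (1 - \<sigma> j) - \<epsilon> powr (1 - \<sigma> j)) / (1 - \<sigma> j)))
         + integral {\<epsilon>..1/2} (chord_rest s K)) {\<epsilon>..1/2}"
      by (rule has_integral_eq[rotated]) (use \<epsilon> in \<open>auto simp: chord_power_split[of _ s K] chord_rest_def \<sigma>_def\<close>)
    then have "integral {\<epsilon>..1/2} (chord_power s) = 
        (\<Sum>j<K. alpha_re s j * (((1/2) powr (1 - \<sigma> j) - \<epsilon> powr (1 - \<sigma> j)) / (1 - \<sigma> j)))
         + integral {\<epsilon>..1/2} (chord_rest s K)" by (rule integral_unique)
    moreover have e: "1 - s + 2 * real j = 1 - \<sigma> j" for j by (simp add: \<sigma>_def)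
    ultimately show ?thesis
      unfolding c_def b_def e
      by (simp add: diff_divide_distrib right_diff_distrib sum_subtractf sum_negf)
  qed
  have "continuous_on {0..1/2} (\<lambda>\<epsilon>. integral {\<epsilon>..1/2} (chord_rest s K))"
    by (rule indefinite_integral_continuous_1'[OF rint])
  then have "((\<lambda>\<epsilon>. integral {\<epsilon>..1/2} (chord_rest s K)) \<longlongrightarrow> integral {0..1/2} (chord_rest s K)) (at 0 within {0..1/2})"
    by (auto simp: continuous_on_def)
  then have "((\<lambda>\<epsilon>. integral {\<epsilon>..1/2} (chord_rest s K)) \<longlongrightarrow> integral {0..1/2} (chord_rest s K)) (at_right 0)"
    by (simp add: at_within_Icc_at_right)
  then have lim: "((\<lambda>\<epsilon>. integral {\<epsilon>..1/2} (chord_rest s K) + c) \<longlongrightarrow> singular_const s K) (at_right 0)"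
    unfolding singular_const_def c_def \<sigma>_def by (intro tendsto_intros)
  note eventually_near_zero
  then have ev: "eventually (\<lambda>\<epsilon>. integral {\<epsilon>..1/2} (chord_power s) - (\<Sum>j<K. b j * \<epsilon> powr (1 - s + 2 * real j))
      = integral {\<epsilon>..1/2} (chord_rest s K) + c) (at_right 0)"
    by eventually_elim (use eq in auto)
  from iffD2[OF tendsto_cong[OF ev] lim] show ?thesis by (rule finite_partI)
qed

definition chord_power' :: "real \<Rightarrow> real \<Rightarrow> real" where
  "chord_power' s x = - s * (sin (pi * x) / pi) powr (- s - 1) * cos (pi * x)"

lemma chord_power_deriv:
  assumes x: "0 < x" "x < 1"
  shows "(chord_power s has_real_derivative chord_power' s x) (at x)"
    and "(chord_power' s has_real_derivative s * (s + 1) * chord_power (s + 2) x - s\<^sup>2 * pi\<^sup>2 * chord_power s x) (at x)"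
proof -
  have pos: "0 < sin (pi * x)" using x by (intro sin_gt_zero) auto
  have u: "((\<lambda>x. sin (pi * x) / pi) has_real_derivative cos (pi * x)) (at x)"
    by (auto intro!: derivative_eq_intros)
  have w: "((\<lambda>x. cos (pi * x)) has_real_derivative - pi * sin (pi * x)) (at x)"
    by (auto intro!: derivative_eq_intros)
  let ?u = "sin (pi * x) / pi"
  have u0: "?u > 0" using pos by simp
  have p: "((\<lambda>x. (sin (pi * x) / pi) powr r) has_real_derivative r * ?u powr (r - 1) * cos (pi * x)) (at x)" for r
    using DERIV_fun_powr[OF u u0, of r] by simp
  show "(chord_power s has_real_derivative chord_power' s x) (at x)"
    unfolding chord_power_def[abs_def] chord_power'_def using p[of "- s"] by simp
  have "(chord_power' s has_real_derivative
      (- s * ((- s - 1) * ?u powr (- s - 1 - 1) * cos (pi * x))) * cos (pi * x)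
        + - pi * sin (pi * x) * (- s * ?u powr (- s - 1))) (at x)"
    unfolding chord_power'_def[abs_def]
    by (intro DERIV_mult DERIV_cmult p w)
  moreover have "(- s * ((- s - 1) * ?u powr (- s - 1 - 1) * cos (pi * x))) * cos (pi * x)
        + - pi * sin (pi * x) * (- s * ?u powr (- s - 1))
      = s * (s + 1) * chord_power (s + 2) x - s\<^sup>2 * pi\<^sup>2 * chord_power s x"
  proof -
    define A where "A = ?u powr (- s - 2)"
    have "- s - 1 - 1 = - s - 2" by simp
    then have e0: "?u powr (- s - 1 - 1) = A" by (simp only: A_def)
    have "- s - 1 = (- s - 2) + 1" by simp
    then have "?u powr (- s - 1) = A * ?u powr 1" by (simp only: powr_add A_def)
    then have e1: "?u powr (- s - 1) = A * ?u" by (simp only: powr_one less_imp_le[OF u0])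
    have "(- s - 2) + 2 = - s" by simp
    then have "?u powr - s = A * ?u powr 2" using powr_add[of ?u "- s - 2" 2] by (simp only: A_def)
    then have e2: "?u powr - s = A * ?u\<^sup>2" using u0 by (simp only: powr_numeral)
    have c: "cos (pi * x) * cos (pi * x) = 1 - pi\<^sup>2 * ?u\<^sup>2"
      using cos_squared_eq[of "pi * x"] by (simp add: power2_eq_square)
    have sn: "sin (pi * x) = pi * ?u" by simp
    have e3: "- (s + 2) = - s - 2" by simp
    have cp: "chord_power (s + 2) x = A" "chord_power s x = A * ?u\<^sup>2"
      unfolding chord_power_def e3 A_def[symmetric] e2 by simp_all
    have "(- s * ((- s - 1) * A * cos (pi * x))) * cos (pi * x) + - pi * sin (pi * x) * (- s * (A * ?u))
       = s * (s + 1) * A * (cos (pi * x) * cos (pi * x)) + pi * (pi * ?u) * (s * (A * ?u))"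
      by (simp add: algebra_simps)
    also have "\<dots> = s * (s + 1) * A - s\<^sup>2 * pi\<^sup>2 * (A * ?u\<^sup>2)"
      unfolding c by (simp add: algebra_simps power2_eq_square)
    finally show ?thesis unfolding e0 e1 cp .
  qed
  ultimately show "(chord_power' s has_real_derivative s * (s + 1) * chord_power (s + 2) x - s\<^sup>2 * pi\<^sup>2 * chord_power s x) (at x)"
    by simp
qed

text \<open>Differentiating the power series term by term gives the powers \<open>x powr (2j - s - 1)\<close> and no
  separate constant.\<close>

lemma finite_part_chord_power': "finite_part (1 - (s + 2)) (chord_power' s) 0"
proof -
  define c where "c n = (- s + 2 * real n) * alpha_re s n" for n
  have us: "unit_summable c" unfolding c_def[abs_def] by (intro unit_summable_euler unit_summable_alpha)
  have eq: "chord_power' s x = x powr (- s - 1) * pser c (x ^ 2)" if x: "0 < x" "x < 1" for x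
  proof (rule DERIV_unique)
    show "(chord_power s has_real_derivative chord_power' s x) (at x)" by (rule chord_power_deriv[OF x])
    have "((\<lambda>x. x powr - s * pser (alpha_re s) (x ^ 2)) has_real_derivative x powr (- s - 1) * pser c (x ^ 2)) (at x)"
      unfolding c_def[abs_def] by (intro powr_pser_deriv unit_summable_alpha x)
    then show "(chord_power s has_real_derivative x powr (- s - 1) * pser c (x ^ 2)) (at x)"
      by (rule has_field_derivative_transform_within_open[of _ _ _ "{0<..<1}"]) (use x in \<open>auto simp: chord_power_eq\<close>)
  qed
  obtain K :: nat where K: "s + 1 < 2 * real K"
    using reals_Archimedean2[of "(s + 1) / 2"] by (auto simp: field_simps)
  define e where "e = 2 * real K - s - 1"
  have e: "e > 0" using K by (simp add: e_def)
  obtain B where B: "\<And>x. 0 \<le> x \<Longrightarrow> x \<le> 1/2 \<Longrightarrow> \<bar>pser (\<lambda>n. c (n + K)) (x ^ 2)\<bar> \<le> B"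
    using pser_bounded[OF unit_summable_shift[OF us, of K]] by metis
  have split: "chord_power' s x - (\<Sum>j<K. c j * x powr (1 - (s + 2) + 2 * real j)) = x powr e * pser (\<lambda>n. c (n + K)) (x ^ 2)"
    if x: "0 < x" "x < 1/2" for x
  proof -
    have p: "x powr (- s - 1) * (x ^ 2) ^ j = x powr (1 - (s + 2) + 2 * real j)" for j
    proof -
      have "(x ^ 2) ^ j = x powr (2 * real j)"
        using x powr_realpow[of x "2 * j"] by (simp add: power_mult)
      moreover have "- s - 1 + 2 * real j = 1 - (s + 2) + 2 * real j" by simp
      ultimately show ?thesis by (simp only: powr_add[symmetric])
    qed
    have "\<bar>x ^ 2\<bar> < 1" using x by (simp add: power_less_one_iff)
    from pser_split[OF us this, of K]
    have "chord_power' s x = (\<Sum>j<K. c j * (x powr (- s - 1) * (x ^ 2) ^ j))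
        + (x powr (- s - 1) * (x ^ 2) ^ K) * pser (\<lambda>n. c (n + K)) (x ^ 2)"
      using x by (simp add: eq distrib_left sum_distrib_left mult_ac)
    then have "chord_power' s x = (\<Sum>j<K. c j * x powr (1 - (s + 2) + 2 * real j))
        + x powr (1 - (s + 2) + 2 * real K) * pser (\<lambda>n. c (n + K)) (x ^ 2)"
      unfolding p .
    moreover have "1 - (s + 2) + 2 * real K = e" by (simp add: e_def)
    ultimately show ?thesis by simp
  qed
  note near = eventually_near_zero
  have lim: "((\<lambda>x. x powr e * pser (\<lambda>n. c (n + K)) (x ^ 2)) \<longlongrightarrow> 0) (at_right 0)"
  proof (rule lim_null_mult_right_bounded)
    have "((\<lambda>x. x powr e) \<longlongrightarrow> 0 powr e) (at_right (0::real))"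
      using e near by (intro tendsto_powr') (auto elim: eventually_mono intro: tendsto_ident_at)
    then show "((\<lambda>x. x powr e) \<longlongrightarrow> 0) (at_right (0::real))" by simp
    show "eventually (\<lambda>x. norm (pser (\<lambda>n. c (n + K)) (x ^ 2)) \<le> B) (at_right 0)"
      using near by eventually_elim (use B in auto)
  qed
  have ev: "eventually (\<lambda>x. chord_power' s x - (\<Sum>j<K. c j * x powr (1 - (s + 2) + 2 * real j)) = x powr e * pser (\<lambda>n. c (n + K)) (x ^ 2)) (at_right 0)"
    using near by eventually_elim (use split in auto)
  from iffD2[OF tendsto_cong[OF ev] lim] show ?thesis by (rule finite_partI)
qed

text \<open>The function \<open>w = chord_power s\<close> satisfies
  \<open>w'' = s (s + 1) * chord_power (s + 2) - s\<^sup>2 \<pi>\<^sup>2 w\<close>. Integrating over \<open>{\<epsilon>..1/2}\<close> leaves the boundary term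
  \<open>- w'(\<epsilon>)\<close>, since \<open>w'\<close> vanishes at \<open>1/2\<close> by symmetry, and its finite part is \<open>0\<close>.\<close>

lemma finite_part_step:
  assumes fp: "finite_part (1 - s) (\<lambda>\<epsilon>. integral {\<epsilon>..1/2} (chord_power s)) C" and s: "s \<noteq> 0" "s \<noteq> - 1"
  shows "finite_part (1 - (s + 2)) (\<lambda>\<epsilon>. integral {\<epsilon>..1/2} (chord_power (s + 2))) (pi\<^sup>2 * s / (s + 1) * C)"
proof -
  have eq: "integral {\<epsilon>..1/2} (chord_power (s + 2)) =
      (- 1 / (s * (s + 1))) * chord_power' s \<epsilon> + (pi\<^sup>2 * s / (s + 1)) * integral {\<epsilon>..1/2} (chord_power s)"
    if \<epsilon>: "0 < \<epsilon>" "\<epsilon> < 1/2" for \<epsilon>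
  proof -
    have int: "(chord_power r has_integral integral {\<epsilon>..1/2} (chord_power r)) {\<epsilon>..1/2}" for r
      using \<epsilon> by (intro integrable_integral integrable_continuous_interval chord_power_continuous) auto
    have "((\<lambda>x. s * (s + 1) * chord_power (s + 2) x - s\<^sup>2 * pi\<^sup>2 * chord_power s x) has_integral
        chord_power' s (1/2) - chord_power' s \<epsilon>) {\<epsilon>..1/2}"
      by (rule fundamental_theorem_of_calculus)
        (use \<epsilon> in \<open>auto simp flip: has_real_derivative_iff_has_vector_derivative
          intro!: has_field_derivative_at_within[OF chord_power_deriv(2)]\<close>)
    moreover have "((\<lambda>x. s * (s + 1) * chord_power (s + 2) x - s\<^sup>2 * pi\<^sup>2 * chord_power s x) has_integral
        s * (s + 1) * integral {\<epsilon>..1/2} (chord_power (s + 2)) - s\<^sup>2 * pi\<^sup>2 * integral {\<epsilon>..1/2} (chord_power s)) {\<epsilon>..1/2}"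
      by (intro has_integral_diff has_integral_mult_right int)
    ultimately have "chord_power' s (1/2) - chord_power' s \<epsilon> =
        s * (s + 1) * integral {\<epsilon>..1/2} (chord_power (s + 2)) - s\<^sup>2 * pi\<^sup>2 * integral {\<epsilon>..1/2} (chord_power s)"
      by (rule has_integral_unique)
    moreover have "chord_power' s (1/2) = 0" by (simp add: chord_power'_def)
    ultimately have "s * (s + 1) * integral {\<epsilon>..1/2} (chord_power (s + 2)) =
        s * (s * pi\<^sup>2) * integral {\<epsilon>..1/2} (chord_power s) - chord_power' s \<epsilon>" by (simp add: power2_eq_square)
    moreover have "s * (s + 1) \<noteq> 0" using s by auto
    ultimately have "integral {\<epsilon>..1/2} (chord_power (s + 2)) =
        (s * (s * pi\<^sup>2) * integral {\<epsilon>..1/2} (chord_power s) - chord_power' s \<epsilon>) / (s * (s + 1))"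
      by (simp add: eq_divide_eq mult.commute)
    then show ?thesis using s by (simp add: diff_divide_distrib mult.assoc)
  qed
  have "finite_part (1 - (s + 2)) (\<lambda>\<epsilon>. integral {\<epsilon>..1/2} (chord_power s)) C"
    by (rule finite_part_shift) (use fp in simp)
  then have "finite_part (1 - (s + 2)) (\<lambda>\<epsilon>. (- 1 / (s * (s + 1))) * chord_power' s \<epsilon>
      + (pi\<^sup>2 * s / (s + 1)) * integral {\<epsilon>..1/2} (chord_power s)) ((- 1 / (s * (s + 1))) * 0 + (pi\<^sup>2 * s / (s + 1)) * C)"
    by (intro finite_part_add finite_part_cmult finite_part_chord_power')
  then show ?thesis using eq finite_part_cong[of "\<lambda>\<epsilon>. integral {\<epsilon>..1/2} (chord_power (s + 2))"] by simp
qed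

text \<open>The closed form of the finite part of the integral of \<open>chord_power s\<close>; up to the factor
  \<open>2 * (2\<pi>) powr -s\<close> it is \<open>v\<^sub>s\<close>.\<close>

definition chord_const :: "real \<Rightarrow> real" where
  "chord_const s = pi powr s * Gamma ((1 - s) / 2) * rGamma (1 - s / 2) / (2 * sqrt pi)"

lemma chord_const_step:
  assumes s: "s \<noteq> - 1" and odd: "\<And>k::nat. s + 2 \<noteq> 2 * real k + 1"
  shows "chord_const (s + 2) = pi\<^sup>2 * s / (s + 1) * chord_const s"
proof -
  have "(- 1 - s) / 2 \<notin> \<int>\<^sub>\<le>\<^sub>0"
  proof
    assume "(- 1 - s) / 2 \<in> \<int>\<^sub>\<le>\<^sub>0"
    then obtain n where "(- 1 - s) / 2 = - real n" by (elim nonpos_Ints_cases')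
    then have "s + 2 = 2 * real n + 1" by (simp add: field_simps)
    then show False using odd by blast
  qed
  from Gamma_plus1[OF this] have 1: "Gamma ((1 - s) / 2) = (- 1 - s) / 2 * Gamma ((1 - (s + 2)) / 2)"
    by (simp add: field_simps)
  have 2: "rGamma (1 - (s + 2) / 2) = (- s / 2) * rGamma (1 - s / 2)"
    using rGamma_plus1[of "- s / 2"] by (simp add: field_simps)
  have 3: "pi powr (s + 2) = pi powr s * pi\<^sup>2" by (simp add: powr_add powr_numeral)
  have "pi\<^sup>2 * s / (s + 1) * chord_const s = pi\<^sup>2 * s / (s + 1) * (pi powr s * ((- 1 - s) / 2 * Gamma ((1 - (s + 2)) / 2)) * rGamma (1 - s / 2) / (2 * sqrt pi))"
    unfolding chord_const_def 1 ..
  also have "\<dots> = chord_const (s + 2)"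
    unfolding chord_const_def 2 3 using s by (simp add: divide_simps) (simp add: algebra_simps)
  finally show ?thesis by simp
qed

text \<open>The substitution \<open>t = sin\<^sup>2 \<pi>x\<close> produces a Beta integral with parameters \<open>(1 - s)/2\<close> and \<open>1/2\<close>.\<close>

lemma chord_power_integral:
  assumes s: "s < 1"
  shows "(chord_power s has_integral chord_const s) {0..1/2}"
proof -
  define a where "a = (1 - s) / 2"
  have a: "a > 0" using s by (simp add: a_def)
  let ?S = "{0<..<1/2::real}"
  define g where "g x = sin (pi * x) ^ 2" for x :: real
  define f where "f t = t powr (a - 1) * (1 - t) powr (1/2 - 1)" for t :: real
  have sc: "0 < sin (pi * x)" "0 < cos (pi * x)" if "x \<in> ?S" for x
    using that by (auto intro!: sin_gt_zero cos_gt_zero)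
  have mono: "g x < g y" if "x \<in> ?S" "y \<in> ?S" "x < y" for x y
  proof -
    have "0 < pi * x" "pi * y \<le> pi / 2" "pi * x < pi * y" using that by auto
    then have "sin (pi * x) < sin (pi * y)" using pi_gt_zero by (intro sin_monotone_2pi) linarith+
    then show ?thesis using sc[OF that(1)] by (simp add: g_def power_strict_mono)
  qed
  have inj: "inj_on g ?S"
    by (rule linorder_inj_onI) (use mono in fastforce)+
  have img: "g ` ?S = {0<..<1}"
  proof
    show "g ` ?S \<subseteq> {0<..<1}"
    proof clarify
      fix x assume "x \<in> ?S"
      then have "0 < sin (pi * x)" "0 < cos (pi * x)" using sc by auto
      then have "0 < sin (pi * x) ^ 2" "0 < cos (pi * x) ^ 2" by simp_all
      then have "0 < g x" "g x < 1" unfolding g_def using sin_cos_squared_add[of "pi * x"] by linarith+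
      then show "g x \<in> {0<..<1}" by simp
    qed
    show "{0<..<1} \<subseteq> g ` ?S"
    proof
      fix t :: real assume t: "t \<in> {0<..<1}"
      have r: "0 < sqrt t" "sqrt t < 1" using t by auto
      have "arcsin 0 < arcsin (sqrt t)" "arcsin (sqrt t) < arcsin 1"
        using r by (intro arcsin_less_arcsin; linarith)+
      then have "arcsin (sqrt t) / pi \<in> ?S" by (simp add: field_simps)
      moreover have "sin (arcsin (sqrt t)) = sqrt t" using r by (intro sin_arcsin) linarith+
      then have "g (arcsin (sqrt t) / pi) = t" using t by (simp add: g_def)
      ultimately show "t \<in> g ` ?S" by (metis imageI)
    qed
  qed
  have "(f has_integral Beta a (1/2)) {0..1}"
    unfolding f_def[abs_def] using a by (intro has_integral_Beta_real) auto
  then have fi: "(f has_integral Beta a (1/2)) {0<..<1}" by (simp add: has_integral_Icc_iff_Ioo)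
  then have ai: "f absolutely_integrable_on g ` ?S \<and> integral (g ` ?S) f = Beta a (1/2)"
    unfolding img by (auto intro!: nonnegative_absolutely_integrable_1 simp: f_def)
  have der: "(g has_field_derivative 2 * sin (pi * x) * (cos (pi * x) * pi)) (at x within ?S)" for x
    unfolding g_def[abs_def] by (auto intro!: derivative_eq_intros)
  have cv: "(\<lambda>x. \<bar>2 * sin (pi * x) * (cos (pi * x) * pi)\<bar> * f (g x)) absolutely_integrable_on ?S \<and>
     integral ?S (\<lambda>x. \<bar>2 * sin (pi * x) * (cos (pi * x) * pi)\<bar> * f (g x)) = Beta a (1/2)"
    by (rule iffD2[OF has_absolute_integral_change_of_variables_1'[OF _ der inj] ai]) simp
  have eq: "\<bar>2 * sin (pi * x) * (cos (pi * x) * pi)\<bar> * f (g x) = 2 * pi * sin (pi * x) powr - s" if "x \<in> ?S" for x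
  proof -
    let ?u = "sin (pi * x)" and ?w = "cos (pi * x)"
    have pos: "?u > 0" "?w > 0" using sc[OF that] by auto
    have "(?u ^ 2) powr (a - 1) = ?u powr (2 * (a - 1))"
      using pos by (simp add: powr_powr powr_realpow[symmetric] del: powr_numeral)
    moreover have "(1 - ?u ^ 2) powr (1/2 - 1) = 1 / ?w"
    proof -
      have "1 - ?u ^ 2 = ?w powr 2" using pos by (simp add: cos_squared_eq[symmetric] powr_numeral)
      then have "(1 - ?u ^ 2) powr (1/2 - 1) = ?w powr (- 1)" by (simp add: powr_powr)
      then show ?thesis using pos by (simp add: powr_minus_divide)
    qed
    moreover have "?u * ?u powr (2 * (a - 1)) = ?u powr - s"
      using pos powr_add[of ?u 1 "2 * (a - 1)"] by (simp add: a_def field_simps)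
    ultimately show ?thesis using pos unfolding f_def g_def
      by (simp add: abs_mult)
  qed
  have i: "(\<lambda>x. \<bar>2 * sin (pi * x) * (cos (pi * x) * pi)\<bar> * f (g x)) integrable_on ?S"
    using cv set_lebesgue_integral_eq_integral(1) by blast
  have "((\<lambda>x. \<bar>2 * sin (pi * x) * (cos (pi * x) * pi)\<bar> * f (g x)) has_integral Beta a (1/2)) ?S"
    using integrable_integral[OF i] unfolding conjunct2[OF cv] .
  then have "((\<lambda>x. 2 * pi * sin (pi * x) powr - s) has_integral Beta a (1/2)) ?S"
    by (rule has_integral_eq[rotated]) (use eq in auto)
  then have "((\<lambda>x. pi powr s / (2 * pi) * (2 * pi * sin (pi * x) powr - s)) has_integral pi powr s / (2 * pi) * Beta a (1/2)) ?S"
    by (rule has_integral_mult_right)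
  then have "(chord_power s has_integral pi powr s / (2 * pi) * Beta a (1/2)) ?S"
    by (rule has_integral_eq[rotated]) (auto simp: chord_power_def powr_divide powr_minus field_simps)
  moreover have "pi powr s / (2 * pi) * Beta a (1/2) = chord_const s"
  proof -
    have "a + 1/2 = 1 - s / 2" by (simp add: a_def field_simps)
    then have "Beta a (1/2) = Gamma ((1 - s) / 2) * sqrt pi * rGamma (1 - s / 2)"
      by (simp add: Beta_altdef Gamma_one_half_real a_def)
    moreover have "sqrt pi / (2 * pi) = 1 / (2 * sqrt pi)" by (simp add: field_simps flip: real_sqrt_mult)
    ultimately show ?thesis by (simp add: chord_const_def field_simps)
  qed
  ultimately show ?thesis by (simp add: has_integral_Icc_iff_Ioo)
qed

lemma finite_part_base:
  assumes s: "s < 1"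
  shows "finite_part (1 - s) (\<lambda>\<epsilon>. integral {\<epsilon>..1/2} (chord_power s)) (chord_const s)"
proof -
  have "continuous_on {0..1/2} (\<lambda>\<epsilon>. integral {\<epsilon>..1/2} (chord_power s))"
    using chord_power_integral[OF s] by (intro indefinite_integral_continuous_1') auto
  then have "((\<lambda>\<epsilon>. integral {\<epsilon>..1/2} (chord_power s)) \<longlongrightarrow> integral {0..1/2} (chord_power s)) (at 0 within {0..1/2})"
    by (auto simp: continuous_on_def)
  then have "((\<lambda>\<epsilon>. integral {\<epsilon>..1/2} (chord_power s)) \<longlongrightarrow> chord_const s) (at_right 0)"
    using chord_power_integral[OF s] by (simp add: at_within_Icc_at_right integral_unique)
  then show ?thesis by (intro finite_partI[where K = 0]) simp
qed

text \<open>The step from \<open>s\<close> to \<open>s + 2\<close> divides by \<open>s (s + 1)\<close>, which excludes the chains through \<open>0\<close> and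
  through the odd integers.\<close>

lemma finite_part_chord_const:
  assumes s: "- 1 < s" "s < 1" "s \<noteq> 0"
  shows "finite_part (1 - (s + 2 * real k)) (\<lambda>\<epsilon>. integral {\<epsilon>..1/2} (chord_power (s + 2 * real k))) (chord_const (s + 2 * real k))"
proof (induction k)
  case 0
  then show ?case using finite_part_base[OF s(2)] by simp
next
  case (Suc k)
  define r where "r = s + 2 * real k"
  have r: "s + 2 * real (Suc k) = r + 2" by (simp add: r_def)
  have nonint: "r \<noteq> of_int n" if "n \<noteq> 0 \<and> odd n \<or> n = 0" for n :: int
  proof
    assume "r = of_int n"
    then have e: "s = of_int (n - 2 * int k)" by (simp add: r_def)
    define m where "m = n - 2 * int k"
    have "- 1 < real_of_int m" "real_of_int m < 1" "m \<noteq> 0" using s e by (auto simp only: m_def of_int_0)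
    then show False by linarith
  qed
  have "r + 2 \<noteq> 2 * real j + 1" for j :: nat
    using nonint[of "2 * int j - 1"] by auto
  moreover have "r \<noteq> 0" "r \<noteq> - 1" using nonint[of 0] nonint[of "- 1"] by auto
  ultimately have "chord_const (r + 2) = pi\<^sup>2 * r / (r + 1) * chord_const r"
    by (intro chord_const_step) auto
  then show ?case unfolding r
    using finite_part_step[of r "chord_const r"] Suc \<open>r \<noteq> 0\<close> \<open>r \<noteq> - 1\<close> by (simp add: r_def)
qed

text \<open>Both sides are the finite part of the same integral: one by integrating the expansion at \<open>0\<close>, the other by
  recursion from the Beta integral.\<close>

lemma singular_const_eq:
  assumes s: "s > 0" and odd: "\<And>k::nat. s \<noteq> 2 * real k + 1" and even: "\<And>k::nat. s \<noteq> 2 * real k"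
    and K: "2 * real K - s > 0"
  shows "singular_const s K = chord_const s"
proof -
  define k where "k = nat \<lfloor>(s + 1) / 2\<rfloor>"
  \<comment> \<open>the representative of \<open>s\<close> modulo \<open>2\<close> in \<open>-1 \<le> s0 < 1\<close>\<close>
  define s0 where "s0 = s - 2 * real k"
  have k: "real k = of_int \<lfloor>(s + 1) / 2\<rfloor>" using s by (simp add: k_def)
  have "real k \<le> (s + 1) / 2" "(s + 1) / 2 < real k + 1" unfolding k by linarith+
  then have "- 1 \<le> s0" "s0 < 1" by (simp_all add: s0_def)
  moreover have "s0 \<noteq> 0" using even[of k] by (simp add: s0_def)
  moreover have "s0 \<noteq> - 1"
  proof
    assume "s0 = - 1"
    then have e: "s = 2 * real k - 1" by (simp add: s0_def)
    then have "k \<ge> 1" using s by (cases k) auto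
    then show False using odd[of "k - 1"] e by (simp add: of_nat_diff)
  qed
  ultimately have "finite_part (1 - s) (\<lambda>\<epsilon>. integral {\<epsilon>..1/2} (chord_power s)) (chord_const s)"
    using finite_part_chord_const[of s0 k] by (simp add: s0_def)
  moreover have "finite_part (1 - s) (\<lambda>\<epsilon>. integral {\<epsilon>..1/2} (chord_power s)) (singular_const s K)"
    by (rule finite_part_singular_const[OF odd K])
  moreover have "1 - s + 2 * real j \<noteq> 0" for j using odd[of j] by auto
  ultimately show ?thesis by (intro finite_part_unique[of "1 - s"])
qed

section \<open>Potential of a greedy sequence\<close>

text \<open>The factor \<open>2\<close> comes from the symmetry \<open>x \<mapsto> 1 - x\<close> of the nodes, which leaves only the singularity at \<open>0\<close>.\<close>

lemma midpoint_energy_chord: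
  assumes m: "m \<ge> 1"
  shows "midpoint_energy s (2 * m)
    = 2 * (2 * pi) powr - s * (\<Sum>i<m. chord_power s (real (2 * i + 1) / real (4 * m)))"
proof -
  define x where "x i = real (2 * i + 1) / real (4 * m)" for i
  have sym: "x (m + (m - Suc i)) = 1 - x i" if "i < m" for i
    using that by (simp add: x_def of_nat_diff field_simps)
  have chord_sym: "chord_power s (1 - y) = chord_power s y" for y
    by (simp add: chord_power_def right_diff_distrib sin_diff)
  have node: "(2 * sin (pi * real (2 * i + 1) / real (2 * (2 * m)))) powr - s = (2 * pi) powr - s * chord_power s (x i)" for i
  proof -
    have "2 * sin (pi * real (2 * i + 1) / real (2 * (2 * m))) = (2 * pi) * (sin (pi * x i) / pi)"
      by (simp add: x_def)
    then show ?thesis by (simp only: powr_mult chord_power_def)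
  qed
  have "(\<Sum>i<m. chord_power s (x (m + i))) = (\<Sum>i<m. chord_power s (x (m + (m - Suc i))))"
    by (rule sum.nat_diff_reindex[symmetric])
  also have "\<dots> = (\<Sum>i<m. chord_power s (x i))"
    by (rule sum.cong[OF refl]) (simp only: sym chord_sym lessThan_iff)
  finally have "(\<Sum>i<2 * m. chord_power s (x i)) = 2 * (\<Sum>i<m. chord_power s (x i))"
    by (simp add: sum_split_double sum.distrib)
  then show ?thesis
    unfolding midpoint_energy_def node sum_distrib_left[symmetric] x_def[symmetric] by simp
qed

definition dyadic_remainder :: "real \<Rightarrow> real \<Rightarrow> nat \<Rightarrow> real" where
  "dyadic_remainder s c n = midpoint_energy s (2 ^ n)
    - 2 * (2 * pi) powr - s * (2 ^ n * c + (\<Sum>j\<le>nat \<lfloor>s / 2\<rfloor>. zeta_coeff s j * (2 ^ n) powr (s - 2 * real j)))"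

lemma dyadic_remainder_decay:
  assumes s: "s > 0" and odd: "\<And>k::nat. s \<noteq> 2 * real k + 1"
  obtains B r where "0 \<le> r" "r < 1"
    "\<And>n. \<bar>dyadic_remainder s (singular_const s (Suc (nat \<lfloor>s / 2\<rfloor>))) n\<bar> \<le> B * r ^ n"
proof -
  let ?K = "Suc (nat \<lfloor>s / 2\<rfloor>)"
  let ?R = "dyadic_remainder s (singular_const s ?K)"
  obtain C \<delta> where \<delta>: "\<delta> > 0" "C \<ge> 0" and C: "\<And>m. m \<ge> 1 \<Longrightarrow>
      \<bar>(\<Sum>i<m. chord_power s (real (2 * i + 1) / real (4 * m)))
      - (real (2 * m) * singular_const s ?K
         + (\<Sum>j<?K. zeta_coeff s j * real (2 * m) powr (s - 2 * real j)))\<bar> \<le> C * real (2 * m) powr - \<delta>"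
    by (rule midpoint_chord_asymptotics[OF s odd]) (rule that; assumption)
  define \<kappa> where "\<kappa> = 2 * (2 * pi) powr - s"
  have \<kappa>: "\<kappa> > 0" by (simp add: \<kappa>_def)
  define r where "r = (2::real) powr - \<delta>"
  have r: "0 \<le> r" "r < 1" using \<delta> by (auto simp: r_def powr_less_one)
  have pos_index: "\<bar>?R (Suc n)\<bar> \<le> \<kappa> * C * r ^ Suc n" for n
  proof -
    have e: "real (2 * 2 ^ n) = 2 ^ Suc n" by simp
    have p: "(2 ^ Suc n) powr - \<delta> = r ^ Suc n"
      by (simp add: r_def powr_realpow[symmetric] powr_powr mult.commute del: power_Suc)
    have "?R (Suc n) = \<kappa> * ((\<Sum>i<2 ^ n. chord_power s (real (2 * i + 1) / real (4 * 2 ^ n)))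
      - (real (2 * 2 ^ n) * singular_const s ?K
         + (\<Sum>j<?K. zeta_coeff s j * real (2 * 2 ^ n) powr (s - 2 * real j))))"
      using midpoint_energy_chord[of "2 ^ n" s] unfolding e
      by (simp add: dyadic_remainder_def \<kappa>_def right_diff_distrib lessThan_Suc_atMost)
    then have "\<bar>?R (Suc n)\<bar> = \<kappa> * \<bar>(\<Sum>i<2 ^ n. chord_power s (real (2 * i + 1) / real (4 * 2 ^ n)))
      - (real (2 * 2 ^ n) * singular_const s ?K
         + (\<Sum>j<?K. zeta_coeff s j * real (2 * 2 ^ n) powr (s - 2 * real j)))\<bar>"
      using \<kappa> by (simp only: abs_mult abs_of_pos)
    also have "\<dots> \<le> \<kappa> * (C * real (2 * 2 ^ n) powr - \<delta>)"
      using \<kappa> by (intro mult_left_mono C) auto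
    finally show ?thesis unfolding e p by (simp only: mult.assoc)
  qed
  \<comment> \<open>the symmetry of the nodes needs an even number of points, so the constant absorbs \<open>n = 0\<close>\<close>
  define B where "B = max (\<kappa> * C) \<bar>?R 0\<bar>"
  have "\<bar>?R n\<bar> \<le> B * r ^ n" for n
  proof (cases n)
    case (Suc l)
    have "\<kappa> * C * r ^ Suc l \<le> B * r ^ Suc l" using r by (intro mult_right_mono) (auto simp: B_def)
    then show ?thesis unfolding Suc using pos_index[of l] by linarith
  qed (simp add: B_def)
  then show ?thesis using r that by blast
qed

text \<open>By \<open>midpoint_energy_even\<close> the remainder is a combination of the sequences \<open>2 ^ n\<close>, \<open>4 ^ n\<close>, \<open>16 ^ n\<close>, \<open>\<dots>\<close>,
  and the term \<open>j = m\<close>, which would be constant, has the coefficient \<open>0\<close>. A null sequence of this form has only zero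
  coefficients.\<close>

lemma dyadic_remainder_even:
  assumes m: "m \<ge> 1" and s: "s = real (2 * m)" and lim: "dyadic_remainder s c \<longlonglongrightarrow> 0"
  shows "c = 0" and "dyadic_remainder s c n = 0"
proof -
  define \<kappa> where "\<kappa> = 2 * (2 * pi) powr - s"
  have \<kappa>: "\<kappa> \<noteq> 0" by (simp add: \<kappa>_def)
  obtain d where d: "\<And>n. midpoint_energy s (2 ^ n) = (\<Sum>k\<in>{1..m}. d k * (4 ^ k) ^ n)"
    using midpoint_energy_even[OF m] unfolding s by blast
  have fl: "nat \<lfloor>s / 2\<rfloor> = m" by (simp add: s)
  have last: "zeta_coeff s m = 0" by (simp add: zeta_coeff_def s)
  have main: "(\<Sum>j\<le>m. zeta_coeff s j * (2 ^ n) powr (s - 2 * real j)) = (\<Sum>k\<in>{1..m}. zeta_coeff s (m - k) * (4 ^ k) ^ n)" for n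
  proof -
    have "(\<Sum>j\<le>m. zeta_coeff s j * (2 ^ n) powr (s - 2 * real j)) = (\<Sum>j\<in>{..<m}. zeta_coeff s j * (2 ^ n) powr (s - 2 * real j))"
      using last by (simp add: lessThan_Suc_atMost[symmetric])
    also have "\<dots> = (\<Sum>k\<in>{1..m}. zeta_coeff s (m - k) * (4 ^ k) ^ n)"
    proof (rule sum.reindex_bij_witness[of _ "\<lambda>k. m - k" "\<lambda>j. m - j"])
      fix j assume j: "j \<in> {..<m}"
      then have "s - 2 * real j = real (2 * (m - j))" by (simp add: s of_nat_diff)
      then have "(2 ^ n) powr (s - 2 * real j) = (2 ^ n) ^ (2 * (m - j))"
        by (simp only: powr_realpow zero_less_power zero_less_numeral)
      also have "\<dots> = ((2::real) ^ 2) ^ ((m - j) * n)"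
        by (simp only: power_mult[symmetric] mult_ac)
      also have "\<dots> = (4 ^ (m - j)) ^ n" by (simp add: power_mult)
      finally show "zeta_coeff s (m - (m - j)) * (4 ^ (m - j)) ^ n = zeta_coeff s j * (2 ^ n) powr (s - 2 * real j)"
        using j by simp
    qed auto
    finally show ?thesis .
  qed
  \<comment> \<open>\<open>None\<close> stands for the linear term, \<open>Some k\<close> for the power \<open>4 ^ k\<close>\<close>
  let ?r = "\<lambda>k. case k of None \<Rightarrow> 2 | Some k \<Rightarrow> (4::real) ^ k"
  let ?d = "\<lambda>k. case k of None \<Rightarrow> - \<kappa> * c | Some k \<Rightarrow> d k - \<kappa> * zeta_coeff s (m - k)"
  let ?I = "insert None (Some ` {1..m})"
  have R: "dyadic_remainder s c n = (\<Sum>k\<in>?I. ?d k * ?r k ^ n)" for n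
    unfolding dyadic_remainder_def d fl main \<kappa>_def[symmetric]
    by (subst sum.insert) (auto simp: sum.reindex algebra_simps sum_subtractf sum_distrib_left)
  have inj: "inj_on ?r ?I"
  proof (rule inj_onI)
    have ne: "(2::real) \<noteq> 4 ^ k" if "k \<ge> 1" for k :: nat
      using power_increasing[of 1 k "4::real"] that by auto
    fix x y assume "x \<in> ?I" "y \<in> ?I" "?r x = ?r y"
    then show "x = y" using ne ne[symmetric] by (cases x; cases y) auto
  qed
  have z: "?d k = 0" if "k \<in> ?I" for k
  proof (rule geometric_independence[where K = ?I and r = ?r and d = ?d])
    show "(\<lambda>n. \<Sum>k\<in>?I. ?d k * ?r k ^ n) \<longlonglongrightarrow> 0"
      using lim unfolding ext[of "dyadic_remainder s c", OF R] .
  qed (use inj that in auto)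
  show "c = 0" using z[of None] \<kappa> by simp
  show "dyadic_remainder s c n = 0"
    unfolding R
  proof (intro sum.neutral ballI)
    fix k assume "k \<in> ?I"
    then show "?d k * ?r k ^ n = 0" using z[of k] by (simp only: mult_zero_left)
  qed
qed

lemma chord_const_even:
  assumes "m \<ge> 1"
  shows "chord_const (real (2 * m)) = 0"
proof -
  have "1 - real (2 * m) / 2 = - real (m - 1)" using assms by (simp add: of_nat_diff)
  then have "rGamma (1 - real (2 * m) / 2) = 0" by (simp only: rGamma_neg_of_nat)
  then show ?thesis by (simp add: chord_const_def)
qed

text \<open>For even \<open>s\<close> the two constants agree because both are \<open>0\<close>, for other \<open>s\<close> by \<open>singular_const_eq\<close>.\<close>

lemma chord_const_remainder:
  assumes s: "s > 0" and odd: "\<And>k::nat. s \<noteq> 2 * real k + 1"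
  obtains B r where "0 \<le> r" "r < 1" "\<And>n. \<bar>dyadic_remainder s (chord_const s) n\<bar> \<le> B * r ^ n"
    "(\<exists>m::nat. s = 2 * real m) \<longrightarrow> (\<forall>n. dyadic_remainder s (chord_const s) n = 0)"
proof -
  let ?K = "Suc (nat \<lfloor>s / 2\<rfloor>)"
  obtain B r where r: "0 \<le> r" "r < 1" and B: "\<And>n. \<bar>dyadic_remainder s (singular_const s ?K) n\<bar> \<le> B * r ^ n"
    by (rule dyadic_remainder_decay[OF s odd]) (rule that; assumption)
  show ?thesis
  proof (cases "\<exists>m::nat. s = 2 * real m")
    case True
    then obtain m :: nat where sm: "s = real (2 * m)" by auto
    then have m: "m \<ge> 1" using s by (cases m) auto
    have "(\<lambda>n. B * r ^ n) \<longlonglongrightarrow> B * 0" using r by (intro tendsto_intros LIMSEQ_realpow_zero) auto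
    then have lim: "(\<lambda>n. B * r ^ n) \<longlonglongrightarrow> 0" by simp
    have "dyadic_remainder s (singular_const s ?K) \<longlonglongrightarrow> 0"
      by (rule Lim_null_comparison[OF always_eventually lim]) (simp add: B)
    note * = dyadic_remainder_even[OF m sm this]
    have "chord_const s = singular_const s ?K" using *(1) chord_const_even[OF m] by (simp add: sm)
    then show ?thesis using that[OF r, of B] B *(2) by simp
  next
    case False
    have "s / 2 < real (nat \<lfloor>s / 2\<rfloor>) + 1"
      using real_of_int_floor_add_one_gt[of "s / 2"] s by simp
    then have "s / 2 < real ?K" by simp
    from mult_strict_left_mono[OF this, of 2] have "2 * real ?K - s > 0" by simp
    then have "singular_const s ?K = chord_const s"
      using False by (intro singular_const_eq s odd) auto
    then show ?thesis using that[OF r, of B] B False by simp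
  qed
qed

lemma v_eq_chord_const: "v (of_real s) = of_real (2 * (2 * pi) powr - s * chord_const s)"
proof -
  have "v (of_real s) = of_real (2 powr - s * Gamma ((1 - s) / 2) * rGamma (1 - s / 2) / sqrt pi)"
    unfolding v_def
    by (simp add: powr_of_real[symmetric] flip: Gamma_complex_of_real rGamma_complex_of_real)
  moreover have "2 * (2 * pi) powr - s * chord_const s = 2 powr - s * Gamma ((1 - s) / 2) * rGamma (1 - s / 2) / sqrt pi"
  proof -
    have "(2 * pi) powr - s * pi powr s = 2 powr - s" by (simp add: powr_mult powr_minus)
    then show ?thesis unfolding chord_const_def
      by (simp add: mult.assoc[symmetric])
  qed
  ultimately show ?thesis by simp
qed

lemma sum_bits: "(\<Sum>k | bit N k. 2 ^ k) = N" for N :: nat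
proof (induction N rule: less_induct)
  case (less N)
  show ?case
  proof (cases "N = 0")
    case False
    then obtain n where n: "2 ^ n \<le> N" "N < 2 ^ Suc n" using ex_power_ivl1[of 2 N] by auto
    have "(\<Sum>k | bit N k. 2 ^ k) = 2 ^ n + (\<Sum>k | bit (N - 2 ^ n) k. 2 ^ k)"
      using bit_high[OF n] finite_bits[of "N - 2 ^ n"] by simp
    also have "\<dots> = N" using less.IH[of "N - 2 ^ n"] n False by simp
    finally show ?thesis .
  qed simp
qed

text \<open>The normalisation of \<open>eta\<close> cancels, which leaves a sum over the binary digits.\<close>

lemma G_eta:
  assumes "N \<ge> 1"
  shows "G (eta N) t * real N powr t = (\<Sum>k | bit N k. (2 ^ k) powr t)"
proof -
  have "G (eta N) t = (\<Sum>k\<leftarrow>binary_exponents N. (2 ^ k / real N) powr t)"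
    by (simp add: G_def eta_def o_def)
  also have "\<dots> = (\<Sum>k | bit N k. (2 ^ k / real N) powr t)"
    using finite_bits[of N] by (subst sum_list_distinct_conv_sum_set) (auto simp: binary_exponents_def)
  finally show ?thesis using assms by (simp add: sum_distrib_right powr_divide)
qed

text \<open>At \<open>s = 2 j\<close> the value \<open>\<zeta>(0)\<close> is not known to be real from \<open>zeta_partial_sums\<close>, but its factor is \<open>0\<close>.\<close>

lemma zeta_coeff_complex:
  assumes "s \<ge> 2 * real j" "s \<noteq> 2 * real j + 1"
  shows "alpha (of_real s) j * riemann_zeta (of_real (s - 2 * real j)) * of_real ((2 powr (s - 2 * real j) - 1) * x * y)
    = of_real (zeta_coeff s j * (x * y))"
proof (cases "s = 2 * real j")
  case True
  then show ?thesis by (simp add: zeta_coeff_def)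
next
  case False
  then have "riemann_zeta (of_real (s - 2 * real j)) \<in> \<real>"
    using assms by (intro zeta_partial_sums(2)) auto
  then obtain z where z: "riemann_zeta (of_real (s - 2 * real j)) = of_real z" by (elim Reals_cases)
  show ?thesis unfolding zeta_coeff_def alpha_eq_alpha_re z by (simp add: mult_ac)
qed

theorem theorem1p4:
  fixes s :: real and a :: "nat \<Rightarrow> complex"
  assumes "s > 0"
    and "\<And>k::nat. s \<noteq> 2 * real k + 1"
    and "greedy_energy_seq s a"
  shows "\<exists>H :: nat \<Rightarrow> real.
      (\<forall>N\<ge>1. \<exists>u :: real. potential s a N (a N) = ereal u \<and>
         complex_of_real u =
           v (of_real s) * of_nat N
           + 2 / of_real ((2 * pi) powr s) *
             (\<Sum>j = 0..nat \<lfloor>s / 2\<rfloor>.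
                alpha (of_real s) j * riemann_zeta (of_real (s - 2 * real j))
                * of_real ((2 powr (s - 2 * real j) - 1) * G (eta N) (s - 2 * real j)
                           * real N powr (s - 2 * real j)))
           + of_real (H N))
      \<and> bounded (H ` {1..})
      \<and> ((\<exists>m::nat. s = 2 * real m) \<longrightarrow> v (of_real s) = 0 \<and> (\<forall>N\<ge>1. H N = 0))"
proof -
  obtain B r where r: "0 \<le> r" "r < 1" and B: "\<And>n. \<bar>dyadic_remainder s (chord_const s) n\<bar> \<le> B * r ^ n"
    and even: "(\<exists>m::nat. s = 2 * real m) \<longrightarrow> (\<forall>n. dyadic_remainder s (chord_const s) n = 0)"
    by (rule chord_const_remainder[OF assms(1,2)]) (rule that; assumption)
  define R where "R = dyadic_remainder s (chord_const s)"
  define H where "H N = (\<Sum>k | bit N k. R k)" for N :: nat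
  define \<kappa> where "\<kappa> = 2 * (2 * pi) powr - s"
  let ?J = "nat \<lfloor>s / 2\<rfloor>"
  have B0: "B \<ge> 0" using B[of 0] by simp
  have "\<bar>H N\<bar> \<le> B * (1 / (1 - r))" for N
  proof -
    have "\<bar>H N\<bar> \<le> (\<Sum>k | bit N k. \<bar>R k\<bar>)" unfolding H_def by (rule sum_abs)
    also have "\<dots> \<le> (\<Sum>k | bit N k. B * r ^ k)" by (intro sum_mono) (simp add: R_def B)
    also have "\<dots> = B * (\<Sum>k | bit N k. r ^ k)" by (simp add: sum_distrib_left)
    also have "(\<Sum>k | bit N k. r ^ k) \<le> (\<Sum>k. r ^ k)"
      using r finite_bits by (intro sum_le_suminf) (auto intro: summable_geometric)
    also have "(\<Sum>k. r ^ k) = 1 / (1 - r)" using r by (intro suminf_geometric) auto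
    finally show ?thesis using B0 by (simp add: mult_left_mono)
  qed
  then have bdd: "bounded (H ` {1..})" unfolding bounded_iff by (intro exI[of _ "B * (1 / (1 - r))"]) auto
  have J: "s \<ge> 2 * real j" if "j \<in> {0..?J}" for j
  proof -
    have "real j \<le> real ?J" using that by simp
    also have "\<dots> = of_int \<lfloor>s / 2\<rfloor>" using assms(1) by simp
    also have "\<dots> \<le> s / 2" by (rule of_int_floor_le)
    finally show ?thesis by simp
  qed
  have expansion: "\<exists>u :: real. potential s a N (a N) = ereal u \<and>
         complex_of_real u =
           v (of_real s) * of_nat N
           + 2 / of_real ((2 * pi) powr s) *
             (\<Sum>j = 0..?J.
                alpha (of_real s) j * riemann_zeta (of_real (s - 2 * real j))
                * of_real ((2 powr (s - 2 * real j) - 1) * G (eta N) (s - 2 * real j)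
                           * real N powr (s - 2 * real j)))
           + of_real (H N)" if N: "N \<ge> 1" for N
  proof -
    define u where "u = (\<Sum>k | bit N k. midpoint_energy s (2 ^ k))"
    have pot: "potential s a N (a N) = ereal u"
      unfolding u_def by (rule greedy_potential[OF assms(1) greedy_energy_seq_prefix[OF assms(3)]])
    have "u = (\<Sum>k | bit N k. \<kappa> * chord_const s * 2 ^ k
        + \<kappa> * (\<Sum>j = 0..?J. zeta_coeff s j * (2 ^ k) powr (s - 2 * real j)) + R k)"
      unfolding u_def R_def dyadic_remainder_def \<kappa>_def by (simp add: algebra_simps atLeast0AtMost)
    also have "\<dots> = \<kappa> * chord_const s * (\<Sum>k | bit N k. 2 ^ k)
        + \<kappa> * (\<Sum>k | bit N k. \<Sum>j = 0..?J. zeta_coeff s j * (2 ^ k) powr (s - 2 * real j)) + H N"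
      by (simp add: sum.distrib sum_distrib_left H_def)
    also have "(\<Sum>k | bit N k. 2 ^ k) = real N"
      using arg_cong[OF sum_bits[of N], of real] by simp
    also have "(\<Sum>k | bit N k. \<Sum>j = 0..?J. zeta_coeff s j * (2 ^ k) powr (s - 2 * real j))
       = (\<Sum>j = 0..?J. zeta_coeff s j * (G (eta N) (s - 2 * real j) * real N powr (s - 2 * real j)))"
      unfolding G_eta[OF N] by (subst sum.swap) (simp add: sum_distrib_left)
    finally have u: "u = \<kappa> * chord_const s * real N
       + \<kappa> * (\<Sum>j = 0..?J. zeta_coeff s j * (G (eta N) (s - 2 * real j) * real N powr (s - 2 * real j))) + H N" .
    have "(\<Sum>j = 0..?J. alpha (of_real s) j * riemann_zeta (of_real (s - 2 * real j))
                * of_real ((2 powr (s - 2 * real j) - 1) * G (eta N) (s - 2 * real j)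
                           * real N powr (s - 2 * real j)))
        = complex_of_real (\<Sum>j = 0..?J. zeta_coeff s j * (G (eta N) (s - 2 * real j) * real N powr (s - 2 * real j)))"
      unfolding of_real_sum by (intro sum.cong refl zeta_coeff_complex J assms(2))
    moreover have "2 / complex_of_real ((2 * pi) powr s) = of_real \<kappa>"
      by (simp add: \<kappa>_def powr_minus_divide)
    moreover have "v (of_real s) = of_real (\<kappa> * chord_const s)"
      unfolding \<kappa>_def by (rule v_eq_chord_const)
    ultimately have "complex_of_real u = v (of_real s) * of_nat N
           + 2 / of_real ((2 * pi) powr s) *
             (\<Sum>j = 0..?J.
                alpha (of_real s) j * riemann_zeta (of_real (s - 2 * real j))
                * of_real ((2 powr (s - 2 * real j) - 1) * G (eta N) (s - 2 * real j)
                           * real N powr (s - 2 * real j)))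
           + of_real (H N)"
      by (simp only: u of_real_add of_real_mult of_real_of_nat_eq)
    with pot show ?thesis by blast
  qed
  have "v (of_real s) = 0 \<and> (\<forall>N\<ge>1. H N = 0)" if ev: "\<exists>m::nat. s = 2 * real m"
  proof -
    obtain m :: nat where m: "s = real (2 * m)" using ev by auto
    then have "m \<ge> 1" using assms(1) by (cases m) auto
    then have "chord_const s = 0" unfolding m by (rule chord_const_even)
    then show ?thesis using even ev by (simp add: v_eq_chord_const H_def R_def)
  qed
  with expansion bdd show ?thesis by blast
qed

end
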